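(* Let $n\ge2$, $1\le k\le n-1$, $\alpha_1,\alpha_2,\gamma_1,\gamma_2\in\mathbb{R}$, $p\ge\max\{1,1+\alpha_2\}$ with $p>1+\alpha_2$ when $\alpha_2>0$, and assume $\gamma_1>0$ if $p=\frac{\alpha_1+n}{k}$. Consider $$\|\sin^{\gamma_1}d(0,\cdot)\cos^{\gamma_2}d(0,\cdot)\,R_kf\|_{L^\infty(\Xi_k(\mathbb{S}^n))}\le C\|f\|_{L^p_{\alpha_1,\alpha_2}(\mathbb{S}^n)}\quad\text{for all even radial }f\in L^p_{\alpha_1,\alpha_2}(\mathbb{S}^n).\qquad( * )$$ (A) If $k\ge2$, $( * )$ holds if and only if $\gamma_1\ge\max\{0,\frac{\alpha_1+n}{p}-k\}$ and $\gamma_2\ge\frac{1+\alpha_2}{p}$. (B) If $k=1$, $( * )$ holds if and only if these conditions hold and $p>2$.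
   Context: $\mathbb{S}^n\subset\mathbb{R}^{n+1}$ unit sphere with origin $0:=e_{n+1}$, distance $d$, surface measure $dx$. $\Xi_k(\mathbb{S}^n)$: $k$-dimensional totally geodesic submanifolds (intersections with $(k+1)$-dimensional linear subspaces) at distance $d(0,\xi)<\pi/2$ from $e_{n+1}$, with its rotation-invariant measure ($L^\infty$ = essential supremum). $R_kf(\xi)=\int_\xi f\,d_\xi x$. $\|f\|^p_{L^p_{\alpha_1,\alpha_2}(\mathbb{S}^n)}=\int|f(x)|^p\sin^{\alpha_1}d(0,x)|\cos d(0,x)|^{\alpha_2}dx$. Even radial: $f(x)=F(|x_{n+1}|)$. $C$ independent of $f$. *)

theory Defs
  imports "HOL-Probability.Probability"
begin

text \<open>Euclidean space R^m is modelled as extensional functions on {..<m}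
  (coordinates 0..m-1) with the product Lebesgue measure.  R^(n+1) has coordinates
  0..n, so the paper's e_(n+1) is the coordinate n.\<close>

definition Rn :: "nat \<Rightarrow> (nat \<Rightarrow> real) measure" where
  "Rn m = (\<Pi>\<^sub>M i\<in>{..<m}. lborel)"

definition ip :: "nat \<Rightarrow> (nat \<Rightarrow> real) \<Rightarrow> (nat \<Rightarrow> real) \<Rightarrow> real" where
  "ip m x y = (\<Sum>i<m. x i * y i)"

definition sph :: "nat \<Rightarrow> (nat \<Rightarrow> real) set" where
  "sph m = {x \<in> space (Rn m). ip m x x = 1}"

text \<open>Surface measure on S^(m-1) (cone construction):
  sigma(A) = m * Lebesgue {x : 0 < |x| <= 1, x/|x| \<in> A}.\<close>
definition surf :: "nat \<Rightarrow> (nat \<Rightarrow> real) measure" where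
  "surf m = scale_measure (of_nat m)
     (distr (restrict_space (Rn m) {x \<in> space (Rn m). 0 < ip m x x \<and> ip m x x \<le> 1})
            (restrict_space (Rn m) (sph m))
            (\<lambda>x. restrict (\<lambda>i. x i / sqrt (ip m x x)) {..<m}))"

definition orig :: "nat \<Rightarrow> (nat \<Rightarrow> real)" where
  "orig n = restrict (\<lambda>i. if i = n then 1 else 0) {..<Suc n}"

definition sdist :: "nat \<Rightarrow> (nat \<Rightarrow> real) \<Rightarrow> (nat \<Rightarrow> real) \<Rightarrow> real" where
  "sdist m x y = arccos (ip m x y)"

definition d0 :: "nat \<Rightarrow> (nat \<Rightarrow> real) \<Rightarrow> real" where
  "d0 n x = sdist (Suc n) (orig n) x"

definition d0set :: "nat \<Rightarrow> (nat \<Rightarrow> real) set \<Rightarrow> real" where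
  "d0set n \<xi> = Inf (d0 n ` \<xi>)"

definition emb :: "nat \<Rightarrow> nat \<Rightarrow> (nat \<Rightarrow> nat \<Rightarrow> real) \<Rightarrow> (nat \<Rightarrow> real) \<Rightarrow> (nat \<Rightarrow> real)" where
  "emb n k u c = restrict (\<lambda>i. \<Sum>j<Suc k. c j * u j i) {..<Suc n}"

definition onframe :: "nat \<Rightarrow> nat \<Rightarrow> (nat \<Rightarrow> nat \<Rightarrow> real) \<Rightarrow> bool" where
  "onframe n k u \<longleftrightarrow> (\<forall>j<Suc k. u j \<in> space (Rn (Suc n))) \<and>
     (\<forall>i<Suc k. \<forall>j<Suc k. ip (Suc n) (u i) (u j) = (if i = j then 1 else 0))"

definition gspan :: "nat \<Rightarrow> nat \<Rightarrow> (nat \<Rightarrow> nat \<Rightarrow> real) \<Rightarrow> (nat \<Rightarrow> real) set" where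
  "gspan n k u = sph (Suc n) \<inter> range (emb n k u)"

text \<open>Xi_k(S^n): k-dimensional totally geodesic submanifolds (intersections of S^n with
  (k+1)-dimensional linear subspaces, given by an orthonormal basis) with d(0,xi) < pi/2.\<close>
definition Xi :: "nat \<Rightarrow> nat \<Rightarrow> (nat \<Rightarrow> real) set set" where
  "Xi n k = {\<xi>. (\<exists>u. onframe n k u \<and> \<xi> = gspan n k u) \<and> d0set n \<xi> < pi / 2}"

text \<open>Rotation-invariant measure on Xi_k: the image of the (unnormalised) standard Gaussian
  measure on (k+1)-tuples of vectors of R^(n+1) under A |-> S^n \<inter> span(A).\<close>
definition frames :: "nat \<Rightarrow> nat \<Rightarrow> (nat \<Rightarrow> nat \<Rightarrow> real) measure" where
  "frames n k = density (\<Pi>\<^sub>M j\<in>{..<Suc k}. Rn (Suc n))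
     (\<lambda>A. ennreal (exp (- (\<Sum>j<Suc k. \<Sum>i<Suc n. (A j i)\<^sup>2) / 2)))"

definition Xi_measure :: "nat \<Rightarrow> nat \<Rightarrow> (nat \<Rightarrow> real) set measure" where
  "Xi_measure n k = distr (frames n k)
     (sigma (Xi n k) {E. E \<subseteq> Xi n k \<and> gspan n k -` E \<inter> space (frames n k) \<in> sets (frames n k)})
     (gspan n k)"

text \<open>Radon transform R_k f(xi) = integral of f over xi w.r.t. the k-dimensional surface
  measure of xi (image of the surface measure of S^k under an orthonormal frame of xi).\<close>
definition frame_of :: "nat \<Rightarrow> nat \<Rightarrow> (nat \<Rightarrow> real) set \<Rightarrow> (nat \<Rightarrow> nat \<Rightarrow> real)" where
  "frame_of n k \<xi> = (SOME u. onframe n k u \<and> gspan n k u = \<xi>)"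

definition Rk_integrable :: "nat \<Rightarrow> nat \<Rightarrow> ((nat \<Rightarrow> real) \<Rightarrow> real) \<Rightarrow> (nat \<Rightarrow> real) set \<Rightarrow> bool" where
  "Rk_integrable n k f \<xi> = integrable (surf (Suc k)) (\<lambda>c. f (emb n k (frame_of n k \<xi>) c))"

definition Rk :: "nat \<Rightarrow> nat \<Rightarrow> ((nat \<Rightarrow> real) \<Rightarrow> real) \<Rightarrow> (nat \<Rightarrow> real) set \<Rightarrow> real" where
  "Rk n k f \<xi> = (\<integral>c. f (emb n k (frame_of n k \<xi>) c) \<partial>surf (Suc k))"

definition wLp_pow :: "nat \<Rightarrow> real \<Rightarrow> real \<Rightarrow> real \<Rightarrow> ((nat \<Rightarrow> real) \<Rightarrow> real) \<Rightarrow> ennreal" where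
  "wLp_pow n a1 a2 p f = (\<integral>\<^sup>+ x. ennreal (\<bar>f x\<bar> powr p * sin (d0 n x) powr a1
       * \<bar>cos (d0 n x)\<bar> powr a2) \<partial>surf (Suc n))"

definition wLp_norm :: "nat \<Rightarrow> real \<Rightarrow> real \<Rightarrow> real \<Rightarrow> ((nat \<Rightarrow> real) \<Rightarrow> real) \<Rightarrow> real" where
  "wLp_norm n a1 a2 p f = enn2real (wLp_pow n a1 a2 p f) powr (1 / p)"

definition even_radial :: "nat \<Rightarrow> ((nat \<Rightarrow> real) \<Rightarrow> real) \<Rightarrow> bool" where
  "even_radial n f \<longleftrightarrow> (\<forall>x\<in>sph (Suc n). \<forall>y\<in>sph (Suc n). \<bar>x n\<bar> = \<bar>y n\<bar> \<longrightarrow> f x = f y)"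

definition ineq_star :: "nat \<Rightarrow> nat \<Rightarrow> real \<Rightarrow> real \<Rightarrow> real \<Rightarrow> real \<Rightarrow> real \<Rightarrow> bool" where
  "ineq_star n k a1 a2 g1 g2 p \<longleftrightarrow>
    (\<exists>C::real. \<forall>f. f \<in> borel_measurable (surf (Suc n)) \<longrightarrow> even_radial n f \<longrightarrow>
        wLp_pow n a1 a2 p f < \<infinity> \<longrightarrow>
        (AE \<xi> in Xi_measure n k. Rk_integrable n k f \<xi>) \<and>
        esssup (Xi_measure n k)
          (\<lambda>\<xi>. ereal \<bar>sin (d0set n \<xi>) powr g1 * cos (d0set n \<xi>) powr g2 * Rk n k f \<xi>\<bar>)
          \<le> ereal (C * wLp_norm n a1 a2 p f))"

end

theory Submission
  imports Defs
begin

text \<open>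
  For an even radial function \<open>f(x) = F(|x\<^sub>n|)\<close> both sides of the inequality are one-dimensional.
  Slicing the sphere by a linear functional shows that \<open>R\<^sub>k f(\<xi>)\<close> depends only on
  \<open>\<rho> = cos d(0,\<xi>)\<close> and equals a constant times the integral of
  \<open>F(\<rho> t) (1 - t\<^sup>2)\<^bsup>k/2-1\<^esup>\<close> over \<open>0 < t < 1\<close>, while the weighted norm is that of \<open>F\<close> for the
  weight \<open>(1 - t\<^sup>2)\<^bsup>(\<alpha>\<^sub>1+n)/2-1\<^esup> t\<^bsup>\<alpha>\<^sub>2\<^esup>\<close>. By Hoelder's inequality the best constant for a fixed
  \<open>\<rho>\<close> is a dual norm of the kernel: its behaviour as \<open>\<rho>\<close> tends to 0 and to 1 gives the conditions on
  \<open>\<gamma>\<^sub>2\<close> and \<open>\<gamma>\<^sub>1\<close>, and for \<open>k = 1\<close> it is finite only if \<open>p > 2\<close>. Indicator functions of short intervals show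
  that the conditions are necessary. On the geometric side one needs that \<open>\<rho>\<close> is measurable
  (through Gram--Schmidt), that \<open>\<rho> < 1\<close> almost everywhere, and that every interval of values
  of \<open>\<rho>\<close> has positive measure.\<close>

section \<open>Integration over Euclidean space\<close>

text \<open>For \<open>p > 1\<close> the dual norm at height \<rho> is governed by the integral of
  \<open>(1 - t\<^sup>2) powr a * t powr b * (1 - \<rho>\<^sup>2 * t\<^sup>2) powr (-
  \<beta>)\<close>. As \<rho> tends to 1 it grows like the power \<open>\<beta> - a - 1\<close> of
  \<open>1 / (1 - \<rho>\<^sup>2)\<close> if that exponent, a positive multiple of
  \<open>(a1 + n) / p - k\<close>, is positive, and logarithmically if it is zero. A logarithm is
  absorbed only by \<open>g1 > 0\<close>, whence the extra assumption at
  \<open>p = (a1 + n) / k\<close>. In the converse direction the essential supremum never gives the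
  inequality at a chosen section, only at some section in each interval of heights. Every test
  function is therefore estimated uniformly for \<rho> in a short interval to the right of its
  support. Surface measure is a cone measure and a section is known through an unspecified
  orthonormal frame. One fact serves both: the distribution of a linear form on the sphere depends
  only on the norm of its coefficients. Of the measure on sections only the null sets matter, so the
  Gaussian density drops out at once.\<close>

lemma space_Rn: "space (Rn m) = extensional {..<m}"
  by (simp add: Rn_def space_PiM PiE_UNIV_domain PiE_def)

lemma sets_Rn [measurable_cong]: "sets (Rn m) = sets (\<Pi>\<^sub>M i\<in>{..<m}. borel)"
  unfolding Rn_def by (intro sets_PiM_cong) auto

lemma measurable_Rn_component:
  "i < m \<Longrightarrow> (\<lambda>x. x i) \<in> borel_measurable (Rn m)"
  unfolding Rn_def by measurable

lemma borel_measurable_ip [measurable (raw)]: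
  assumes "\<And>i. i < m \<Longrightarrow> (\<lambda>x. f x i) \<in> borel_measurable M"
    and "\<And>i. i < m \<Longrightarrow> (\<lambda>x. g x i) \<in> borel_measurable M"
  shows "(\<lambda>x. ip m (f x) (g x)) \<in> borel_measurable M"
  unfolding ip_def using assms by (intro borel_measurable_sum borel_measurable_times) auto

lemma measurable_into_Rn:
  assumes "\<And>i. i < m \<Longrightarrow> (\<lambda>x. f x i) \<in> borel_measurable M"
    and "\<And>x. x \<in> space M \<Longrightarrow> f x \<in> extensional {..<m}"
  shows "f \<in> measurable M (Rn m)"
  unfolding Rn_def
  by (rule measurable_PiM_single') (use assms in \<open>auto simp: PiE_def\<close>)

lemma ip_commute: "ip m x y = ip m y x"
  by (simp add: ip_def mult.commute)

lemma ip_nonneg [simp]: "0 \<le> ip m x x"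
  by (simp add: ip_def sum_nonneg)

lemma ip_self_upd_last: "ip (Suc m) (y(m := t)) (y(m := t)) = ip m y y + t\<^sup>2"
  by (simp add: ip_def power2_eq_square)

interpretation lebP: product_sigma_finite "\<lambda>_::nat. lborel :: real measure" ..

section \<open>Substitutions in a single coordinate\<close>

lemma nn_integral_Rn_coord:
  assumes i: "i < m" and [measurable]: "f \<in> borel_measurable (Rn m)"
  shows "(\<integral>\<^sup>+x. f x \<partial>Rn m) =
    (\<integral>\<^sup>+x. (\<integral>\<^sup>+y. f (x(i := y)) \<partial>lborel) \<partial>(\<Pi>\<^sub>M j\<in>{..<m} - {i}. lborel))"
proof -
  have eq: "insert i ({..<m} - {i}) = {..<m}" using i by auto
  show ?thesis
    using lebP.product_nn_integral_insert[of "{..<m} - {i}" i f] assms(2)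
    by (simp add: eq Rn_def insert_absorb i)
qed

lemma nn_integral_Rn_Suc:
  assumes [measurable]: "f \<in> borel_measurable (Rn (Suc m))"
  shows "(\<integral>\<^sup>+x. f x \<partial>Rn (Suc m)) = (\<integral>\<^sup>+x. (\<integral>\<^sup>+y. f (x(m := y)) \<partial>lborel) \<partial>Rn m)"
  using nn_integral_Rn_coord[of m "Suc m" f] assms by (simp add: Rn_def lessThan_Suc)

lemma measurable_Rn_upd [measurable]:
  assumes "i < m" and [measurable]: "g \<in> borel_measurable (Rn m)"
  shows "(\<lambda>x. x(i := g x)) \<in> measurable (Rn m) (Rn m)"
proof (rule measurable_into_Rn)
  show "(\<lambda>x. (x(i := g x)) j) \<in> borel_measurable (Rn m)" if "j < m" for j
    using that by (cases "j = i") auto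
qed (use assms in \<open>auto simp: space_Rn extensional_def\<close>)

text \<open>All substitutions in space reduce to this one. Since \<open>h\<close> ignores
  \<open>x i\<close>, once the other coordinates are fixed by Fubini the map is affine in one real
  variable. Shears have \<open>c = 1\<close>; reflections and dilations have
  \<open>h = 0\<close>.\<close>

lemma nn_integral_Rn_affine:
  assumes i: "i < m" and f[measurable]: "f \<in> borel_measurable (Rn m)" and c: "c \<noteq> 0"
    and h[measurable]: "h \<in> borel_measurable (Rn m)" and hi: "\<And>x y. h (x(i := y)) = h x"
  shows "(\<integral>\<^sup>+x. f x \<partial>Rn m) = ennreal \<bar>c\<bar> * (\<integral>\<^sup>+x. f (x(i := h x + c * x i)) \<partial>Rn m)"
proof -
  let ?P = "\<Pi>\<^sub>M j\<in>{..<m} - {i}. lborel :: real measure"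
  have upd: "(\<lambda>y. x(i := y)) \<in> measurable lborel (Rn m)" if "x \<in> space ?P" for x
  proof (rule measurable_into_Rn)
    show "(\<lambda>y. (x(i := y)) j) \<in> borel_measurable lborel" if "j < m" for j
      using that by (cases "j = i") auto
  qed (use i that in \<open>auto simp: space_PiM PiE_def extensional_def\<close>)
  have [measurable]: "(\<lambda>x. f (x(i := h x + c * x i))) \<in> borel_measurable (Rn m)"
    by (rule measurable_compose[OF measurable_Rn_upd f]) (use i in \<open>auto intro!: borel_measurable_add borel_measurable_times measurable_Rn_component\<close>)
  have "(\<integral>\<^sup>+x. f x \<partial>Rn m) = (\<integral>\<^sup>+x. (\<integral>\<^sup>+y. f (x(i := y)) \<partial>lborel) \<partial>?P)"
    by (rule nn_integral_Rn_coord) (use i in auto)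
  also have "\<dots> = (\<integral>\<^sup>+x. \<bar>c\<bar> * (\<integral>\<^sup>+y. f (x(i := h x + c * y)) \<partial>lborel) \<partial>?P)"
  proof (rule nn_integral_cong)
    fix x assume x: "x \<in> space ?P"
    have [measurable]: "(\<lambda>y. f (x(i := y))) \<in> borel_measurable borel"
      using measurable_compose[OF upd[OF x] f] by simp
    show "(\<integral>\<^sup>+y. f (x(i := y)) \<partial>lborel) = \<bar>c\<bar> * (\<integral>\<^sup>+y. f (x(i := h x + c * y)) \<partial>lborel)"
      by (subst nn_integral_real_affine[OF _ c, where t="h x"]) auto
  qed
  also have "\<dots> = (\<integral>\<^sup>+x. (\<integral>\<^sup>+y. \<bar>c\<bar> * f ((x(i := y))(i := h (x(i := y)) + c * (x(i := y)) i)) \<partial>lborel) \<partial>?P)"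
  proof (rule nn_integral_cong)
    fix x assume x: "x \<in> space ?P"
    have [measurable]: "(\<lambda>y. f (x(i := y))) \<in> borel_measurable borel"
      using measurable_compose[OF upd[OF x] f] by simp
    have "(\<lambda>y. f (x(i := h x + c * y))) \<in> borel_measurable lborel"
      by (rule measurable_compose[where g="\<lambda>y. f (x(i := y))" and N=borel]) auto
    then show "\<bar>c\<bar> * (\<integral>\<^sup>+y. f (x(i := h x + c * y)) \<partial>lborel) =
      (\<integral>\<^sup>+y. \<bar>c\<bar> * f ((x(i := y))(i := h (x(i := y)) + c * (x(i := y)) i)) \<partial>lborel)"
      by (simp add: hi nn_integral_cmult)
  qed
  also have "\<dots> = (\<integral>\<^sup>+x. \<bar>c\<bar> * f (x(i := h x + c * x i)) \<partial>Rn m)"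
    by (subst nn_integral_Rn_coord[OF i]) auto
  finally show ?thesis by (simp add: nn_integral_cmult)
qed

section \<open>Rotation invariance for functions of a linear form and the norm\<close>

lemma nn_integral_Rn_shear:
  assumes "i < m" "j < m" "i \<noteq> j" "f \<in> borel_measurable (Rn m)"
  shows "(\<integral>\<^sup>+x. f (x(i := x i + a * x j)) \<partial>Rn m) = (\<integral>\<^sup>+x. f x \<partial>Rn m)"
  using nn_integral_Rn_affine[of i m f 1 "\<lambda>x. a * x j"] assms by (simp add: add.commute)

text \<open>A planar rotation by an angle other than \<open>\<pi>\<close> is a product of three shears.\<close>
lemma nn_integral_Rn_rotation:
  assumes il: "i < m" "l < m" "i \<noteq> l" and f[measurable]: "f \<in> borel_measurable (Rn m)"
    and cs: "c\<^sup>2 + s\<^sup>2 = 1" "c \<noteq> -1"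
  shows "(\<integral>\<^sup>+x. f (x(i := c * x i - s * x l, l := s * x i + c * x l)) \<partial>Rn m) = (\<integral>\<^sup>+x. f x \<partial>Rn m)"
proof -
  \<comment> \<open>With \<open>c\<close> and \<open>s\<close> the cosine and sine of an angle,
    \<open>a\<close> is minus the tangent of half of it. The outer shears use \<open>a\<close>, the
    middle one \<open>s\<close>; the excluded angle \<pi> is where \<open>a\<close> becomes
    infinite.\<close>
  define a where "a = - s / (1 + c)"
  have c1: "1 + c \<noteq> 0" using cs by auto
  have a1: "a * (1 + c) = - s" using c1 by (simp add: a_def)
  have "s * a * (1 + c) = s * (a * (1 + c))" by simp
  also have "\<dots> = (c - 1) * (1 + c)" using cs(1) unfolding a1 by (simp add: power2_eq_square algebra_simps)
  finally have "s * a * (1 + c) = (c - 1) * (1 + c)" .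
  then have a2: "s * a = c - 1" using c1 by simp
  define S1 where "S1 = (\<lambda>x::nat\<Rightarrow>real. x(i := x i + a * x l))"
  define S2 where "S2 = (\<lambda>x::nat\<Rightarrow>real. x(l := x l + s * x i))"
  have [measurable]: "S1 \<in> measurable (Rn m) (Rn m)" "S2 \<in> measurable (Rn m) (Rn m)"
    unfolding S1_def S2_def using il
    by (auto intro!: measurable_Rn_upd borel_measurable_add borel_measurable_times measurable_Rn_component)
  have S: "x(i := c * x i - s * x l, l := s * x i + c * x l) = S1 (S2 (S1 x))" for x
  proof -
    have "x l + s * (x i + a * x l) = x l + s * x i + (s * a) * x l" by (simp add: algebra_simps)
    then have 1: "c * x l + s * x i = x l + s * (x i + a * x l)"
      unfolding a2 by (simp add: algebra_simps)
    have "x i + a * x l + a * (x l + s * (x i + a * x l)) = x i + a * x l + a * (c * x l + s * x i)"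
      using 1 by simp
    also have "\<dots> = (1 + s * a) * x i + a * (1 + c) * x l" by (simp add: algebra_simps)
    also have "\<dots> = c * x i - s * x l" by (simp add: a1 a2)
    finally show ?thesis using 1 il by (auto simp: S1_def S2_def fun_eq_iff)
  qed
  have m: "(\<lambda>x. f (S1 (S2 x))) \<in> borel_measurable (Rn m)" "(\<lambda>x. f (S1 x)) \<in> borel_measurable (Rn m)"
    by measurable
  from S have "(\<integral>\<^sup>+x. f (x(i := c * x i - s * x l, l := s * x i + c * x l)) \<partial>Rn m)
      = (\<integral>\<^sup>+x. f (S1 (S2 (S1 x))) \<partial>Rn m)" by simp
  also have "\<dots> = (\<integral>\<^sup>+x. f (S1 (S2 x)) \<partial>Rn m)"
    using nn_integral_Rn_shear[OF il m(1), of a] unfolding S1_def by simp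
  also have "\<dots> = (\<integral>\<^sup>+x. f (S1 x) \<partial>Rn m)"
    using nn_integral_Rn_shear[OF il(2,1) il(3)[symmetric] m(2), of s] unfolding S2_def by simp
  also have "\<dots> = (\<integral>\<^sup>+x. f x \<partial>Rn m)"
    using nn_integral_Rn_shear[OF il f, of a] unfolding S1_def by simp
  finally show ?thesis .
qed

lemma ip_upd:
  assumes "i < m" "l < m" "i \<noteq> l"
  shows "ip m (x(i := a, l := b)) (y(i := a', l := b')) = ip m x y - x i * y i - x l * y l + a * a' + b * b'"
proof -
  have S: "{..<m} = insert i (insert l ({..<m} - {i,l}))" using assms by auto
  have "(\<Sum>j<m. (x(i := a, l := b)) j * (y(i := a', l := b')) j)
      = a * a' + b * b' + (\<Sum>j\<in>{..<m} - {i,l}. x j * y j)"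
    by (subst S) (use assms in simp)
  moreover have "(\<Sum>j<m. x j * y j) = x i * y i + x l * y l + (\<Sum>j\<in>{..<m} - {i,l}. x j * y j)"
    by (subst S) (use assms in simp)
  ultimately show ?thesis by (simp add: ip_def)
qed

text \<open>The rotation in the plane of coordinates \<open>i\<close> and \<open>l\<close> that
  clears \<open>w i\<close> and collects its length in \<open>w l\<close>. As \<open>w i\<close> is
  nonzero, so is the sine of the angle, which rules out the angle \<pi> that three shears cannot
  reach. Functions of the linear form and the norm are enough, because the cone construction of
  surface measure asks for nothing else.\<close>

lemma nn_integral_Rn_givens:
  fixes \<Phi> :: "real \<times> real \<Rightarrow> ennreal"
  assumes il: "i < m" "l < m" "i \<noteq> l" and [measurable]: "\<Phi> \<in> borel_measurable borel" and w: "w i \<noteq> 0"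
  shows "(\<integral>\<^sup>+x. \<Phi> (ip m x w, ip m x x) \<partial>Rn m)
    = (\<integral>\<^sup>+x. \<Phi> (ip m x (w(i := 0, l := sqrt ((w i)\<^sup>2 + (w l)\<^sup>2))), ip m x x) \<partial>Rn m)"
proof -
  define r where "r = sqrt ((w i)\<^sup>2 + (w l)\<^sup>2)"
  have rp: "r > 0" using w by (simp add: r_def sum_power2_gt_zero_iff)
  have r2: "r\<^sup>2 = (w i)\<^sup>2 + (w l)\<^sup>2" by (simp add: r_def)
  define c s where "c = w l / r" and "s = - w i / r"
  have cs: "c\<^sup>2 + s\<^sup>2 = 1"
    using rp r2 w by (simp add: c_def s_def power_divide add_divide_distrib[symmetric] add.commute)
  have "s \<noteq> 0" using w rp by (simp add: s_def)
  then have "c \<noteq> -1" using cs by auto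
  note rot = nn_integral_Rn_rotation[OF il _ cs this]
  have pair: "(\<lambda>x. (ip m x w, ip m x x)) \<in> borel_measurable (Rn m)" for w
    by measurable
  have "(\<integral>\<^sup>+x. \<Phi> (ip m x w, ip m x x) \<partial>Rn m) =
     (\<integral>\<^sup>+x. (\<lambda>x. \<Phi> (ip m x w, ip m x x)) (x(i := c * x i - s * x l, l := s * x i + c * x l)) \<partial>Rn m)"
    by (rule rot[symmetric]) measurable
  also have "\<dots> = (\<integral>\<^sup>+x. \<Phi> (ip m x (w(i := 0, l := r)), ip m x x) \<partial>Rn m)"
  proof (rule nn_integral_cong)
    fix x :: "nat \<Rightarrow> real"
    define x' where "x' = x(i := c * x i - s * x l, l := s * x i + c * x l)"
    have "ip m x' x' = ip m x x - x i * x i - x l * x l + (c\<^sup>2 + s\<^sup>2) * (x i * x i) + (c\<^sup>2 + s\<^sup>2) * (x l * x l)"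
      unfolding x'_def ip_upd[OF il] by (simp add: algebra_simps power2_eq_square)
    then have 1: "ip m x' x' = ip m x x" by (simp add: cs)
    have wi: "- s * r = w i" "c * r = w l" using rp by (auto simp: c_def s_def)
    have "ip m x' w = ip m x' (w(i := w i, l := w l))" by simp
    also have "\<dots> = ip m x w - x i * w i - x l * w l + x i * (c * w i + s * w l) + x l * (c * w l - s * w i)"
      unfolding x'_def ip_upd[OF il] by (simp add: algebra_simps)
    also have "c * w i + s * w l = 0" unfolding wi[symmetric] by simp
    also have "c * w l - s * w i = r * (c\<^sup>2 + s\<^sup>2)"
      unfolding wi[symmetric] by (simp add: algebra_simps power2_eq_square)
    finally have 2: "ip m x' w = ip m x w - x i * w i - x l * w l + x l * r" by (simp add: cs)
    have "ip m x (w(i := 0, l := r)) = ip m (x(i := x i, l := x l)) (w(i := 0, l := r))" by simp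
    also have "\<dots> = ip m x w - x i * w i - x l * w l + x l * r"
      unfolding ip_upd[OF il] by simp
    finally show "(\<lambda>x. \<Phi> (ip m x w, ip m x x)) (x(i := c * x i - s * x l, l := s * x i + c * x l))
       = \<Phi> (ip m x (w(i := 0, l := r)), ip m x x)"
      using 1 2 by (simp add: x'_def)
  qed
  finally show ?thesis by (simp add: r_def)
qed

text \<open>Induction on the number of nonzero coefficients before the last: each Givens rotation
  clears one and leaves the norm of \<open>w\<close> unchanged. What remains is a form in the last
  coordinate, whose coefficient may be negative; a reflection then repairs the sign.\<close>

lemma nn_integral_Rn_rotate_to_axis:
  fixes \<Phi> :: "real \<times> real \<Rightarrow> ennreal"
  assumes [measurable]: "\<Phi> \<in> borel_measurable borel"
  shows "(\<integral>\<^sup>+x. \<Phi> (ip (Suc m) x w, ip (Suc m) x x) \<partial>Rn (Suc m))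
    = (\<integral>\<^sup>+x. \<Phi> (sqrt (ip (Suc m) w w) * x m, ip (Suc m) x x) \<partial>Rn (Suc m))"
proof (induction "card {i. i < m \<and> w i \<noteq> 0}" arbitrary: w)
  case 0
  then have w0: "w i = 0" if "i < m" for i using that by auto
  have ipw: "ip (Suc m) x w = x m * w m" for x using w0 by (simp add: ip_def)
  have sq: "sqrt (ip (Suc m) w w) = \<bar>w m\<bar>" by (simp add: ipw)
  show ?case
  proof (cases "w m \<ge> 0")
    case True then show ?thesis by (simp only: ipw sq) (simp add: mult.commute)
  next
    case False
    have "(\<integral>\<^sup>+x. \<Phi> (x m * w m, ip (Suc m) x x) \<partial>Rn (Suc m)) = ennreal \<bar>-1\<bar> *
       (\<integral>\<^sup>+x. (\<lambda>x. \<Phi> (x m * w m, ip (Suc m) x x)) (x(m := 0 + (-1) * x m)) \<partial>Rn (Suc m))"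
      by (rule nn_integral_Rn_affine) (simp_all, measurable)
    also have "\<dots> = (\<integral>\<^sup>+x. \<Phi> (sqrt (ip (Suc m) w w) * x m, ip (Suc m) x x) \<partial>Rn (Suc m))"
    proof -
      have "ip (Suc m) (x(m := - x m)) (x(m := - x m)) = ip (Suc m) x x" for x
        by (simp add: ip_def)
      then show ?thesis unfolding sq using False by (simp add: mult.commute)
    qed
    finally show ?thesis by (simp only: ipw)
  qed
next
  case (Suc q)
  then obtain i where i: "i < m" "w i \<noteq> 0"
    by (metis (mono_tags, lifting) Collect_empty_eq card.empty nat.distinct(1))
  define w' where "w' = w(i := 0, m := sqrt ((w i)\<^sup>2 + (w m)\<^sup>2))"
  have "{j. j < m \<and> w' j \<noteq> 0} = {j. j < m \<and> w j \<noteq> 0} - {i}"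
    using i by (auto simp: w'_def)
  then have q: "q = card {j. j < m \<and> w' j \<noteq> 0}" using Suc(2) i by simp
  have sq: "sqrt ((w i)\<^sup>2 + (w m)\<^sup>2) * sqrt ((w i)\<^sup>2 + (w m)\<^sup>2) = (w i)\<^sup>2 + (w m)\<^sup>2"
    by simp
  have "ip (Suc m) w' w' = ip (Suc m) w w"
    unfolding w'_def using i by (subst ip_upd) (auto simp: sq power2_eq_square)
  then show ?case
    using nn_integral_Rn_givens[of i "Suc m" m \<Phi> w] i Suc(1)[OF q]
    unfolding w'_def[symmetric] by simp
qed

section \<open>Dilations, central projection and the moment of the unit ball\<close>

lemma nn_integral_Rn_scale:
  assumes r: "r > 0" and f: "f \<in> borel_measurable (Rn m)"
  shows "(\<integral>\<^sup>+x. f x \<partial>Rn m) = ennreal (r ^ m) * (\<integral>\<^sup>+x. f (\<lambda>i\<in>{..<m}. r * x i) \<partial>Rn m)"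
proof -
  \<comment> \<open>\<open>S j\<close> rescales only the coordinates below \<open>j\<close>, so that
    each induction step gains one factor \<open>r\<close> from a substitution in a single
    coordinate.\<close>
  define S where "S j x = (\<lambda>i\<in>{..<m}. (if i < j then r else 1) * x i)" for j and x :: "nat \<Rightarrow> real"
  have Sm [measurable]: "S j \<in> measurable (Rn m) (Rn m)" for j
    by (rule measurable_into_Rn) (auto simp: S_def)
  have main: "j \<le> m \<Longrightarrow> (\<integral>\<^sup>+x. f x \<partial>Rn m) = ennreal (r ^ j) * (\<integral>\<^sup>+x. f (S j x) \<partial>Rn m)" for j
  proof (induction j)
    case 0
    have "S 0 x = x" if "x \<in> space (Rn m)" for x
      using that by (auto simp: S_def space_Rn extensional_def fun_eq_iff)
    then show ?case by (simp cong: nn_integral_cong)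
  next
    case (Suc j)
    have fS: "(\<lambda>x. f (S j x)) \<in> borel_measurable (Rn m)"
      using measurable_compose[OF Sm f] .
    have 1: "(\<integral>\<^sup>+x. f (S j x) \<partial>Rn m) = ennreal \<bar>r\<bar> * (\<integral>\<^sup>+x. f (S j (x(j := 0 + r * x j))) \<partial>Rn m)"
      by (rule nn_integral_Rn_affine[OF _ fS]) (use Suc r in auto)
    have 2: "S j (x(j := 0 + r * x j)) = S (Suc j) x" for x
      using Suc.prems by (auto simp: S_def fun_eq_iff restrict_def less_Suc_eq)
    have "(\<integral>\<^sup>+x. f x \<partial>Rn m) = ennreal (r ^ j) * (ennreal \<bar>r\<bar> * (\<integral>\<^sup>+x. f (S (Suc j) x) \<partial>Rn m))"
      using Suc.IH Suc.prems unfolding 1 2 by simp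
    also have "\<dots> = ennreal (r ^ Suc j) * (\<integral>\<^sup>+x. f (S (Suc j) x) \<partial>Rn m)"
      using r by (simp add: ennreal_mult ac_simps)
    finally show ?case .
  qed
  have "S m = (\<lambda>x. \<lambda>i\<in>{..<m}. r * x i)" by (auto simp: S_def fun_eq_iff)
  then show ?thesis using main[of m] by simp
qed

lemma ip_scale: "ip m (\<lambda>i\<in>{..<m}. r * x i) (\<lambda>i\<in>{..<m}. r * x i) = r\<^sup>2 * ip m x x"
  by (simp add: ip_def sum_distrib_left power2_eq_square algebra_simps)

text \<open>If \<open>t\<close> is the slope of a vector, \<open>\<tau>\<close> is the height of its
  normalisation; the weight is the derivative of \<open>t\<close> in \<open>\<tau>\<close>. The
  proof compares two measures on intervals and uses uniqueness of Lebesgue measure, so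
  \<open>f\<close> need only be measurable.\<close>

lemma nn_integral_lborel_project:
  fixes f :: "real \<Rightarrow> ennreal"
  assumes [measurable]: "f \<in> borel_measurable borel"
  shows "(\<integral>\<^sup>+t. f t \<partial>lborel) =
    (\<integral>\<^sup>+\<tau>. ennreal (1 / ((1 - \<tau>\<^sup>2) * sqrt (1 - \<tau>\<^sup>2))) * indicator {-1<..<1} \<tau> * f (\<tau> / sqrt (1 - \<tau>\<^sup>2)) \<partial>lborel)"
proof -
  define w where "w \<tau> = 1 / ((1 - \<tau>\<^sup>2) * sqrt (1 - \<tau>\<^sup>2))" for \<tau> :: real
  define h where "h \<tau> = \<tau> / sqrt (1 - \<tau>\<^sup>2)" for \<tau> :: real
  define g where "g t = t / sqrt (1 + t\<^sup>2)" for t :: real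
  have [measurable]: "w \<in> borel_measurable borel" "h \<in> borel_measurable borel"
    unfolding w_def h_def by measurable
  have sq1: "\<tau>\<^sup>2 < 1" if "-1 < \<tau>" "\<tau> < 1" for \<tau> :: real
    using that abs_square_less_1[of \<tau>] by auto
  have pos: "1 + t\<^sup>2 > 0" for t :: real using zero_le_power2[of t] by linarith
  have g2: "1 - (g t)\<^sup>2 = 1 / (1 + t\<^sup>2)" for t
    using pos[of t] by (simp add: g_def power_divide field_simps)
  have hg: "h (g t) = t" for t
    using pos[of t] unfolding h_def g2 by (simp add: g_def real_sqrt_divide)
  have gb: "-1 < g t \<and> g t < 1" for t
  proof -
    have "0 < 1 - (g t)\<^sup>2" unfolding g2 using pos[of t] by simp
    then show ?thesis using abs_square_less_1[of "g t"] by auto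
  qed
  have der: "(h has_real_derivative w \<tau>) (at \<tau>)" if "-1 < \<tau>" "\<tau> < 1" for \<tau>
  proof -
    have p: "1 - \<tau>\<^sup>2 > 0" using sq1[OF that] by simp
    define s where "s = sqrt (1 - \<tau>\<^sup>2)"
    have s: "s > 0" "s\<^sup>2 = 1 - \<tau>\<^sup>2" using p by (auto simp: s_def)
    have "(h has_real_derivative (1 * s - \<tau> * ((- (2 * \<tau>)) * (inverse s / 2))) / (s * s)) (at \<tau>)"
      unfolding h_def s_def using p
      by (auto intro!: derivative_eq_intros simp: field_simps power2_eq_square)
    also have "(1 * s - \<tau> * ((- (2 * \<tau>)) * (inverse s / 2))) / (s * s) = (s\<^sup>2 + \<tau>\<^sup>2) / (s\<^sup>2 * s)"
      using s(1) by (simp add: field_simps power2_eq_square)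
    also have "\<dots> = w \<tau>" unfolding s(2) w_def by (simp add: s_def)
    finally show ?thesis .
  qed
  have wpos: "w \<tau> > 0" if "-1 < \<tau>" "\<tau> < 1" for \<tau>
    using sq1[OF that] by (simp add: w_def)
  have hmono: "h x < h y" if "-1 < x" "x < y" "y < 1" for x y
    using that by (intro DERIV_pos_imp_increasing[of x y h]) (auto intro!: exI der wpos)
  have h_less: "h x < h y \<longleftrightarrow> x < y" if "-1 < x" "x < 1" "-1 < y" "y < 1" for x y
    using hmono[of x y] hmono[of y x] that by (metis less_asym less_linear)
  let ?D = "density lborel (\<lambda>\<tau>. ennreal (w \<tau>) * indicator {-1<..<1} \<tau>)"
  have "lborel = distr ?D borel h"
  proof (rule lborel_eqI)
    fix l u :: real assume "\<And>b. b \<in> Basis \<Longrightarrow> l \<bullet> b \<le> u \<bullet> b"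
    then have lu: "l \<le> u" by simp
    have glu: "g l \<le> g u"
      using h_less[of "g u" "g l"] gb[of u] gb[of l] lu unfolding hg by (meson leI less_le_not_le)
    have ind: "indicator {-1<..<1} \<tau> * indicator (h -` {l<..<u}) \<tau> = (indicator {g l<..<g u} \<tau> :: ennreal)" for \<tau>
    proof -
      have "h \<tau> < h (g u) \<longleftrightarrow> \<tau> < g u" "h (g l) < h \<tau> \<longleftrightarrow> g l < \<tau>" if "-1 < \<tau>" "\<tau> < 1"
        using h_less that gb by blast+
      then show ?thesis using gb[of l] gb[of u] unfolding hg by (auto simp: indicator_def)
    qed
    have "emeasure (distr ?D borel h) (box l u) = emeasure ?D (h -` {l<..<u})"
      by (subst emeasure_distr) auto
    also have "\<dots> = (\<integral>\<^sup>+\<tau>. ennreal (w \<tau>) * indicator {-1<..<1} \<tau> * indicator (h -` {l<..<u}) \<tau> \<partial>lborel)"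
    proof (rule emeasure_density)
      have "h -` {l<..<u} \<inter> space borel \<in> sets borel" by measurable
      then show "h -` {l<..<u} \<in> sets lborel" by simp
    qed measurable
    also have "\<dots> = (\<integral>\<^sup>+\<tau>. ennreal (w \<tau>) * indicator {g l..g u} \<tau> \<partial>lborel)"
      unfolding mult.assoc ind
    proof (rule nn_integral_cong_AE, rule AE_I')
      show "{g l, g u} \<in> null_sets lborel" by (simp add: emeasure_lborel_countable null_setsI)
    qed (auto simp: indicator_def split: if_splits)
    also have "\<dots> = ennreal (h (g u) - h (g l))"
      by (rule nn_integral_FTC_Icc[OF _ _ _ glu]) (use gb[of l] gb[of u] in \<open>auto intro!: der less_imp_le wpos\<close>)
    finally show "emeasure (distr ?D borel h) (box l u) = (\<Prod>b\<in>Basis. (u - l) \<bullet> b)"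
      by (simp add: hg)
  qed simp
  then have "(\<integral>\<^sup>+t. f t \<partial>lborel) = (\<integral>\<^sup>+t. f t \<partial>distr ?D borel h)" by simp
  also have "\<dots> = (\<integral>\<^sup>+\<tau>. ennreal (w \<tau>) * indicator {-1<..<1} \<tau> * f (h \<tau>) \<partial>lborel)"
    by (subst nn_integral_distr) (auto simp: nn_integral_density)
  finally show ?thesis by (simp add: w_def h_def)
qed

text \<open>The first moment of the norm over the unit ball. The factor
  \<open>sqrt (ip m y y)\<close> is what remains when, in slicing a cone, the last coordinate is
  measured in units of the norm of the other \<open>m\<close>.\<close>

definition ball_moment :: "nat \<Rightarrow> ennreal" where
  "ball_moment m = (\<integral>\<^sup>+y. ennreal (sqrt (ip m y y)) * indicator {..1} (ip m y y) \<partial>Rn m)"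

lemma ball_moment_scaled:
  assumes q: "q > 0"
  shows "(\<integral>\<^sup>+y. ennreal (sqrt (ip m y y)) * indicator {..q\<^sup>2} (ip m y y) \<partial>Rn m) = ennreal (q ^ Suc m) * ball_moment m"
proof -
  have "(\<integral>\<^sup>+y. ennreal (sqrt (ip m y y)) * indicator {..q\<^sup>2} (ip m y y) \<partial>Rn m)
     = ennreal (q ^ m) * (\<integral>\<^sup>+x. ennreal (sqrt (q\<^sup>2 * ip m x x)) * indicator {..q\<^sup>2} (q\<^sup>2 * ip m x x) \<partial>Rn m)"
    by (subst nn_integral_Rn_scale[OF q]) (simp_all only: ip_scale, measurable)
  also have "(\<integral>\<^sup>+x. ennreal (sqrt (q\<^sup>2 * ip m x x)) * indicator {..q\<^sup>2} (q\<^sup>2 * ip m x x) \<partial>Rn m)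
     = (\<integral>\<^sup>+x. ennreal q * (ennreal (sqrt (ip m x x)) * indicator {..1} (ip m x x)) \<partial>Rn m)"
  proof (rule nn_integral_cong)
    fix x
    have "q\<^sup>2 * ip m x x \<le> q\<^sup>2 \<longleftrightarrow> ip m x x \<le> 1" using q by simp
    then show "ennreal (sqrt (q\<^sup>2 * ip m x x)) * indicator {..q\<^sup>2} (q\<^sup>2 * ip m x x)
      = ennreal q * (ennreal (sqrt (ip m x x)) * indicator {..1} (ip m x x))"
      using q by (auto simp: indicator_def real_sqrt_mult ennreal_mult)
  qed
  also have "\<dots> = ennreal q * ball_moment m"
    unfolding ball_moment_def by (rule nn_integral_cmult) measurable
  finally show ?thesis using q by (simp only: power_Suc ennreal_mult zero_le_power less_imp_le ac_simps)
qed

lemma emeasure_Rn_box: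
  "(\<And>i. i < m \<Longrightarrow> A i \<in> sets borel) \<Longrightarrow>
    emeasure (Rn m) (Pi\<^sub>E {..<m} A) = (\<Prod>i<m. emeasure lborel (A i))"
  unfolding Rn_def by (rule lebP.emeasure_PiM) auto

lemma sets_Rn_box:
  "(\<And>i. i < m \<Longrightarrow> A i \<in> sets borel) \<Longrightarrow> Pi\<^sub>E {..<m} A \<in> sets (Rn m)"
  unfolding Rn_def by (rule sets_PiM_I_finite) auto

lemma component_le_ip:
  assumes "i < m" shows "(x i)\<^sup>2 \<le> ip m x x"
proof -
  have "x i * x i \<le> (\<Sum>j<m. x j * x j)"
    using assms by (intro member_le_sum) auto
  then show ?thesis by (simp add: ip_def power2_eq_square)
qed

lemma ball_moment_less_top: "ball_moment m < \<infinity>"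
proof -
  have "ball_moment m \<le> (\<integral>\<^sup>+y. indicator (Pi\<^sub>E {..<m} (\<lambda>_. {-1..1})) y \<partial>Rn m)"
    unfolding ball_moment_def
  proof (rule nn_integral_mono)
    fix y assume y: "y \<in> space (Rn m)"
    have "y \<in> Pi\<^sub>E {..<m} (\<lambda>_. {-1..1})" if "ip m y y \<le> 1"
    proof -
      have "\<bar>y i\<bar> \<le> 1" if "i < m" for i
        using component_le_ip[OF that, of y] \<open>ip m y y \<le> 1\<close> abs_square_le_1[of "y i"] by auto
      then show ?thesis using y by (auto simp: space_Rn PiE_def abs_le_iff)
    qed
    then show "ennreal (sqrt (ip m y y)) * indicator {..1} (ip m y y) \<le> indicator (Pi\<^sub>E {..<m} (\<lambda>_. {-1..1})) y"
      by (auto simp: indicator_def)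
  qed
  also have "\<dots> = 2 ^ m"
    by (subst nn_integral_indicator) (auto simp: emeasure_Rn_box intro!: sets_Rn_box)
  also have "\<dots> < \<infinity>" by (simp add: power_less_top_ennreal)
  finally show ?thesis .
qed

lemma ball_moment_pos:
  assumes m: "m \<ge> 1" shows "ball_moment m > 0"
proof -
  \<comment> \<open>Each coordinate is at most \<open>1 / m\<close>, so this box lies in the unit
    ball, and the lower bound on one coordinate keeps the norm away from 0.\<close>
  define B where "B = Pi\<^sub>E {..<m} (\<lambda>_. {1 / (2 * real m)..1 / real m})"
  have "ennreal (1 / (2 * real m)) * emeasure (Rn m) B = (\<integral>\<^sup>+y. ennreal (1 / (2 * real m)) * indicator B y \<partial>Rn m)"
    unfolding B_def by (subst nn_integral_cmult_indicator) (auto intro!: sets_Rn_box)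
  also have "\<dots> \<le> ball_moment m"
    unfolding ball_moment_def
  proof (rule nn_integral_mono)
    fix y
    show "ennreal (1 / (2 * real m)) * indicator B y \<le> ennreal (sqrt (ip m y y)) * indicator {..1} (ip m y y)"
    proof (cases "y \<in> B")
      case True
      then have y: "1 / (2 * real m) \<le> y i" "y i \<le> 1 / real m" if "i < m" for i
        using that by (auto simp: B_def PiE_def Pi_def)
      have "ip m y y \<le> (\<Sum>i<m. (1 / real m) * 1)"
        unfolding ip_def
      proof (rule sum_mono)
        fix i assume "i \<in> {..<m}"
        then have i: "i < m" by simp
        have "1 / (2 * real m) \<ge> 0" "1 / real m \<le> 1" using m by auto
        then have "0 \<le> y i" "y i \<le> 1" using y[OF i] by linarith+
        then show "y i * y i \<le> (1 / real m) * 1" using y[OF i] by (intro mult_mono) auto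
      qed
      then have le: "ip m y y \<le> 1" using m by simp
      have "(1 / (2 * real m))\<^sup>2 \<le> (y 0)\<^sup>2" using y[of 0] m by (intro power_mono) auto
      also have "\<dots> \<le> ip m y y" using m by (intro component_le_ip) auto
      finally have "1 / (2 * real m) \<le> sqrt (ip m y y)" by (rule real_le_rsqrt)
      then show ?thesis using True le by (auto simp: ennreal_leI)
    qed auto
  qed
  finally have le: "ennreal (1 / (2 * real m)) * emeasure (Rn m) B \<le> ball_moment m" .
  have "emeasure (Rn m) B = ennreal (1 / real m - 1 / (2 * real m)) ^ m"
    unfolding B_def by (subst emeasure_Rn_box) (use m in \<open>auto simp: field_simps\<close>)
  also have "\<dots> = ennreal ((1 / real m - 1 / (2 * real m)) ^ m)"
    by (rule ennreal_power) (use m in \<open>simp add: field_simps\<close>)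
  also have "\<dots> > 0"
    using m by (simp add: field_simps)
  finally have "ennreal (1 / (2 * real m)) * emeasure (Rn m) B > 0"
    using m by (simp add: ennreal_zero_less_mult_iff)
  with le show ?thesis by simp
qed

section \<open>Slicing the sphere\<close>

lemma AE_Rn_ip_pos:
  assumes "m \<ge> 1" shows "AE y in Rn m. ip m y y > 0"
proof (rule AE_I')
  let ?Z = "Pi\<^sub>E {..<m} (\<lambda>_. {0::real})"
  have "emeasure (Rn m) ?Z = 0"
    using assms by (subst emeasure_Rn_box) auto
  then show "?Z \<in> null_sets (Rn m)" by (rule null_setsI) (rule sets_Rn_box, simp)
  show "{y \<in> space (Rn m). \<not> 0 < ip m y y} \<subseteq> ?Z"
  proof
    fix y assume "y \<in> {y \<in> space (Rn m). \<not> 0 < ip m y y}"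
    then have y: "y \<in> extensional {..<m}" "ip m y y = 0"
      using ip_nonneg[of m y] by (auto simp: space_Rn)
    have "y i = 0" if "i < m" for i
      using component_le_ip[OF that, of y] y(2) by simp
    then show "y \<in> ?Z" using y(1) by (auto simp: fun_eq_iff restrict_def extensional_def)
  qed
qed

lemma sets_surf: "sets (surf m) = sets (restrict_space (Rn m) (sph m))"
  by (simp add: surf_def)

lemma space_surf: "space (surf m) = sph m"
  by (auto simp: surf_def space_scale_measure space_restrict_space sph_def)

lemma nn_integral_surf:
  assumes g: "g \<in> borel_measurable (surf m)"
  shows "(\<integral>\<^sup>+x. g x \<partial>surf m) = of_nat m * (\<integral>\<^sup>+x. g (\<lambda>i\<in>{..<m}. x i / sqrt (ip m x x)) *
     indicator {x. 0 < ip m x x \<and> ip m x x \<le> 1} x \<partial>Rn m)"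
proof -
  let ?B = "{x \<in> space (Rn m). 0 < ip m x x \<and> ip m x x \<le> 1}"
  let ?N = "\<lambda>x. \<lambda>i\<in>{..<m}. x i / sqrt (ip m x x)"
  have B [measurable]: "?B \<in> sets (Rn m)" by measurable
  have N: "?N \<in> measurable (restrict_space (Rn m) ?B) (restrict_space (Rn m) (sph m))"
  proof (rule measurable_restrict_space2)
    show "?N \<in> space (restrict_space (Rn m) ?B) \<rightarrow> sph m"
    proof
      fix x assume "x \<in> space (restrict_space (Rn m) ?B)"
      then have x: "0 < ip m x x" by (auto simp: space_restrict_space)
      have "ip m (?N x) (?N x) = (\<Sum>i<m. x i * x i) / (sqrt (ip m x x))\<^sup>2"
        by (simp add: ip_def sum_divide_distrib power2_eq_square)
      also have "\<dots> = 1" using x by (simp add: ip_def)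
      finally show "?N x \<in> sph m" by (auto simp: sph_def space_Rn)
    qed
    have "?N \<in> measurable (Rn m) (Rn m)"
      by (rule measurable_into_Rn) auto
    then show "?N \<in> measurable (restrict_space (Rn m) ?B) (Rn m)"
      by (rule measurable_restrict_space1)
  qed
  have g': "g \<in> borel_measurable (restrict_space (Rn m) (sph m))"
    using g by (simp add: measurable_cong_sets[OF sets_surf refl])
  have "(\<integral>\<^sup>+x. g x \<partial>surf m) = of_nat m * (\<integral>\<^sup>+x. g (?N x) \<partial>restrict_space (Rn m) ?B)"
    unfolding surf_def by (subst nn_integral_scale_measure) (auto simp: g' nn_integral_distr[OF N])
  also have "(\<integral>\<^sup>+x. g (?N x) \<partial>restrict_space (Rn m) ?B) = (\<integral>\<^sup>+x. g (?N x) * indicator ?B x \<partial>Rn m)"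
    by (rule nn_integral_restrict_space) simp
  also have "\<dots> = (\<integral>\<^sup>+x. g (?N x) * indicator {x. 0 < ip m x x \<and> ip m x x \<le> 1} x \<partial>Rn m)"
    by (rule nn_integral_cong) (auto simp: indicator_def)
  finally show ?thesis .
qed

definition slice_const :: "nat \<Rightarrow> real" where
  "slice_const m = real (Suc m) * enn2real (ball_moment m)"

text \<open>The image of the surface measure of the unit sphere in \<open>\<real>\<^sup>m\<^sup>+\<^sup>1\<close> under a coordinate function.\<close>
definition slice_measure :: "nat \<Rightarrow> real measure" where
  "slice_measure m = density lborel (\<lambda>t. ennreal (slice_const m * (1 - t\<^sup>2) powr (real m / 2 - 1)) * indicator {-1<..<1} t)"

lemma slice_const_pos: "m \<ge> 1 \<Longrightarrow> slice_const m > 0"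
  using ball_moment_pos[of m] ball_moment_less_top[of m] by (simp add: slice_const_def enn2real_positive_iff)

text \<open>Write a vector as \<open>y\<close> with last coordinate \<open>t\<close> and substitute
  \<open>t = sqrt (ip m y y) * \<tau> / sqrt (1 - \<tau>\<^sup>2)\<close>. Then the normalised last
  coordinate is \<open>\<tau>\<close>, free of \<open>y\<close>, and lying in the unit ball becomes
  \<open>ip m y y \<le> 1 - \<tau>\<^sup>2\<close>. After exchanging the integrals, homogeneity of
  \<open>ball_moment\<close> contributes the power \<open>(m + 1) / 2\<close> of
  \<open>1 - \<tau>\<^sup>2\<close> and the substitution the power \<open>-3/2\<close>, together
  \<open>m / 2 - 1\<close>.\<close>

lemma nn_integral_cone_slice:
  fixes \<phi> :: "real \<Rightarrow> ennreal"
  assumes m: "m \<ge> 1" and \<phi> [measurable]: "\<phi> \<in> borel_measurable borel"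
  shows "of_nat (Suc m) * (\<integral>\<^sup>+x. \<phi> (x m / sqrt (ip (Suc m) x x)) *
     indicator {x. 0 < ip (Suc m) x x \<and> ip (Suc m) x x \<le> 1} x \<partial>Rn (Suc m)) = (\<integral>\<^sup>+t. \<phi> t \<partial>slice_measure m)"
proof -
  define w where "w \<tau> = 1 / ((1 - \<tau>\<^sup>2) * sqrt (1 - \<tau>\<^sup>2))" for \<tau> :: real
  have [measurable]: "w \<in> borel_measurable borel" unfolding w_def by measurable
  have sq1: "\<tau>\<^sup>2 < 1" if "-1 < \<tau>" "\<tau> < 1" for \<tau> :: real
    using that abs_square_less_1[of \<tau>] by auto
  have "(\<integral>\<^sup>+x. \<phi> (x m / sqrt (ip (Suc m) x x)) *
     indicator {x. 0 < ip (Suc m) x x \<and> ip (Suc m) x x \<le> 1} x \<partial>Rn (Suc m))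
    = (\<integral>\<^sup>+y. (\<integral>\<^sup>+t. \<phi> ((y(m := t)) m / sqrt (ip (Suc m) (y(m := t)) (y(m := t)))) *
     indicator {x. 0 < ip (Suc m) x x \<and> ip (Suc m) x x \<le> 1} (y(m := t)) \<partial>lborel) \<partial>Rn m)"
    by (rule nn_integral_Rn_Suc) measurable
  also have "\<dots> = (\<integral>\<^sup>+y. (\<integral>\<^sup>+t. \<phi> (t / sqrt (ip m y y + t\<^sup>2)) *
     indicator {s. 0 < s \<and> s \<le> 1} (ip m y y + t\<^sup>2) \<partial>lborel) \<partial>Rn m)"
    by (simp add: ip_self_upd_last indicator_def)
  \<comment> \<open>The origin \<open>y = 0\<close> is discarded as a null set, since the fibre over
    \<open>y\<close> is rescaled by the norm of \<open>y\<close>.\<close>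
  also have "\<dots> = (\<integral>\<^sup>+y. (\<integral>\<^sup>+\<tau>. (ennreal (w \<tau>) * indicator {-1<..<1} \<tau> * \<phi> \<tau>) *
      (ennreal (sqrt (ip m y y)) * indicator {..1 - \<tau>\<^sup>2} (ip m y y)) \<partial>lborel) \<partial>Rn m)"
  proof (rule nn_integral_cong_AE, rule AE_mp[OF AE_Rn_ip_pos[OF m] AE_I2], rule impI)
    fix y assume N: "ip m y y > 0"
    define N where "N = ip m y y"
    define r where "r = sqrt N"
    have r: "r > 0" "r\<^sup>2 = N" using N by (auto simp: r_def N_def)
    have "(\<integral>\<^sup>+t. \<phi> (t / sqrt (N + t\<^sup>2)) * indicator {s. 0 < s \<and> s \<le> 1} (N + t\<^sup>2) \<partial>lborel)
      = ennreal \<bar>r\<bar> * (\<integral>\<^sup>+t. \<phi> ((0 + r * t) / sqrt (N + (0 + r * t)\<^sup>2)) * indicator {s. 0 < s \<and> s \<le> 1} (N + (0 + r * t)\<^sup>2) \<partial>lborel)"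
      by (rule nn_integral_real_affine) (use r in auto)
    also have "(\<integral>\<^sup>+t. \<phi> ((0 + r * t) / sqrt (N + (0 + r * t)\<^sup>2)) * indicator {s. 0 < s \<and> s \<le> 1} (N + (0 + r * t)\<^sup>2) \<partial>lborel)
      = (\<integral>\<^sup>+t. \<phi> (t / sqrt (1 + t\<^sup>2)) * indicator {..1} (N * (1 + t\<^sup>2)) \<partial>lborel)"
    proof (rule nn_integral_cong)
      fix t :: real
      have p: "1 + t\<^sup>2 > 0" using zero_le_power2[of t] by linarith
      have 1: "N + (0 + r * t)\<^sup>2 = N * (1 + t\<^sup>2)"
        using r by (simp add: power_mult_distrib algebra_simps)
      have "sqrt (N * (1 + t\<^sup>2)) = r * sqrt (1 + t\<^sup>2)"
        by (simp add: r_def real_sqrt_mult)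
      moreover have "0 < N * (1 + t\<^sup>2)" using p N by (simp add: N_def)
      ultimately show "\<phi> ((0 + r * t) / sqrt (N + (0 + r * t)\<^sup>2)) * indicator {s. 0 < s \<and> s \<le> 1} (N + (0 + r * t)\<^sup>2)
        = \<phi> (t / sqrt (1 + t\<^sup>2)) * indicator {..1} (N * (1 + t\<^sup>2))"
        unfolding 1 using r by (simp add: indicator_def)
    qed
    also have "\<dots> = (\<integral>\<^sup>+\<tau>. ennreal (w \<tau>) * indicator {-1<..<1} \<tau> *
        (\<phi> ((\<tau> / sqrt (1 - \<tau>\<^sup>2)) / sqrt (1 + (\<tau> / sqrt (1 - \<tau>\<^sup>2))\<^sup>2)) * indicator {..1} (N * (1 + (\<tau> / sqrt (1 - \<tau>\<^sup>2))\<^sup>2))) \<partial>lborel)"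
      unfolding w_def by (rule nn_integral_lborel_project) measurable
    also have "\<dots> = (\<integral>\<^sup>+\<tau>. ennreal (w \<tau>) * indicator {-1<..<1} \<tau> * (\<phi> \<tau> * indicator {..1 - \<tau>\<^sup>2} N) \<partial>lborel)"
    proof (rule nn_integral_cong)
      fix \<tau> :: real
      show "ennreal (w \<tau>) * indicator {-1<..<1} \<tau> *
        (\<phi> ((\<tau> / sqrt (1 - \<tau>\<^sup>2)) / sqrt (1 + (\<tau> / sqrt (1 - \<tau>\<^sup>2))\<^sup>2)) * indicator {..1} (N * (1 + (\<tau> / sqrt (1 - \<tau>\<^sup>2))\<^sup>2)))
        = ennreal (w \<tau>) * indicator {-1<..<1} \<tau> * (\<phi> \<tau> * indicator {..1 - \<tau>\<^sup>2} N)"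
      proof (cases "-1 < \<tau> \<and> \<tau> < 1")
        case True
        then have q: "1 - \<tau>\<^sup>2 > 0" using sq1[of \<tau>] by auto
        have 1: "1 + (\<tau> / sqrt (1 - \<tau>\<^sup>2))\<^sup>2 = 1 / (1 - \<tau>\<^sup>2)"
          using q by (simp add: power_divide field_simps)
        have 2: "(\<tau> / sqrt (1 - \<tau>\<^sup>2)) / sqrt (1 / (1 - \<tau>\<^sup>2)) = \<tau>"
          using q by (simp add: real_sqrt_divide)
        have 3: "N * (1 / (1 - \<tau>\<^sup>2)) \<le> 1 \<longleftrightarrow> N \<le> 1 - \<tau>\<^sup>2"
          using q by (simp add: divide_le_eq)
        show ?thesis unfolding 1 2 using 3 by (simp add: indicator_def)
      qed (auto simp: indicator_def)
    qed
    finally have "(\<integral>\<^sup>+t. \<phi> (t / sqrt (N + t\<^sup>2)) * indicator {s. 0 < s \<and> s \<le> 1} (N + t\<^sup>2) \<partial>lborel)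
       = ennreal r * (\<integral>\<^sup>+\<tau>. ennreal (w \<tau>) * indicator {-1<..<1} \<tau> * (\<phi> \<tau> * indicator {..1 - \<tau>\<^sup>2} N) \<partial>lborel)"
      using r by simp
    also have "\<dots> = (\<integral>\<^sup>+\<tau>. ennreal r * (ennreal (w \<tau>) * indicator {-1<..<1} \<tau> * (\<phi> \<tau> * indicator {..1 - \<tau>\<^sup>2} N)) \<partial>lborel)"
    proof (rule nn_integral_cmult[symmetric])
      have [measurable]: "Measurable.pred borel (\<lambda>x. N \<in> {..1 - x\<^sup>2})" unfolding atMost_iff by measurable
      show "(\<lambda>\<tau>. ennreal (w \<tau>) * indicator {-1<..<1} \<tau> * (\<phi> \<tau> * indicator {..1 - \<tau>\<^sup>2} N)) \<in> borel_measurable lborel"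
        by measurable
    qed
    finally show "(\<integral>\<^sup>+t. \<phi> (t / sqrt (ip m y y + t\<^sup>2)) * indicator {s. 0 < s \<and> s \<le> 1} (ip m y y + t\<^sup>2) \<partial>lborel)
       = (\<integral>\<^sup>+\<tau>. (ennreal (w \<tau>) * indicator {-1<..<1} \<tau> * \<phi> \<tau>) *
      (ennreal (sqrt (ip m y y)) * indicator {..1 - \<tau>\<^sup>2} (ip m y y)) \<partial>lborel)"
      by (simp only: N_def r_def ac_simps)
  qed
  also have "\<dots> = (\<integral>\<^sup>+\<tau>. (\<integral>\<^sup>+y. (ennreal (w \<tau>) * indicator {-1<..<1} \<tau> * \<phi> \<tau>) *
      (ennreal (sqrt (ip m y y)) * indicator {..1 - \<tau>\<^sup>2} (ip m y y)) \<partial>Rn m) \<partial>lborel)"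
  proof (rule pair_sigma_finite.Fubini')
    interpret finite_product_sigma_finite "\<lambda>_::nat. lborel :: real measure" "{..<m}" by standard simp
    show "pair_sigma_finite lborel (Rn m)"
      unfolding Rn_def pair_sigma_finite_def using sigma_finite by (simp add: lborel.sigma_finite_measure_axioms sigma_finite_measure_axioms)
    show "(\<lambda>(\<tau>, y). ennreal (w \<tau>) * indicator {- 1<..<1} \<tau> * \<phi> \<tau> *
         (ennreal (sqrt (ip m y y)) * indicator {..1 - \<tau>\<^sup>2} (ip m y y))) \<in> borel_measurable (lborel \<Otimes>\<^sub>M Rn m)"
    proof -
      have "(\<lambda>p. indicator {..1 - (fst p)\<^sup>2} (ip m (snd p) (snd p)) :: ennreal) =
         (\<lambda>p. if ip m (snd p) (snd p) \<le> 1 - (fst p)\<^sup>2 then 1 else 0)" by (auto simp: indicator_def)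
      moreover have "\<dots> \<in> borel_measurable (lborel \<Otimes>\<^sub>M Rn m)" by measurable
      ultimately have [measurable]: "(\<lambda>p. indicator {..1 - (fst p)\<^sup>2} (ip m (snd p) (snd p)) :: ennreal) \<in> borel_measurable (lborel \<Otimes>\<^sub>M Rn m)" by simp
      show ?thesis unfolding case_prod_beta by measurable
    qed
  qed
  also have "\<dots> = (\<integral>\<^sup>+\<tau>. ball_moment m * (ennreal ((1 - \<tau>\<^sup>2) powr (real m / 2 - 1)) * indicator {-1<..<1} \<tau> * \<phi> \<tau>) \<partial>lborel)"
  proof (rule nn_integral_cong)
    fix \<tau> :: real
    show "(\<integral>\<^sup>+y. (ennreal (w \<tau>) * indicator {-1<..<1} \<tau> * \<phi> \<tau>) *
      (ennreal (sqrt (ip m y y)) * indicator {..1 - \<tau>\<^sup>2} (ip m y y)) \<partial>Rn m)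
      = ball_moment m * (ennreal ((1 - \<tau>\<^sup>2) powr (real m / 2 - 1)) * indicator {-1<..<1} \<tau> * \<phi> \<tau>)"
    proof (cases "-1 < \<tau> \<and> \<tau> < 1")
      case True
      then have q: "1 - \<tau>\<^sup>2 > 0" using sq1[of \<tau>] by auto
      define s where "s = sqrt (1 - \<tau>\<^sup>2)"
      have s: "s > 0" "1 - \<tau>\<^sup>2 = s\<^sup>2" using q by (auto simp: s_def)
      have "w \<tau> * s ^ Suc m = s ^ Suc m / s ^ 3"
        using s(1) unfolding w_def s(2) by (simp add: power2_eq_square power3_eq_cube)
      also have "\<dots> = s powr (real (Suc m)) / s powr 3"
        using s(1) by (subst powr_realpow) (auto simp: powr_numeral)
      also have "\<dots> = s powr (2 * (real m / 2 - 1))"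
        by (simp add: powr_diff[symmetric])
      also have "\<dots> = (s\<^sup>2) powr (real m / 2 - 1)"
        using s(1) powr_powr[of s 2 "real m / 2 - 1"] by (simp add: powr_numeral)
      finally have ws: "w \<tau> * s ^ Suc m = (1 - \<tau>\<^sup>2) powr (real m / 2 - 1)" using s(2) by simp
      have "(\<integral>\<^sup>+y. (ennreal (w \<tau>) * indicator {-1<..<1} \<tau> * \<phi> \<tau>) *
        (ennreal (sqrt (ip m y y)) * indicator {..1 - \<tau>\<^sup>2} (ip m y y)) \<partial>Rn m)
        = (ennreal (w \<tau>) * indicator {-1<..<1} \<tau> * \<phi> \<tau>) * (ennreal (s ^ Suc m) * ball_moment m)"
        unfolding s(2) ball_moment_scaled[OF s(1), symmetric]
        by (rule nn_integral_cmult) measurable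
      also have "\<dots> = ball_moment m * ((ennreal (w \<tau>) * ennreal (s ^ Suc m)) * indicator {-1<..<1} \<tau> * \<phi> \<tau>)"
        by (simp only: ac_simps)
      also have "ennreal (w \<tau>) * ennreal (s ^ Suc m) = ennreal ((1 - \<tau>\<^sup>2) powr (real m / 2 - 1))"
        unfolding ws[symmetric] using s q by (subst ennreal_mult) (auto simp: w_def)
      finally show ?thesis .
    qed auto
  qed
  also have "\<dots> = ball_moment m * (\<integral>\<^sup>+\<tau>. ennreal ((1 - \<tau>\<^sup>2) powr (real m / 2 - 1)) * indicator {-1<..<1} \<tau> * \<phi> \<tau> \<partial>lborel)"
    by (rule nn_integral_cmult) measurable
  finally have I: "of_nat (Suc m) * (\<integral>\<^sup>+x. \<phi> (x m / sqrt (ip (Suc m) x x)) *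
     indicator {x. 0 < ip (Suc m) x x \<and> ip (Suc m) x x \<le> 1} x \<partial>Rn (Suc m))
     = (of_nat (Suc m) * ball_moment m) * (\<integral>\<^sup>+\<tau>. ennreal ((1 - \<tau>\<^sup>2) powr (real m / 2 - 1)) * indicator {-1<..<1} \<tau> * \<phi> \<tau> \<partial>lborel)"
    by (simp only: ac_simps)
  \<comment> \<open>\<open>slice_const\<close> is defined through \<open>enn2real\<close>;
    finiteness of the moment makes this lossless.\<close>
  have kk: "of_nat (Suc m) * ball_moment m = ennreal (slice_const m)"
    using ball_moment_less_top[of m] by (simp only: slice_const_def ennreal_mult of_nat_0_le_iff enn2real_nonneg) (simp add: ennreal_of_nat_eq_real_of_nat less_top)
  show ?thesis unfolding I kk
    unfolding slice_measure_def
    by (subst nn_integral_density, measurable, subst nn_integral_cmult[symmetric], measurable)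
       (use slice_const_pos[OF m] in \<open>simp add: ennreal_mult ac_simps\<close>)
qed

text \<open>Through the cone construction the left side becomes an integral over space of a function
  of the linear form and the norm alone, which can be rotated until \<open>w\<close> points along
  the last axis.\<close>

lemma nn_integral_surf_linear:
  fixes \<phi> :: "real \<Rightarrow> ennreal"
  assumes m: "m \<ge> 1" and \<phi> [measurable]: "\<phi> \<in> borel_measurable borel"
  shows "(\<integral>\<^sup>+c. \<phi> (ip (Suc m) c w) \<partial>surf (Suc m)) = (\<integral>\<^sup>+t. \<phi> (sqrt (ip (Suc m) w w) * t) \<partial>slice_measure m)"
proof -
  let ?I = "\<lambda>s. indicator {s. 0 < s \<and> s \<le> 1} (s::real) :: ennreal"
  define \<Phi> where "\<Phi> = (\<lambda>p. \<phi> (fst p / sqrt (snd p)) * ?I (snd p))"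
  have [measurable]: "\<Phi> \<in> borel_measurable borel"
    unfolding \<Phi>_def borel_prod[symmetric] by measurable
  have meas: "(\<lambda>c. \<phi> (ip (Suc m) c w)) \<in> borel_measurable (surf (Suc m))"
    unfolding measurable_cong_sets[OF sets_surf refl]
    by (rule measurable_restrict_space1) measurable
  have "(\<integral>\<^sup>+c. \<phi> (ip (Suc m) c w) \<partial>surf (Suc m))
    = of_nat (Suc m) * (\<integral>\<^sup>+x. \<Phi> (ip (Suc m) x w, ip (Suc m) x x) \<partial>Rn (Suc m))"
    unfolding nn_integral_surf[OF meas]
  proof (rule arg_cong[where f="\<lambda>z. of_nat (Suc m) * z"], rule nn_integral_cong)
    fix x
    have "ip (Suc m) (\<lambda>i\<in>{..<Suc m}. x i / sqrt (ip (Suc m) x x)) w = ip (Suc m) x w / sqrt (ip (Suc m) x x)"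
      unfolding ip_def sum_divide_distrib by (intro sum.cong) auto
    then show "\<phi> (ip (Suc m) (\<lambda>i\<in>{..<Suc m}. x i / sqrt (ip (Suc m) x x)) w) *
       indicator {x. 0 < ip (Suc m) x x \<and> ip (Suc m) x x \<le> 1} x = \<Phi> (ip (Suc m) x w, ip (Suc m) x x)"
      by (simp add: \<Phi>_def indicator_def)
  qed
  also have "\<dots> = of_nat (Suc m) * (\<integral>\<^sup>+x. \<Phi> (sqrt (ip (Suc m) w w) * x m, ip (Suc m) x x) \<partial>Rn (Suc m))"
    by (subst nn_integral_Rn_rotate_to_axis) auto
  also have "\<dots> = of_nat (Suc m) * (\<integral>\<^sup>+x. (\<lambda>t. \<phi> (sqrt (ip (Suc m) w w) * t)) (x m / sqrt (ip (Suc m) x x)) *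
     indicator {x. 0 < ip (Suc m) x x \<and> ip (Suc m) x x \<le> 1} x \<partial>Rn (Suc m))"
    by (simp add: \<Phi>_def indicator_def)
  also have "\<dots> = (\<integral>\<^sup>+t. \<phi> (sqrt (ip (Suc m) w w) * t) \<partial>slice_measure m)"
    by (rule nn_integral_cone_slice[OF m]) measurable
  finally show ?thesis .
qed

lemma sets_slice_measure [simp, measurable_cong]: "sets (slice_measure m) = sets borel"
  by (simp add: slice_measure_def)

lemma space_slice_measure [simp]: "space (slice_measure m) = UNIV"
  by (simp add: slice_measure_def)

lemma measurable_surf_ip [measurable]:
  "(\<lambda>c. ip m c w) \<in> borel_measurable (surf m)"
  unfolding measurable_cong_sets[OF sets_surf refl]
  by (rule measurable_restrict_space1) measurable

text \<open>An equality of image measures rather than of integrals, because the Radon transform is a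
  Bochner integral: integrability and value then both transfer to signed functions.\<close>

lemma distr_surf_linear:
  assumes m: "m \<ge> 1"
  shows "distr (surf (Suc m)) borel (\<lambda>c. ip (Suc m) c w) = distr (slice_measure m) borel (\<lambda>t. sqrt (ip (Suc m) w w) * t)"
proof (rule measure_eqI)
  fix A :: "real set" assume "A \<in> sets (distr (surf (Suc m)) borel (\<lambda>c. ip (Suc m) c w))"
  then have A[measurable]: "A \<in> sets borel" by simp
  show "emeasure (distr (surf (Suc m)) borel (\<lambda>c. ip (Suc m) c w)) A =
      emeasure (distr (slice_measure m) borel (\<lambda>t. sqrt (ip (Suc m) w w) * t)) A"
    using nn_integral_surf_linear[OF m, of "indicator A" w]
    by (subst (1 2) nn_integral_indicator[symmetric])
       (simp_all del: nn_integral_indicator add: nn_integral_distr)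
qed simp

section \<open>Gram--Schmidt orthogonalisation\<close>

lemma ip_sum_left: "ip N (\<lambda>i. \<Sum>l\<in>L. c l * v l i) y = (\<Sum>l\<in>L. c l * ip N (v l) y)"
  unfolding ip_def sum_distrib_left sum_distrib_right
  by (subst sum.swap) (simp add: mult.assoc)

lemma ip_sum_right: "ip N y (\<lambda>i. \<Sum>l\<in>L. c l * v l i) = (\<Sum>l\<in>L. c l * ip N y (v l))"
  by (subst (1 2) ip_commute) (rule ip_sum_left)

lemma ip_diff_left: "ip N (\<lambda>i. x i - z i) y = ip N x y - ip N z y"
  by (simp add: ip_def left_diff_distrib sum_subtractf)

lemma ip_diff_right: "ip N y (\<lambda>i. x i - z i) = ip N y x - ip N y z"
  by (subst (1 2 3) ip_commute) (rule ip_diff_left)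

lemma ip_divide_left: "ip N (\<lambda>i. x i / r) y = ip N x y / r"
  by (simp add: ip_def sum_divide_distrib)

lemma ip_divide_right: "ip N y (\<lambda>i. x i / r) = ip N y x / r"
  by (simp add: ip_def sum_divide_distrib)

lemma ip_cong: "(\<And>i. i < N \<Longrightarrow> x i = x' i) \<Longrightarrow> (\<And>i. i < N \<Longrightarrow> y i = y' i) \<Longrightarrow> ip N x y = ip N x' y'"
  by (simp add: ip_def)

lemma ip_self_zeroD: "ip N x x = 0 \<Longrightarrow> i < N \<Longrightarrow> x i = 0"
  using component_le_ip[of i N x] by simp

lemma ip_self_zero_left: "ip N x x = 0 \<Longrightarrow> ip N x y = 0"
  unfolding ip_def[of N x y] by (intro sum.neutral) (auto simp: ip_self_zeroD)

lemma ip_self_zero_right: "ip N x x = 0 \<Longrightarrow> ip N y x = 0"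
  by (subst ip_commute) (rule ip_self_zero_left)

text \<open>Only the coordinates below \<open>N\<close> count.\<close>
definition in_span :: "nat \<Rightarrow> nat \<Rightarrow> (nat \<Rightarrow> nat \<Rightarrow> real) \<Rightarrow> (nat \<Rightarrow> real) \<Rightarrow> bool" where
  "in_span N K A x \<longleftrightarrow> (\<exists>c. \<forall>i<N. x i = (\<Sum>j<K. c j * A j i))"

lemma in_span_comb:
  fixes c :: "'b \<Rightarrow> real"
  assumes "finite L" "\<And>l. l \<in> L \<Longrightarrow> in_span N K A (v l)"
  shows "in_span N K A (\<lambda>i. \<Sum>l\<in>L. c l * v l i)"
proof -
  from assms(2) have "\<forall>l\<in>L. \<exists>d. \<forall>i<N. v l i = (\<Sum>j<K. d j * A j i)" by (auto simp: in_span_def)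
  then obtain d where d: "\<And>l i. l \<in> L \<Longrightarrow> i < N \<Longrightarrow> v l i = (\<Sum>j<K. d l j * A j i)"
    by (metis (no_types))
  have "(\<Sum>l\<in>L. c l * v l i) = (\<Sum>j<K. (\<Sum>l\<in>L. c l * d l j) * A j i)" if "i < N" for i
  proof -
    have "(\<Sum>l\<in>L. c l * v l i) = (\<Sum>l\<in>L. \<Sum>j<K. c l * d l j * A j i)"
      using d that by (intro sum.cong) (auto simp: sum_distrib_left mult.assoc)
    also have "\<dots> = (\<Sum>j<K. \<Sum>l\<in>L. c l * d l j * A j i)" by (rule sum.swap)
    finally show ?thesis by (simp add: sum_distrib_right)
  qed
  then show ?thesis unfolding in_span_def by (intro exI[of _ "\<lambda>j. \<Sum>l\<in>L. c l * d l j"]) auto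
qed

lemma in_span_base: assumes "j < K" shows "in_span N K A (A j)"
proof -
  have "(\<Sum>l<K. (if l = j then 1 else 0) * A l i) = A j i" for i
    using assms by (subst sum.remove[of _ j]) auto
  then show ?thesis unfolding in_span_def by (intro exI[of _ "\<lambda>l. if l = j then 1 else 0"]) auto
qed

lemma in_span_cong: "in_span N K A x \<Longrightarrow> (\<And>i. i < N \<Longrightarrow> y i = x i) \<Longrightarrow> in_span N K A y"
  unfolding in_span_def by (elim exE, rule exI) auto

lemma in_span_trans:
  assumes "in_span N K' B x" "\<And>j. j < K' \<Longrightarrow> in_span N K A (B j)"
  shows "in_span N K A x"
proof -
  obtain c where c: "\<And>i. i < N \<Longrightarrow> x i = (\<Sum>j<K'. c j * B j i)" using assms(1) by (auto simp: in_span_def)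
  show ?thesis
    by (rule in_span_cong[OF in_span_comb[of "{..<K'}" N K A B c]]) (use assms(2) c in auto)
qed

lemma in_span_diff: "in_span N K A x \<Longrightarrow> in_span N K A y \<Longrightarrow> in_span N K A (\<lambda>i. x i - y i)"
  using in_span_comb[of "{True,False}" N K A "\<lambda>b. if b then x else y" "\<lambda>b. if b then 1 else -1"] by simp

lemma in_span_divide: "in_span N K A x \<Longrightarrow> in_span N K A (\<lambda>i. x i / r)"
  using in_span_comb[of "{()}" N K A "\<lambda>_. x" "\<lambda>_. 1 / r"] by simp

text \<open>Orthogonal systems whose vectors have norm 1 or 0, as produced by Gram--Schmidt without
  any independence assumption.\<close>
definition orthogonal_system :: "nat \<Rightarrow> nat \<Rightarrow> (nat \<Rightarrow> nat \<Rightarrow> real) \<Rightarrow> bool" where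
  "orthogonal_system N K g \<longleftrightarrow> (\<forall>i<K. \<forall>j<K. i \<noteq> j \<longrightarrow> ip N (g i) (g j) = 0) \<and> (\<forall>j<K. ip N (g j) (g j) = 0 \<or> ip N (g j) (g j) = 1)"

section \<open>Bessel, Parseval and the dimension count\<close>

lemma orthogonal_system_sum:
  assumes "orthogonal_system N K g" "l < K"
  shows "(\<Sum>j<K. ip N x (g j) * ip N (g j) (g l)) = ip N x (g l)"
proof -
  have "(\<Sum>j<K. ip N x (g j) * ip N (g j) (g l)) = ip N x (g l) * ip N (g l) (g l)"
    by (subst sum.remove[of _ l]) (use assms in \<open>auto simp: orthogonal_system_def intro!: sum.neutral\<close>)
  also have "\<dots> = ip N x (g l)"
    using assms ip_self_zero_right[of N "g l" x] by (auto simp: orthogonal_system_def)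
  finally show ?thesis .
qed

lemma orthogonal_system_residual:
  assumes g: "orthogonal_system N K g"
  shows "ip N (\<lambda>i. x i - (\<Sum>j<K. ip N x (g j) * g j i)) (\<lambda>i. x i - (\<Sum>j<K. ip N x (g j) * g j i))
    = ip N x x - (\<Sum>j<K. (ip N x (g j))\<^sup>2)"
proof -
  let ?P = "\<lambda>i. \<Sum>j<K. ip N x (g j) * g j i"
  have Px: "ip N x ?P = (\<Sum>j<K. (ip N x (g j))\<^sup>2)"
    by (simp add: ip_sum_right power2_eq_square)
  have Pg: "ip N ?P (g l) = ip N x (g l)" if "l < K" for l
    unfolding ip_sum_left by (rule orthogonal_system_sum[OF g that])
  have PP: "ip N ?P ?P = (\<Sum>j<K. (ip N x (g j))\<^sup>2)"
    by (subst ip_sum_right) (auto simp: Pg power2_eq_square intro!: sum.cong)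
  show ?thesis
    by (simp only: ip_diff_left ip_diff_right PP Px ip_commute[of N ?P x])
qed

lemma orthogonal_system_bessel: "orthogonal_system N K g \<Longrightarrow> (\<Sum>j<K. (ip N x (g j))\<^sup>2) \<le> ip N x x"
  using orthogonal_system_residual[of N K g x] ip_nonneg[of N "\<lambda>i. x i - (\<Sum>j<K. ip N x (g j) * g j i)"] by linarith

lemma orthogonal_system_expand:
  assumes g: "orthogonal_system N K g" and x: "in_span N K g x" and i: "i < N"
  shows "x i = (\<Sum>j<K. ip N x (g j) * g j i)"
proof -
  obtain c where c: "\<And>i. i < N \<Longrightarrow> x i = (\<Sum>j<K. c j * g j i)" using x by (auto simp: in_span_def)
  \<comment> \<open>The coefficient \<open>c l\<close> of a zero vector is not determined by
    \<open>x\<close>; only its product with \<open>g l\<close> is, and that is zero.\<close>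
  have "ip N x (g l) * g l i = c l * g l i" if l: "l < K" for l
  proof -
    have "ip N x (g l) = ip N (\<lambda>i. \<Sum>j<K. c j * g j i) (g l)" by (rule ip_cong) (auto simp: c)
    also have "\<dots> = (\<Sum>j<K. c j * ip N (g j) (g l))" by (rule ip_sum_left)
    also have "\<dots> = c l * ip N (g l) (g l)"
      by (subst sum.remove[of _ l]) (use g l in \<open>auto simp: orthogonal_system_def intro!: sum.neutral\<close>)
    finally have 1: "ip N x (g l) = c l * ip N (g l) (g l)" .
    show ?thesis
    proof (cases "ip N (g l) (g l) = 0")
      case True
      then show ?thesis using ip_self_zeroD[OF True i] by simp
    next
      case False
      then show ?thesis using 1 g l by (auto simp: orthogonal_system_def)
    qed
  qed
  then show ?thesis unfolding c[OF i] by (intro sum.cong) (auto, metis)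
qed

lemma orthogonal_system_parseval:
  assumes g: "orthogonal_system N K g" and x: "in_span N K g x"
  shows "ip N x x = (\<Sum>j<K. (ip N x (g j))\<^sup>2)"
proof -
  have "ip N x x = ip N x (\<lambda>i. \<Sum>j<K. ip N x (g j) * g j i)"
    by (rule ip_cong) (use orthogonal_system_expand[OF assms] in auto)
  then show ?thesis by (simp add: ip_sum_right power2_eq_square)
qed

text \<open>Dimension count: the squared inner products of the two systems sum to \<open>K\<close> by Parseval and to at
  most the number of nonzero vectors of \<open>g\<close> by Bessel.\<close>
lemma orthogonal_system_exchange:
  assumes g: "orthogonal_system N K g" and u: "orthogonal_system N K u" "\<And>j. j < K \<Longrightarrow> ip N (u j) (u j) = 1"
    and sp: "\<And>j. j < K \<Longrightarrow> in_span N K g (u j)" and l: "l < K"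
  shows "ip N (g l) (g l) = 1"
proof (rule ccontr)
  assume "ip N (g l) (g l) \<noteq> 1"
  with g l have 0: "ip N (g l) (g l) = 0" by (auto simp: orthogonal_system_def)
  have "real K = (\<Sum>j<K. ip N (u j) (u j))" using u(2) by simp
  also have "\<dots> = (\<Sum>j<K. \<Sum>i<K. (ip N (u j) (g i))\<^sup>2)"
    using orthogonal_system_parseval[OF g sp] by simp
  also have "\<dots> = (\<Sum>i<K. \<Sum>j<K. (ip N (g i) (u j))\<^sup>2)"
    by (subst sum.swap) (simp add: ip_commute)
  also have "\<dots> \<le> (\<Sum>i<K. ip N (g i) (g i))"
    by (intro sum_mono orthogonal_system_bessel[OF u(1)])
  also have "\<dots> = (\<Sum>i\<in>{..<K} - {l}. ip N (g i) (g i))"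
    using l 0 by (subst sum.remove[of _ l]) auto
  also have "\<dots> \<le> (\<Sum>i\<in>{..<K} - {l}. 1)"
    by (intro sum_mono) (use g in \<open>fastforce simp: orthogonal_system_def\<close>)
  also have "\<dots> = real K - 1" using l by (simp add: of_nat_diff)
  finally show False by simp
qed

text \<open>Division by zero gives zero, so a dependent \<open>A j\<close> produces the zero vector
  without a case distinction. The map is total and given by a formula whose measurability in
  \<open>A\<close> follows by induction. The dimension \<open>N\<close> is a parameter because the
  same recursion is run both in full space and on tuples whose last coordinate is ignored.\<close>

function gram_schmidt :: "nat \<Rightarrow> (nat \<Rightarrow> nat \<Rightarrow> real) \<Rightarrow> nat \<Rightarrow> nat \<Rightarrow> real" where
  "gram_schmidt N A j = (let v = (\<lambda>i. A j i - (\<Sum>l<j. ip N (A j) (gram_schmidt N A l) * gram_schmidt N A l i)) in (\<lambda>i. v i / sqrt (ip N v v)))"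
  by auto
termination by (relation "Wellfounded.measure (\<lambda>(N, A, j). j)") auto

declare gram_schmidt.simps [simp del]

definition gs_residual :: "nat \<Rightarrow> (nat \<Rightarrow> nat \<Rightarrow> real) \<Rightarrow> nat \<Rightarrow> nat \<Rightarrow> real" where
  "gs_residual N A j i = A j i - (\<Sum>l<j. ip N (A j) (gram_schmidt N A l) * gram_schmidt N A l i)"

lemma gram_schmidt_eq: "gram_schmidt N A j = (\<lambda>i. gs_residual N A j i / sqrt (ip N (gs_residual N A j) (gs_residual N A j)))"
  by (subst gram_schmidt.simps) (simp add: Let_def gs_residual_def[abs_def])

lemma ip_gram_schmidt_self: "ip N (gram_schmidt N A j) (gram_schmidt N A j) = (if ip N (gs_residual N A j) (gs_residual N A j) = 0 then 0 else 1)"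
proof -
  have "ip N (gram_schmidt N A j) (gram_schmidt N A j) = ip N (gs_residual N A j) (gs_residual N A j) / (sqrt (ip N (gs_residual N A j) (gs_residual N A j)))\<^sup>2"
    by (simp add: gram_schmidt_eq ip_divide_left ip_divide_right power2_eq_square)
  then show ?thesis by simp
qed

lemma gram_schmidt_orthogonal: "i < j \<Longrightarrow> ip N (gram_schmidt N A i) (gram_schmidt N A j) = 0"
proof (induction j arbitrary: i rule: less_induct)
  case (less j)
  have g: "orthogonal_system N j (gram_schmidt N A)"
    unfolding orthogonal_system_def using less.IH ip_gram_schmidt_self by (metis ip_commute linorder_neqE_nat)
  have "ip N (gs_residual N A j) (gram_schmidt N A i) = ip N (A j) (gram_schmidt N A i) - (\<Sum>l<j. ip N (A j) (gram_schmidt N A l) * ip N (gram_schmidt N A l) (gram_schmidt N A i))"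
    unfolding gs_residual_def[abs_def] by (simp only: ip_diff_left ip_sum_left)
  also have "\<dots> = 0" using orthogonal_system_sum[OF g less.prems] by simp
  finally have "ip N (gram_schmidt N A j) (gram_schmidt N A i) = 0" by (simp add: gram_schmidt_eq[of N A j] ip_divide_left)
  then show ?case by (simp add: ip_commute)
qed

lemma orthogonal_system_gram_schmidt: "orthogonal_system N K (gram_schmidt N A)"
proof -
  have "ip N (gram_schmidt N A i) (gram_schmidt N A j) = 0" if "i \<noteq> j" for i j
    using that gram_schmidt_orthogonal[of i j N A] gram_schmidt_orthogonal[of j i N A]
    by (cases "i < j") (auto simp: ip_commute)
  then show ?thesis unfolding orthogonal_system_def by (auto simp: ip_gram_schmidt_self)
qed

lemma in_span_mono: assumes "in_span N K A x" "K \<le> K'" shows "in_span N K' A x"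
  by (rule in_span_trans[OF assms(1)]) (use assms(2) in \<open>auto intro: in_span_base\<close>)

lemma in_span_gram_schmidt: "in_span N (Suc j) A (gram_schmidt N A j)"
proof (induction j rule: less_induct)
  case (less j)
  have "in_span N (Suc j) A (\<lambda>i. \<Sum>l<j. ip N (A j) (gram_schmidt N A l) * gram_schmidt N A l i)"
    by (rule in_span_comb) (auto intro!: in_span_mono[OF less])
  then have "in_span N (Suc j) A (gs_residual N A j)"
    unfolding gs_residual_def[abs_def] by (intro in_span_diff in_span_base) auto
  then show ?case unfolding gram_schmidt_eq by (rule in_span_divide)
qed

lemma in_span_of_gram_schmidt: "in_span N (Suc j) (gram_schmidt N A) (A j)"
proof -
  let ?s = "sqrt (ip N (gs_residual N A j) (gs_residual N A j))"
  have 1: "?s * gram_schmidt N A j i = gs_residual N A j i" if "i < N" for i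
    using ip_self_zeroD[of N "gs_residual N A j" i] that by (auto simp: gram_schmidt_eq)
  show ?thesis unfolding in_span_def
    by (rule exI[of _ "\<lambda>l. if l < j then ip N (A j) (gram_schmidt N A l) else ?s"])
       (auto simp: 1 gs_residual_def)
qed

lemma in_span_gram_schmidt_iff: "in_span N K (gram_schmidt N A) x \<longleftrightarrow> in_span N K A x"
proof
  assume "in_span N K (gram_schmidt N A) x"
  then show "in_span N K A x" by (rule in_span_trans) (auto intro: in_span_mono[OF in_span_gram_schmidt])
next
  assume "in_span N K A x"
  then show "in_span N K (gram_schmidt N A) x" by (rule in_span_trans) (auto intro: in_span_mono[OF in_span_of_gram_schmidt])
qed

lemma ip_gram_schmidt_later: "l < j \<Longrightarrow> ip N (A l) (gram_schmidt N A j) = 0"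
proof -
  assume lj: "l < j"
  obtain c where c: "\<And>i. i < N \<Longrightarrow> A l i = (\<Sum>q<Suc l. c q * gram_schmidt N A q i)"
    using in_span_of_gram_schmidt[of N l A] by (auto simp: in_span_def)
  have "ip N (A l) (gram_schmidt N A j) = ip N (\<lambda>i. \<Sum>q<Suc l. c q * gram_schmidt N A q i) (gram_schmidt N A j)"
    by (rule ip_cong) (auto simp: c)
  also have "\<dots> = (\<Sum>q<Suc l. c q * ip N (gram_schmidt N A q) (gram_schmidt N A j))" by (rule ip_sum_left)
  also have "\<dots> = 0" using lj by (intro sum.neutral) (auto simp: gram_schmidt_orthogonal)
  finally show ?thesis .
qed

lemma ip_gram_schmidt_same: "ip N (A j) (gram_schmidt N A j) = sqrt (ip N (gs_residual N A j) (gs_residual N A j))"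
proof -
  have "ip N (gs_residual N A j) (gram_schmidt N A j) = ip N (A j) (gram_schmidt N A j) - ip N (\<lambda>i. \<Sum>l<j. ip N (A j) (gram_schmidt N A l) * gram_schmidt N A l i) (gram_schmidt N A j)"
    unfolding gs_residual_def[abs_def] by (rule ip_diff_left)
  also have "ip N (\<lambda>i. \<Sum>l<j. ip N (A j) (gram_schmidt N A l) * gram_schmidt N A l i) (gram_schmidt N A j) = 0"
    unfolding ip_sum_left by (intro sum.neutral) (auto simp: gram_schmidt_orthogonal)
  finally have "ip N (A j) (gram_schmidt N A j) = ip N (gs_residual N A j) (gram_schmidt N A j)" by simp
  also have "\<dots> = sqrt (ip N (gs_residual N A j) (gs_residual N A j))"
    by (simp add: gram_schmidt_eq ip_divide_right real_div_sqrt)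
  finally show ?thesis .
qed

text \<open>Let \<open>J\<close> be the last index with nonzero coefficient. Pairing the relation
  with \<open>gram_schmidt N A J\<close> kills the terms before \<open>J\<close>, as that vector is
  orthogonal to all earlier \<open>A l\<close>, and leaves \<open>c J\<close> times the norm of a
  nonzero residual.\<close>

lemma gram_schmidt_independent:
  assumes nz: "\<And>j. j < K \<Longrightarrow> ip N (gs_residual N A j) (gs_residual N A j) \<noteq> 0"
    and z: "\<And>i. i < N \<Longrightarrow> (\<Sum>j<K. c j * A j i) = 0" and j: "j < K"
  shows "c j = 0"
proof (rule ccontr)
  assume "c j \<noteq> 0"
  define J where "J = Max {j. j < K \<and> c j \<noteq> 0}"
  have fin: "finite {j. j < K \<and> c j \<noteq> 0}" by simp
  have "J \<in> {j. j < K \<and> c j \<noteq> 0}"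
    unfolding J_def using j \<open>c j \<noteq> 0\<close> by (intro Max_in[OF fin]) auto
  then have J: "J < K" "c J \<noteq> 0" by auto
  have Jmax: "c l = 0" if "l < K" "J < l" for l
    using Max_ge[OF fin, of l] that unfolding J_def[symmetric] by (cases "c l = 0") auto
  have "0 = ip N (\<lambda>i. \<Sum>j<K. c j * A j i) (gram_schmidt N A J)" using z by (simp add: ip_def)
  also have "\<dots> = (\<Sum>j<K. c j * ip N (A j) (gram_schmidt N A J))" by (rule ip_sum_left)
  also have "\<dots> = c J * ip N (A J) (gram_schmidt N A J)"
  proof (subst sum.remove[of _ J])
    show "c J * ip N (A J) (gram_schmidt N A J) + (\<Sum>j\<in>{..<K} - {J}. c j * ip N (A j) (gram_schmidt N A J)) = c J * ip N (A J) (gram_schmidt N A J)"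
    proof -
      have "c l * ip N (A l) (gram_schmidt N A J) = 0" if "l < K" "l \<noteq> J" for l
        using Jmax[of l] ip_gram_schmidt_later[of l J N A] that by (cases "l < J") auto
      then show ?thesis by (simp add: sum.neutral)
    qed
  qed (use J in auto)
  finally show False using J nz[of J] by (simp add: ip_gram_schmidt_same)
qed

section \<open>Totally geodesic submanifolds\<close>

lemma gspan_iff: "x \<in> gspan n k A \<longleftrightarrow> x \<in> sph (Suc n) \<and> in_span (Suc n) (Suc k) A x"
proof -
  have "x \<in> range (emb n k A) \<longleftrightarrow> in_span (Suc n) (Suc k) A x" if "x \<in> sph (Suc n)"
  proof
    assume "x \<in> range (emb n k A)"
    then show "in_span (Suc n) (Suc k) A x" by (auto simp: emb_def in_span_def simp del: sum.lessThan_Suc)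
  next
    assume "in_span (Suc n) (Suc k) A x"
    then obtain c where c: "\<And>i. i < Suc n \<Longrightarrow> x i = (\<Sum>j<Suc k. c j * A j i)" by (auto simp: in_span_def)
    have "x = emb n k A c"
      using that c by (auto simp: emb_def fun_eq_iff sph_def space_Rn extensional_def restrict_def simp del: sum.lessThan_Suc)
    then show "x \<in> range (emb n k A)" by blast
  qed
  then show ?thesis by (auto simp: gspan_def)
qed

lemma onframe_orthogonal_system:
  assumes "onframe n k u"
  shows "orthogonal_system (Suc n) (Suc k) u" "\<And>j. j < Suc k \<Longrightarrow> ip (Suc n) (u j) (u j) = 1"
  using assms by (auto simp: onframe_def orthogonal_system_def)

definition independent_tuple :: "nat \<Rightarrow> nat \<Rightarrow> (nat \<Rightarrow> nat \<Rightarrow> real) \<Rightarrow> bool" where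
  "independent_tuple n k A \<longleftrightarrow> (\<forall>j<Suc k. ip (Suc n) (gs_residual (Suc n) A j) (gs_residual (Suc n) A j) \<noteq> 0)"

text \<open>The squared length of the orthogonal projection of the pole \<open>orig n\<close> onto
  the span of the tuple, that is, the squared cosine of the distance of the section from the
  pole.\<close>

definition height_sq :: "nat \<Rightarrow> nat \<Rightarrow> (nat \<Rightarrow> nat \<Rightarrow> real) \<Rightarrow> real" where
  "height_sq n k A = (\<Sum>j<Suc k. (gram_schmidt (Suc n) A j n)\<^sup>2)"

definition gs_frame :: "nat \<Rightarrow> (nat \<Rightarrow> nat \<Rightarrow> real) \<Rightarrow> nat \<Rightarrow> nat \<Rightarrow> real" where
  "gs_frame n A j = restrict (gram_schmidt (Suc n) A j) {..<Suc n}"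

lemma in_span_system_cong:
  "(\<And>j i. j < K \<Longrightarrow> i < N \<Longrightarrow> A j i = B j i) \<Longrightarrow> in_span N K A x \<longleftrightarrow> in_span N K B x"
  by (simp add: in_span_def)

lemma gspan_gs_frame: "gspan n k (gs_frame n A) = gspan n k A"
proof -
  have "in_span (Suc n) (Suc k) (gs_frame n A) x \<longleftrightarrow> in_span (Suc n) (Suc k) A x" for x
    unfolding in_span_gram_schmidt_iff[of "Suc n" "Suc k" A x, symmetric]
    by (rule in_span_system_cong) (auto simp: gs_frame_def)
  then show ?thesis by (auto simp: gspan_iff)
qed

lemma onframe_gs_frame:
  assumes "independent_tuple n k A" shows "onframe n k (gs_frame n A)"
proof -
  have "ip (Suc n) (gs_frame n A i) (gs_frame n A j) = ip (Suc n) (gram_schmidt (Suc n) A i) (gram_schmidt (Suc n) A j)" for i j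
    by (rule ip_cong) (auto simp: gs_frame_def)
  moreover have "ip (Suc n) (gram_schmidt (Suc n) A i) (gram_schmidt (Suc n) A j) = (if i = j then 1 else 0)"
    if "i < Suc k" "j < Suc k" for i j
    using that assms orthogonal_system_gram_schmidt[of "Suc n" "Suc k" A] by (auto simp: independent_tuple_def orthogonal_system_def ip_gram_schmidt_self)
  ultimately show ?thesis unfolding onframe_def by (auto simp: space_Rn gs_frame_def)
qed

text \<open>Membership in \<open>Xi\<close> only provides some orthonormal frame of the same
  section. Its vectors lie in the span of the Gram-Schmidt vectors of \<open>A\<close>, and the
  dimension count then forbids a zero vector among the latter.\<close>

lemma independent_tuple_if_onframe:
  assumes u: "onframe n k u" and eq: "gspan n k A = gspan n k u"
  shows "independent_tuple n k A"
proof -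
  have "in_span (Suc n) (Suc k) (gram_schmidt (Suc n) A) (u j)" if j: "j < Suc k" for j
  proof -
    have "u j \<in> gspan n k u"
      using u j in_span_base[OF j, of "Suc n" u] by (auto simp: gspan_iff sph_def onframe_def)
    then show ?thesis unfolding eq[symmetric] by (simp add: gspan_iff in_span_gram_schmidt_iff)
  qed
  then have "ip (Suc n) (gram_schmidt (Suc n) A l) (gram_schmidt (Suc n) A l) = 1" if "l < Suc k" for l
    using orthogonal_system_exchange[OF orthogonal_system_gram_schmidt onframe_orthogonal_system[OF u] _ that] by blast
  then show ?thesis unfolding independent_tuple_def ip_gram_schmidt_self by fastforce
qed

section \<open>Distance of a section from the pole\<close>

lemma ip_orig_left: "ip (Suc n) (orig n) x = x n"
  by (simp add: ip_def orig_def)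

lemma d0_eq: "d0 n x = arccos (x n)"
  by (simp add: d0_def sdist_def ip_orig_left)

lemma onframe_height_le_1: "onframe n k u \<Longrightarrow> (\<Sum>j<Suc k. (u j n)\<^sup>2) \<le> 1"
proof -
  assume "onframe n k u"
  moreover have "orig n n = 1" by (simp add: orig_def)
  ultimately show ?thesis
    using orthogonal_system_bessel[OF onframe_orthogonal_system(1), of n k u "orig n"]
    by (simp add: ip_orig_left del: sum.lessThan_Suc)
qed

lemma ip_emb:
  assumes "onframe n k u" shows "ip (Suc n) (emb n k u c) (emb n k u c) = ip (Suc k) c c"
proof -
  have "ip (Suc n) (emb n k u c) (emb n k u c) = ip (Suc n) (\<lambda>i. \<Sum>j<Suc k. c j * u j i) (\<lambda>i. \<Sum>j<Suc k. c j * u j i)"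
    by (rule ip_cong) (auto simp: emb_def)
  also have "\<dots> = (\<Sum>l<Suc k. c l * (\<Sum>j<Suc k. c j * ip (Suc n) (u l) (u j)))"
    by (simp only: ip_sum_left ip_sum_right)
  also have "\<dots> = (\<Sum>l<Suc k. c l * c l)"
  proof (rule sum.cong[OF refl])
    fix l assume "l \<in> {..<Suc k}"
    then have "(\<Sum>j<Suc k. c j * ip (Suc n) (u l) (u j)) = c l"
      using assms by (subst sum.remove[of _ l]) (auto simp: onframe_def intro!: sum.neutral simp del: sum.lessThan_Suc)
    then show "c l * (\<Sum>j<Suc k. c j * ip (Suc n) (u l) (u j)) = c l * c l" by simp
  qed
  finally show ?thesis by (simp add: ip_def)
qed

lemma emb_last: "emb n k u c n = ip (Suc k) c (\<lambda>j. u j n)"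
  by (simp add: emb_def ip_def)

lemma ip_cauchy_schwarz: "ip N x y \<le> sqrt (ip N x x) * sqrt (ip N y y)"
proof -
  have "(ip N x y)\<^sup>2 \<le> ip N x x * ip N y y"
    using Cauchy_Schwarz_ineq_sum[of x y "{..<N}"] by (simp add: ip_def power2_eq_square)
  then have "\<bar>ip N x y\<bar> \<le> sqrt (ip N x x * ip N y y)" by (rule real_le_rsqrt[of "\<bar>_\<bar>", simplified])
  then show ?thesis by (simp add: real_sqrt_mult)
qed

text \<open>A point of the section has last coordinate \<open>ip (Suc k) c w\<close>, where
  \<open>c\<close> is its unit coordinate vector in the frame and \<open>w\<close> collects the last
  coordinates of the frame vectors. The distance is least where this linear form is largest:
  Cauchy-Schwarz gives the bound and \<open>c = w / r\<close> attains it. If \<open>w = 0\<close>,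
  every unit \<open>c\<close> does.\<close>

lemma d0set_gspan:
  assumes u: "onframe n k u"
  shows "d0set n (gspan n k u) = arccos (sqrt (\<Sum>j<Suc k. (u j n)\<^sup>2))"
proof -
  define w where "w j = u j n" for j
  define r where "r = sqrt (ip (Suc k) w w)"
  have ipw: "ip (Suc k) w w = (\<Sum>j<Suc k. (u j n)\<^sup>2)"
    by (simp add: ip_def w_def power2_eq_square)
  have r01: "0 \<le> r" "r \<le> 1" using onframe_height_le_1[OF u] by (auto simp: r_def ipw sum_nonneg simp del: sum.lessThan_Suc)
  have lower: "arccos r \<le> d0 n x" if gx: "x \<in> gspan n k u" for x
  proof -
    obtain c where x: "x = emb n k u c" "ip (Suc n) x x = 1" using gx by (auto simp: gspan_def sph_def)
    have cc: "ip (Suc k) c c = 1" using x ip_emb[OF u] by simp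
    have le: "x n \<le> r" using ip_cauchy_schwarz[of "Suc k" c w] cc by (simp add: x(1) emb_last r_def w_def[abs_def])
    have "(x n)\<^sup>2 \<le> 1" using component_le_ip[of n "Suc n" x] x(2) by simp
    then have "-1 \<le> x n" by (simp add: abs_square_le_1 abs_le_iff)
    then show ?thesis unfolding d0_eq using le r01 by (intro arccos_le_arccos) auto
  qed
  have "\<exists>c. ip (Suc k) c c = 1 \<and> ip (Suc k) c w = r"
  proof (cases "r = 0")
    case True
    then have w0: "ip (Suc k) w w = 0" by (simp add: r_def)
    define c where "c = (\<lambda>j::nat. if j = 0 then 1 else 0 :: real)"
    have "ip (Suc k) c c = 1" unfolding ip_def by (subst sum.remove[of _ 0]) (auto simp: c_def)
    then show ?thesis using ip_self_zero_right[OF w0] True by auto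
  next
    case False
    have rr: "r * r = ip (Suc k) w w" by (simp add: r_def)
    define c where "c = (\<lambda>j. w j / r)"
    have "ip (Suc k) c c = 1" "ip (Suc k) c w = r" unfolding c_def
      using False by (auto simp: ip_divide_left ip_divide_right rr[symmetric])
    then show ?thesis by blast
  qed
  then obtain c where c: "ip (Suc k) c c = 1" "ip (Suc k) c w = r" by blast
  have mem: "emb n k u c \<in> gspan n k u"
    using ip_emb[OF u, of c] c by (auto simp: gspan_def sph_def space_Rn emb_def)
  have att: "d0 n (emb n k u c) = arccos r"
    using c(2) by (simp add: d0_eq emb_last w_def[abs_def])
  have "Inf (d0 n ` gspan n k u) = arccos r"
    by (rule cInf_eq_minimum) (use mem att lower in \<open>auto intro!: image_eqI\<close>)
  then show ?thesis by (simp add: d0set_def r_def ipw del: sum.lessThan_Suc)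
qed

lemma arccos_less_pi_half_iff: "0 \<le> r \<Longrightarrow> r \<le> 1 \<Longrightarrow> arccos r < pi / 2 \<longleftrightarrow> r > 0"
  using arccos_less_arccos[of 0 r] by (cases "r = 0") auto

lemma cos_d0set_onframe:
  assumes "onframe n k u" shows "cos (d0set n (gspan n k u)) = sqrt (\<Sum>j<Suc k. (u j n)\<^sup>2)"
  using onframe_height_le_1[OF assms]
  by (simp add: d0set_gspan[OF assms] sum_nonneg order_trans[of "-1" 0] del: sum.lessThan_Suc)

lemma height_sq_gs_frame: "height_sq n k A = (\<Sum>j<Suc k. (gs_frame n A j n)\<^sup>2)"
  by (simp add: height_sq_def gs_frame_def)

text \<open>Translates membership in \<open>Xi\<close> into conditions on the tuple whose
  measurability can be read off the Gram-Schmidt formulas. All preimages under \<open>gspan\<close>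
  are computed through it.\<close>

lemma gspan_in_Xi_iff: "gspan n k A \<in> Xi n k \<longleftrightarrow> independent_tuple n k A \<and> height_sq n k A > 0"
proof
  assume X: "gspan n k A \<in> Xi n k"
  then obtain u where u: "onframe n k u" "gspan n k A = gspan n k u" by (auto simp: Xi_def)
  have g: "independent_tuple n k A" using independent_tuple_if_onframe[OF u] .
  have f: "onframe n k (gs_frame n A)" using onframe_gs_frame[OF g] .
  have "d0set n (gspan n k (gs_frame n A)) < pi / 2" using X by (auto simp: Xi_def gspan_gs_frame)
  then show "independent_tuple n k A \<and> height_sq n k A > 0"
    using g onframe_height_le_1[OF f] unfolding d0set_gspan[OF f] height_sq_gs_frame
    by (subst (asm) arccos_less_pi_half_iff) (auto simp: sum_nonneg simp del: sum.lessThan_Suc)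
next
  assume g: "independent_tuple n k A \<and> height_sq n k A > 0"
  then have f: "onframe n k (gs_frame n A)" using onframe_gs_frame by blast
  have "d0set n (gspan n k (gs_frame n A)) < pi / 2"
    using g onframe_height_le_1[OF f] unfolding d0set_gspan[OF f] height_sq_gs_frame
    by (subst arccos_less_pi_half_iff) (auto simp: sum_nonneg simp del: sum.lessThan_Suc)
  then show "gspan n k A \<in> Xi n k" using f by (auto simp: Xi_def gspan_gs_frame)
qed

lemma cos_d0set_gspan: "independent_tuple n k A \<Longrightarrow> cos (d0set n (gspan n k A)) = sqrt (height_sq n k A)"
  using cos_d0set_onframe[OF onframe_gs_frame, of n k A] by (simp add: gspan_gs_frame height_sq_gs_frame)

lemma Xi_height:
  assumes "\<xi> \<in> Xi n k"
  shows "0 < cos (d0set n \<xi>)" "cos (d0set n \<xi>) \<le> 1" "sin (d0set n \<xi>) = sqrt (1 - (cos (d0set n \<xi>))\<^sup>2)"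
proof -
  obtain u where u: "onframe n k u" "\<xi> = gspan n k u" "d0set n \<xi> < pi / 2" using assms by (auto simp: Xi_def)
  define r where "r = sqrt (\<Sum>j<Suc k. (u j n)\<^sup>2)"
  have r: "0 \<le> r" "r \<le> 1" using onframe_height_le_1[OF u(1)] by (auto simp: r_def sum_nonneg simp del: sum.lessThan_Suc)
  have d: "d0set n \<xi> = arccos r" using d0set_gspan[OF u(1)] u(2) by (simp add: r_def)
  have r0: "r > 0" using u(3) arccos_less_pi_half_iff[OF r] unfolding d by blast
  have c: "cos (d0set n \<xi>) = r" unfolding d using r by simp
  show "0 < cos (d0set n \<xi>)" "cos (d0set n \<xi>) \<le> 1" using r0 r c by auto
  show "sin (d0set n \<xi>) = sqrt (1 - (cos (d0set n \<xi>))\<^sup>2)"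
    unfolding c unfolding d using r by (simp add: sin_arccos)
qed

lemma frame_of_Xi:
  assumes "\<xi> \<in> Xi n k"
  shows "onframe n k (frame_of n k \<xi>)" "gspan n k (frame_of n k \<xi>) = \<xi>"
proof -
  have "\<exists>u. onframe n k u \<and> gspan n k u = \<xi>" using assms by (auto simp: Xi_def)
  from someI_ex[OF this] show "onframe n k (frame_of n k \<xi>)" "gspan n k (frame_of n k \<xi>) = \<xi>"
    by (auto simp: frame_of_def)
qed

section \<open>Gaussian tuples: measurability and null sets\<close>

lemma sigma_finite_Rn: "sigma_finite_measure (Rn m)"
proof -
  interpret finite_product_sigma_finite "\<lambda>_::nat. lborel :: real measure" "{..<m}" by standard simp
  show ?thesis unfolding Rn_def by (rule sigma_finite_measure_axioms)
qed

interpretation RnP: product_sigma_finite "\<lambda>_::nat. Rn m" for m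
  by (simp add: product_sigma_finite_def sigma_finite_Rn)

definition tuples :: "nat \<Rightarrow> nat \<Rightarrow> (nat \<Rightarrow> nat \<Rightarrow> real) measure" where
  "tuples n k = (\<Pi>\<^sub>M j\<in>{..<Suc k}. Rn (Suc n))"

lemma frames_eq: "frames n k = density (tuples n k)
     (\<lambda>A. ennreal (exp (- (\<Sum>j<Suc k. \<Sum>i<Suc n. (A j i)\<^sup>2) / 2)))"
  by (simp add: frames_def tuples_def)

lemma sets_frames [simp, measurable_cong]: "sets (frames n k) = sets (tuples n k)"
  by (simp add: frames_eq)

lemma space_frames [simp]: "space (frames n k) = space (tuples n k)"
  by (simp add: frames_eq)

lemma measurable_entry:
  assumes "j < Suc k" "i < Suc n"
  shows "(\<lambda>A. A j i) \<in> borel_measurable (tuples n k)"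
proof -
  have "(\<lambda>A. A j) \<in> measurable (tuples n k) (Rn (Suc n))"
    unfolding tuples_def using assms by (intro measurable_component_singleton) auto
  from measurable_compose[OF this measurable_Rn_component[OF assms(2)]] show ?thesis .
qed

text \<open>The Gaussian density is positive everywhere. Almost-everywhere statements about sections
  can therefore be checked against Lebesgue measure on tuples, where Fubini and boxes are
  available.\<close>

lemma null_sets_frames_iff: "S \<in> null_sets (frames n k) \<longleftrightarrow> S \<in> null_sets (tuples n k)"
proof -
  have m: "(\<lambda>A. ennreal (exp (- (\<Sum>j<Suc k. \<Sum>i<Suc n. (A j i)\<^sup>2) / 2))) \<in> borel_measurable (tuples n k)"
    by (intro measurable_compose[OF _ measurable_ennreal] measurable_compose[OF _ borel_measurable_exp]
          borel_measurable_divide borel_measurable_uminus borel_measurable_sum borel_measurable_power measurable_entry) auto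
  show ?thesis unfolding frames_eq
    by (subst null_sets_density_iff[OF m]) (auto simp: AE_iff_null_sets intro: AE_not_in)
qed

lemma measurable_gram_schmidt:
  assumes "N \<le> Suc n"
  shows "j < Suc k \<Longrightarrow> i < Suc n \<Longrightarrow> (\<lambda>A. gram_schmidt N A j i) \<in> borel_measurable (tuples n k)"
proof (induction j arbitrary: i rule: less_induct)
  case (less j)
  have [measurable]: "(\<lambda>A. gram_schmidt N A l i) \<in> borel_measurable (tuples n k)" if "l < j" "i < Suc n" for l i
    using less that by auto
  have [measurable]: "(\<lambda>A. A j i) \<in> borel_measurable (tuples n k)" if "i < Suc n" for i
    using less.prems that by (intro measurable_entry) auto
  have ipm: "(\<lambda>A. ip N (A j) (gram_schmidt N A l)) \<in> borel_measurable (tuples n k)" if "l < j" for l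
    using assms that by (intro borel_measurable_ip) auto
  have rm: "(\<lambda>A. gs_residual N A j i) \<in> borel_measurable (tuples n k)" if "i < Suc n" for i
    unfolding gs_residual_def using that by (intro borel_measurable_diff borel_measurable_sum borel_measurable_times ipm) auto
  have "(\<lambda>A. ip N (gs_residual N A j) (gs_residual N A j)) \<in> borel_measurable (tuples n k)"
    using assms by (intro borel_measurable_ip rm) auto
  with rm[OF less.prems(2)] show ?case unfolding gram_schmidt_eq by measurable
qed

lemma measurable_ip_gs_residual:
  assumes "N \<le> Suc n" "j < Suc k"
  shows "(\<lambda>A. ip N (gs_residual N A j) (gs_residual N A j)) \<in> borel_measurable (tuples n k)"
  unfolding gs_residual_def[abs_def] using assms
  by (intro borel_measurable_ip borel_measurable_diff borel_measurable_sum borel_measurable_times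
      measurable_entry measurable_gram_schmidt) auto

lemma measurable_height_sq [measurable]: "height_sq n k \<in> borel_measurable (tuples n k)"
  unfolding height_sq_def[abs_def]
  by (intro borel_measurable_sum borel_measurable_power measurable_gram_schmidt) auto

lemma measurable_independent_tuple [measurable]: "Measurable.pred (tuples n k) (independent_tuple n k)"
proof -
  have "{A \<in> space (tuples n k). ip (Suc n) (gs_residual (Suc n) A j) (gs_residual (Suc n) A j) \<noteq> 0} \<in> sets (tuples n k)"
    if "j < Suc k" for j
    using measurable_ip_gs_residual[OF order_refl that, of n] by measurable
  then have "Measurable.pred (tuples n k) (\<lambda>A. \<forall>j\<in>{..<Suc k}. ip (Suc n) (gs_residual (Suc n) A j) (gs_residual (Suc n) A j) \<noteq> 0)"
    by (intro pred_intros_finite) (auto simp: pred_def)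
  then show ?thesis by (simp only: independent_tuple_def[abs_def] Ball_def lessThan_iff)
qed

text \<open>A line parallel to the axis of a coordinate with \<open>w i \<noteq> 0\<close> meets the
  hyperplane in at most one point. The pairing may stop at \<open>N \<le> m\<close>, since
  Gram-Schmidt is also run on truncated vectors.\<close>

lemma null_hyperplane:
  assumes i: "i < N" "N \<le> m" and w: "w i \<noteq> 0"
  shows "emeasure (Rn m) {y \<in> space (Rn m). ip N y w = 0} = 0"
proof -
  let ?H = "{y \<in> space (Rn m). ip N y w = 0}"
  have H [measurable]: "?H \<in> sets (Rn m)"
  proof -
    have "(\<lambda>y. ip N y w) \<in> borel_measurable (Rn m)"
      using i by (intro borel_measurable_ip measurable_Rn_component) auto
    then show ?thesis by measurable
  qed
  have "emeasure (Rn m) ?H = (\<integral>\<^sup>+y. indicator ?H y \<partial>Rn m)" by simp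
  also have "\<dots> = (\<integral>\<^sup>+x. (\<integral>\<^sup>+t. indicator ?H (x(i := t)) \<partial>lborel) \<partial>(\<Pi>\<^sub>M j\<in>{..<m} - {i}. lborel))"
    by (rule nn_integral_Rn_coord) (use i in auto)
  also have "\<dots> = (\<integral>\<^sup>+x. 0 \<partial>(\<Pi>\<^sub>M j\<in>{..<m} - {i}. lborel :: real measure))"
  proof (rule nn_integral_cong)
    fix x :: "nat \<Rightarrow> real"
    define s where "s = (\<Sum>j\<in>{..<N} - {i}. x j * w j)"
    have "ip N (x(i := t)) w = t * w i + s" for t
    proof -
      have "ip N (x(i := t)) w = t * w i + (\<Sum>j\<in>{..<N} - {i}. (x(i := t)) j * w j)"
        unfolding ip_def using i by (subst sum.remove[of _ i]) auto
      also have "(\<Sum>j\<in>{..<N} - {i}. (x(i := t)) j * w j) = s" unfolding s_def by (rule sum.cong) auto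
      finally show ?thesis .
    qed
    then have "indicator ?H (x(i := t)) \<le> (indicator {- s / w i} t :: ennreal)" for t
      using w by (auto simp: indicator_def field_simps add_eq_0_iff2)
    then have "(\<integral>\<^sup>+t. indicator ?H (x(i := t)) \<partial>lborel) \<le> (\<integral>\<^sup>+t. indicator {- s / w i} t \<partial>lborel)"
      by (intro nn_integral_mono) auto
    then show "(\<integral>\<^sup>+t. indicator ?H (x(i := t)) \<partial>lborel) = 0" by simp
  qed
  finally show ?thesis by simp
qed

lemma gram_schmidt_cong: "(\<And>l. l \<le> j \<Longrightarrow> A l = B l) \<Longrightarrow> gram_schmidt N A j = gram_schmidt N B j"
proof (induction j rule: less_induct)
  case (less j)
  have "gs_residual N A j = gs_residual N B j" unfolding gs_residual_def[abs_def]
    using less by (auto intro!: sum.cong ext)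
  then show ?case by (simp add: gram_schmidt_eq)
qed

text \<open>Since the trace of the projection onto \<open>j\<close> vectors is at most \<open>j < N\<close>, some coordinate
  vector has a nonzero residual, which exhibits the span as part of a hyperplane.\<close>
lemma null_gs_residual_zero:
  assumes N: "N \<le> Suc n" and j: "j < N" "j < Suc k"
  shows "{A \<in> space (tuples n k). ip N (gs_residual N A j) (gs_residual N A j) = 0} \<in> null_sets (tuples n k)" (is "?Z \<in> _")
proof (rule null_setsI)
  show Zm: "?Z \<in> sets (tuples n k)" using measurable_ip_gs_residual[OF N j(2)] by measurable
  define I where "I = {..<Suc k} - {j}"
  have I: "insert j I = {..<Suc k}" "finite I" "j \<notin> I" using j by (auto simp: I_def)
  have "emeasure (tuples n k) ?Z = (\<integral>\<^sup>+A. indicator ?Z A \<partial>(\<Pi>\<^sub>M j\<in>insert j I. Rn (Suc n)))"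
    using Zm by (simp add: I tuples_def)
  also have "\<dots> = (\<integral>\<^sup>+A. (\<integral>\<^sup>+y. indicator ?Z (A(j := y)) \<partial>Rn (Suc n)) \<partial>(\<Pi>\<^sub>M j\<in>I. Rn (Suc n)))"
    by (rule RnP.product_nn_integral_insert[OF I(2,3)]) (use Zm in \<open>simp add: I tuples_def\<close>)
  also have "\<dots> = (\<integral>\<^sup>+A. 0 \<partial>(\<Pi>\<^sub>M j\<in>I. Rn (Suc n)))"
  proof (rule nn_integral_cong)
    fix A :: "nat \<Rightarrow> nat \<Rightarrow> real"
    let ?g = "gram_schmidt N A"
    have nrm: "ip N (?g l) (?g l) \<le> 1" for l by (simp add: ip_gram_schmidt_self)
    have "(\<Sum>i<N. \<Sum>l<j. (?g l i)\<^sup>2) = (\<Sum>l<j. ip N (?g l) (?g l))"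
      by (subst sum.swap) (simp add: ip_def power2_eq_square)
    also have "\<dots> \<le> (\<Sum>l<j. 1)" by (intro sum_mono nrm)
    also have "\<dots> < (\<Sum>i<N. 1)" using j by simp
    finally have "\<exists>i<N. (\<Sum>l<j. (?g l i)\<^sup>2) < 1"
      using sum_mono[of "{..<N}" "\<lambda>_. 1" "\<lambda>i. \<Sum>l<j. (?g l i)\<^sup>2"] by (meson lessThan_iff not_le)
    then obtain i where i: "i < N" "(\<Sum>l<j. (?g l i)\<^sup>2) < 1" by blast
    \<comment> \<open>\<open>w\<close> is row \<open>i\<close> of the identity minus the projection
      onto the span of the \<open>?g l\<close> with \<open>l < j\<close>. That matrix is symmetric,
      so pairing \<open>y\<close> with \<open>w\<close> yields entry \<open>i\<close> of the
      residual of \<open>y\<close>. The entry \<open>w i\<close> is 1 minus the sum just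
      bounded.\<close>
    define w where "w q = (if q = i then 1 else 0) - (\<Sum>l<j. ?g l i * ?g l q)" for q
    have wi: "w i \<noteq> 0" using i by (simp add: w_def power2_eq_square)
    have "gs_residual N (A(j := y)) j i = ip N y w" for y
    proof -
      have "gram_schmidt N (A(j := y)) l = ?g l" if "l < j" for l by (rule gram_schmidt_cong) (use that in auto)
      then have "gs_residual N (A(j := y)) j i = y i - (\<Sum>l<j. ip N y (?g l) * ?g l i)" by (simp add: gs_residual_def)
      moreover have "ip N y w = y i - (\<Sum>l<j. ?g l i * ip N y (?g l))"
      proof -
        have "ip N y (\<lambda>q. if q = i then 1 else 0) = y i"
          unfolding ip_def using i(1) by (subst sum.remove[of _ i]) auto
        then show ?thesis unfolding w_def[abs_def] by (simp only: ip_diff_right ip_sum_right)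
      qed
      ultimately show ?thesis by (simp add: mult.commute)
    qed
    then have "indicator ?Z (A(j := y)) \<le> (indicator {y \<in> space (Rn (Suc n)). ip N y w = 0} y :: ennreal)"
      if "y \<in> space (Rn (Suc n))" for y
      using that ip_self_zeroD[OF _ i(1), of "gs_residual N (A(j := y)) j"] by (auto simp: indicator_def)
    then have "(\<integral>\<^sup>+y. indicator ?Z (A(j := y)) \<partial>Rn (Suc n)) \<le> (\<integral>\<^sup>+y. indicator {y \<in> space (Rn (Suc n)). ip N y w = 0} y \<partial>Rn (Suc n))"
      by (intro nn_integral_mono)
    also have "\<dots> = emeasure (Rn (Suc n)) {y \<in> space (Rn (Suc n)). ip N y w = 0}"
    proof (rule nn_integral_indicator)
      have "(\<lambda>y. ip N y w) \<in> borel_measurable (Rn (Suc n))"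
        using N by (intro borel_measurable_ip measurable_Rn_component) auto
      then show "{y \<in> space (Rn (Suc n)). ip N y w = 0} \<in> sets (Rn (Suc n))" by measurable
    qed
    also have "\<dots> = 0" by (rule null_hyperplane[where i=i]) (use i(1) N wi in auto)
    finally show "(\<integral>\<^sup>+y. indicator ?Z (A(j := y)) \<partial>Rn (Suc n)) = 0" by simp
  qed
  finally show "emeasure (tuples n k) ?Z = 0" by simp
qed

text \<open>Height 1 is equality in Bessel, so the pole lies in the span. The combination of the
  \<open>A j\<close> representing it vanishes in the first \<open>n\<close> coordinates but not in
  the last, so the tuple truncated to \<open>n\<close> coordinates is dependent. For
  \<open>k + 1 \<le> n\<close> vectors in dimension \<open>n\<close> this is a null event, which is
  why residuals are taken with \<open>N = n\<close> here.\<close>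

lemma null_through_pole:
  assumes kn: "Suc k \<le> n"
  shows "{A \<in> space (tuples n k). independent_tuple n k A \<and> height_sq n k A = 1} \<in> null_sets (tuples n k)"
proof (rule null_sets_subset)
  let ?Z = "\<lambda>j. {A \<in> space (tuples n k). ip n (gs_residual n A j) (gs_residual n A j) = 0}"
  show "(\<Union>j\<in>{..<Suc k}. ?Z j) \<in> null_sets (tuples n k)"
    using kn by (intro null_sets_UN' null_gs_residual_zero) auto
  show "{A \<in> space (tuples n k). independent_tuple n k A \<and> height_sq n k A = 1} \<in> sets (tuples n k)" by measurable
  show "{A \<in> space (tuples n k). independent_tuple n k A \<and> height_sq n k A = 1} \<subseteq> (\<Union>j\<in>{..<Suc k}. ?Z j)"
  proof (rule subsetI, rule ccontr)
    fix A assume "A \<in> {A \<in> space (tuples n k). independent_tuple n k A \<and> height_sq n k A = 1}" "A \<notin> (\<Union>j\<in>{..<Suc k}. ?Z j)"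
    then have r: "height_sq n k A = 1" and nz: "\<And>j. j < Suc k \<Longrightarrow> ip n (gs_residual n A j) (gs_residual n A j) \<noteq> 0" by auto
    let ?g = "gram_schmidt (Suc n) A"
    have on: "orig n n = 1" by (simp add: orig_def)
    have z: "ip (Suc n) (\<lambda>i. orig n i - (\<Sum>j<Suc k. ip (Suc n) (orig n) (?g j) * ?g j i))
        (\<lambda>i. orig n i - (\<Sum>j<Suc k. ip (Suc n) (orig n) (?g j) * ?g j i)) = 0"
      unfolding orthogonal_system_residual[OF orthogonal_system_gram_schmidt] using r
      by (simp add: ip_orig_left height_sq_def on)
    have "orig n i = (\<Sum>j<Suc k. ?g j n * ?g j i)" if "i < Suc n" for i
      using ip_self_zeroD[OF z that] by (simp only: ip_orig_left)
    then have "in_span (Suc n) (Suc k) ?g (orig n)"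
      unfolding in_span_def by (intro exI[of _ "\<lambda>j. ?g j n"] allI impI)
    then obtain c where c: "\<And>i. i < Suc n \<Longrightarrow> orig n i = (\<Sum>j<Suc k. c j * A j i)"
      unfolding in_span_gram_schmidt_iff by (auto simp: in_span_def)
    have "(\<Sum>j<Suc k. c j * A j i) = 0" if "i < n" for i
      using c[of i] that by (simp add: orig_def)
    then have "c j = 0" if "j < Suc k" for j
      using gram_schmidt_independent[of "Suc k" n A c j] nz that by blast
    then show False using c[of n] by (simp add: orig_def)
  qed
qed

section \<open>Every range of heights has positive measure\<close>

lemma gram_schmidt_orthonormal:
  assumes "\<And>i j. i < K \<Longrightarrow> j < K \<Longrightarrow> ip N (A i) (A j) = (if i = j then 1 else 0)"
  shows "j < K \<Longrightarrow> gram_schmidt N A j = A j \<and> gs_residual N A j = A j"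
proof (induction j rule: less_induct)
  case (less j)
  have "gs_residual N A j i = A j i" for i
  proof -
    have "(\<Sum>l<j. ip N (A j) (gram_schmidt N A l) * gram_schmidt N A l i) = 0"
      using less assms by (intro sum.neutral) auto
    then show ?thesis by (simp add: gs_residual_def)
  qed
  then have "gs_residual N A j = A j" by auto
  then show ?case using assms[of j j] less.prems by (simp add: gram_schmidt_eq)
qed

lemma tendsto_ip [tendsto_intros]:
  assumes "\<And>i. i < N \<Longrightarrow> ((\<lambda>m. x m i) \<longlongrightarrow> x' i) F" "\<And>i. i < N \<Longrightarrow> ((\<lambda>m. y m i) \<longlongrightarrow> y' i) F"
  shows "((\<lambda>m. ip N (x m) (y m)) \<longlongrightarrow> ip N x' y') F"
  unfolding ip_def using assms by (intro tendsto_sum tendsto_mult) auto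

text \<open>Nonzero residuals at the limit keep the normalisation continuous. Convergence of the
  residual norms is part of the induction because it is also what shows nearby tuples to be
  independent.\<close>

lemma tendsto_gram_schmidt:
  assumes X: "\<And>j i. j < K \<Longrightarrow> i < N \<Longrightarrow> ((\<lambda>m. X m j i) \<longlongrightarrow> A j i) F"
    and nz: "\<And>j. j < K \<Longrightarrow> ip N (gs_residual N A j) (gs_residual N A j) \<noteq> 0"
  shows "j < K \<Longrightarrow> (\<forall>i<N. ((\<lambda>m. gram_schmidt N (X m) j i) \<longlongrightarrow> gram_schmidt N A j i) F) \<and>
      ((\<lambda>m. ip N (gs_residual N (X m) j) (gs_residual N (X m) j)) \<longlongrightarrow> ip N (gs_residual N A j) (gs_residual N A j)) F"
proof (induction j rule: less_induct)
  case (less j)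
  have g: "((\<lambda>m. gram_schmidt N (X m) l i) \<longlongrightarrow> gram_schmidt N A l i) F" if "l < j" "i < N" for l i
    using less that by auto
  have r: "((\<lambda>m. gs_residual N (X m) j i) \<longlongrightarrow> gs_residual N A j i) F" if "i < N" for i
    unfolding gs_residual_def using that less.prems
    by (intro tendsto_diff tendsto_sum tendsto_mult tendsto_ip X g) auto
  have ipr: "((\<lambda>m. ip N (gs_residual N (X m) j) (gs_residual N (X m) j)) \<longlongrightarrow> ip N (gs_residual N A j) (gs_residual N A j)) F"
    by (intro tendsto_ip r)
  have "((\<lambda>m. gram_schmidt N (X m) j i) \<longlongrightarrow> gram_schmidt N A j i) F" if "i < N" for i
    unfolding gram_schmidt_eq using nz[OF less.prems] by (intro tendsto_divide r that tendsto_real_sqrt ipr) auto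
  with ipr show ?case by blast
qed

text \<open>Strict bounds on the height together with independence persist near an independent
  tuple, because Gram-Schmidt is continuous there. One tuple of suitable height therefore has a
  whole box of positive measure around it.\<close>

lemma positive_height_tuples:
  assumes kn: "Suc k \<le> n" and ab: "0 < a" "a < b" "b < 1"
  shows "emeasure (tuples n k) {A \<in> space (tuples n k). independent_tuple n k A \<and> a < height_sq n k A \<and> height_sq n k A < b} > 0"
proof -
  let ?W = "{A \<in> space (tuples n k). independent_tuple n k A \<and> a < height_sq n k A \<and> height_sq n k A < b}"
  define \<tau> where "\<tau> = (a + b) / 2"
  have \<tau>: "a < \<tau>" "\<tau> < b" "0 < \<tau>" "\<tau> < 1" using ab by (auto simp: \<tau>_def)
  \<comment> \<open>The first vector is tilted towards the pole in the plane of coordinates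
    \<open>0\<close> and \<open>n\<close> and carries the whole height \<open>sqrt \<tau>\<close>.
    The others are the coordinate vectors \<open>1\<close> to \<open>k\<close>, orthogonal to the
    pole because \<open>k < n\<close>.\<close>
  define A0 :: "nat \<Rightarrow> nat \<Rightarrow> real" where
    "A0 j i = (if j = 0 then (if i = n then sqrt \<tau> else if i = 0 then sqrt (1 - \<tau>) else 0)
       else (if i = j then 1 else 0))" for j i
  have on: "ip (Suc n) (A0 i) (A0 j) = (if i = j then 1 else 0)" if ij: "i < Suc k" "j < Suc k" for i j
  proof -
    have *: "ip (Suc n) x (A0 j) = x j" if "0 < j" "j < Suc k" for x j
      unfolding ip_def using that kn
      by (subst sum.remove[of _ j]) (auto simp: A0_def intro!: sum.neutral simp del: sum.lessThan_Suc)
    have **: "ip (Suc n) (A0 0) (A0 0) = 1"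
    proof -
      have "{..<Suc n} = insert n (insert 0 {1..<n})" using kn by auto
      then have "ip (Suc n) (A0 0) (A0 0) = A0 0 n * A0 0 n + (A0 0 0 * A0 0 0 + (\<Sum>i\<in>{1..<n}. A0 0 i * A0 0 i))"
        using kn unfolding ip_def by simp
      moreover have "(\<Sum>i\<in>{1..<n}. A0 0 i * A0 0 i) = 0" by (intro sum.neutral) (auto simp: A0_def)
      moreover have "A0 0 n = sqrt \<tau>" "A0 0 0 = sqrt (1 - \<tau>)" using kn by (auto simp: A0_def)
      ultimately show ?thesis using \<tau> by simp
    qed
    show ?thesis
    proof (cases "j = 0")
      case True
      show ?thesis
      proof (cases "i = 0")
        case True then show ?thesis using ** \<open>j = 0\<close> by simp
      next
        case False
        then show ?thesis using *[of i "A0 0"] ij kn True by (simp add: ip_commute A0_def)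
      qed
    next
      case False
      then show ?thesis using *[of j "A0 i"] ij kn by (auto simp: A0_def)
    qed
  qed
  have gsA0: "gram_schmidt (Suc n) A0 j = A0 j" "gs_residual (Suc n) A0 j = A0 j" if "j < Suc k" for j
    using gram_schmidt_orthonormal[of "Suc k" "Suc n" A0 j] on that by auto
  have nzA0: "ip (Suc n) (gs_residual (Suc n) A0 j) (gs_residual (Suc n) A0 j) \<noteq> 0" if "j < Suc k" for j
    using gsA0(2)[OF that] on[OF that that] by simp
  have rhoA0: "height_sq n k A0 = \<tau>"
  proof -
    have "height_sq n k A0 = (\<Sum>j<Suc k. (A0 j n)\<^sup>2)" unfolding height_sq_def by (intro sum.cong) (auto simp: gsA0)
    also have "\<dots> = (A0 0 n)\<^sup>2 + (\<Sum>j\<in>{..<Suc k} - {0}. (A0 j n)\<^sup>2)" by (subst sum.remove[of _ 0]) auto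
    also have "(\<Sum>j\<in>{..<Suc k} - {0}. (A0 j n)\<^sup>2) = 0" using kn by (intro sum.neutral) (auto simp: A0_def)
    finally have "height_sq n k A0 = (A0 0 n)\<^sup>2" by simp
    also have "A0 0 n = sqrt \<tau>" by (simp add: A0_def)
    finally show ?thesis using \<tau> by simp
  qed
  define \<delta> :: "nat \<Rightarrow> real" where "\<delta> m = 1 / real (Suc m)" for m
  define Bx where "Bx m = (\<Pi>\<^sub>E j\<in>{..<Suc k}. \<Pi>\<^sub>E i\<in>{..<Suc n}. {A0 j i - \<delta> m <..< A0 j i + \<delta> m})" for m
  have Bs: "Bx m \<in> sets (tuples n k)" for m
    unfolding Bx_def tuples_def by (intro sets_PiM_I_finite sets_Rn_box) auto
  have Bpos: "emeasure (tuples n k) (Bx m) > 0" for m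
  proof -
    have d: "\<delta> m > 0" by (simp add: \<delta>_def)
    have "emeasure (tuples n k) (Bx m) = (\<Prod>j<Suc k. \<Prod>i<Suc n. emeasure lborel {A0 j i - \<delta> m <..< A0 j i + \<delta> m})"
      unfolding Bx_def tuples_def
      by (subst RnP.emeasure_PiM) (auto simp: emeasure_Rn_box intro!: sets_Rn_box simp del: prod.lessThan_Suc)
    also have "\<dots> = (\<Prod>j<Suc k. \<Prod>i<Suc n. ennreal (2 * \<delta> m))"
      using d by (intro prod.cong) auto
    also have "\<dots> = ennreal (((2 * \<delta> m) ^ Suc n) ^ Suc k)"
      using d by (simp only: prod_constant card_lessThan ennreal_power zero_le_power mult_nonneg_nonneg less_imp_le zero_le_numeral)
    also have "\<dots> > 0" using d by (simp only: ennreal_less_zero_iff zero_less_power mult_pos_pos zero_less_numeral)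
    finally show ?thesis .
  qed
  \<comment> \<open>If no box were contained in \<open>?W\<close>, points outside it chosen from the
    shrinking boxes would converge to \<open>A0\<close>, against continuity.\<close>
  have "\<exists>m. Bx m \<subseteq> ?W"
  proof (rule ccontr)
    assume "\<nexists>m. Bx m \<subseteq> ?W"
    then have "\<forall>m. \<exists>A. A \<in> Bx m \<and> A \<notin> ?W" by blast
    from choice[OF this] obtain X where "\<forall>m. X m \<in> Bx m \<and> X m \<notin> ?W" ..
    then have X: "\<And>m. X m \<in> Bx m" "\<And>m. X m \<notin> ?W" by blast+
    have lim: "(\<lambda>m. X m j i) \<longlonglongrightarrow> A0 j i" if "j < Suc k" "i < Suc n" for j i
    proof (rule LIMSEQ_I)
      fix r :: real assume "r > 0"
      then obtain m0 where m0: "inverse (real (Suc m0)) < r" using reals_Archimedean by blast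
      have "norm (X m j i - A0 j i) < r" if "m \<ge> m0" for m
      proof -
        have "X m j \<in> (\<Pi>\<^sub>E i\<in>{..<Suc n}. {A0 j i - \<delta> m <..< A0 j i + \<delta> m})"
          using X(1)[of m] \<open>j < Suc k\<close> unfolding Bx_def by (auto simp: PiE_def Pi_def)
        then have "X m j i \<in> {A0 j i - \<delta> m <..< A0 j i + \<delta> m}"
          using \<open>i < Suc n\<close> by (auto simp: PiE_def Pi_def)
        moreover have "\<delta> m \<le> inverse (real (Suc m0))"
          unfolding \<delta>_def inverse_eq_divide using that by (intro divide_left_mono) auto
        ultimately show ?thesis using m0 by auto
      qed
      then show "\<exists>no. \<forall>m\<ge>no. norm (X m j i - A0 j i) < r" by blast
    qed
    note T = tendsto_gram_schmidt[OF lim nzA0]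
    have "(\<lambda>m. height_sq n k (X m)) \<longlonglongrightarrow> height_sq n k A0"
      unfolding height_sq_def using T by (intro tendsto_sum tendsto_power) auto
    then have "eventually (\<lambda>m. a < height_sq n k (X m)) sequentially" "eventually (\<lambda>m. height_sq n k (X m) < b) sequentially"
      unfolding rhoA0 using \<tau> by (auto dest: order_tendstoD)
    moreover have "eventually (\<lambda>m. \<forall>j\<in>{..<Suc k}. ip (Suc n) (gs_residual (Suc n) (X m) j) (gs_residual (Suc n) (X m) j) \<noteq> 0) sequentially"
      using T nzA0 by (intro eventually_ball_finite) (auto intro!: tendsto_imp_eventually_ne)
    ultimately have "eventually (\<lambda>m. independent_tuple n k (X m) \<and> a < height_sq n k (X m) \<and> height_sq n k (X m) < b) sequentially"
      by eventually_elim (auto simp: independent_tuple_def)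
    then obtain m where "independent_tuple n k (X m) \<and> a < height_sq n k (X m) \<and> height_sq n k (X m) < b"
      by (auto simp: eventually_sequentially)
    moreover have "X m \<in> space (tuples n k)" using X(1)[of m] Bs[of m] sets.sets_into_space by blast
    ultimately show False using X(2)[of m] by blast
  qed
  then obtain m where "Bx m \<subseteq> ?W" by blast
  then have "emeasure (tuples n k) (Bx m) \<le> emeasure (tuples n k) ?W" by (intro emeasure_mono) auto
  with Bpos[of m] show ?thesis by (rule less_le_trans)
qed

section \<open>The measure on the space of sections\<close>

lemma vimage_gspan_Xi:
  "gspan n k -` {\<xi> \<in> Xi n k. P (cos (d0set n \<xi>))} \<inter> space (tuples n k) =
    {A \<in> space (tuples n k). independent_tuple n k A \<and> height_sq n k A > 0 \<and> P (sqrt (height_sq n k A))}"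
  by (auto simp: gspan_in_Xi_iff cos_d0set_gspan)

definition Xi_sets :: "nat \<Rightarrow> nat \<Rightarrow> (nat \<Rightarrow> real) set set set" where
  "Xi_sets n k = {E. E \<subseteq> Xi n k \<and> gspan n k -` E \<inter> space (tuples n k) \<in> sets (tuples n k)}"

lemma height_in_Xi_sets:
  assumes "Measurable.pred borel P"
  shows "{\<xi> \<in> Xi n k. P (cos (d0set n \<xi>))} \<in> Xi_sets n k"
proof -
  have [measurable]: "Measurable.pred borel P" by fact
  have "{A \<in> space (tuples n k). independent_tuple n k A \<and> height_sq n k A > 0 \<and> P (sqrt (height_sq n k A))} \<in> sets (tuples n k)"
    by measurable
  then show ?thesis unfolding Xi_sets_def vimage_gspan_Xi[symmetric] by auto
qed

text \<open>The map \<open>gspan\<close> is not measurable into \<open>Xi n k\<close> in the library sense, since degenerate tuples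
  are mapped outside; the set function in the definition of \<open>distr\<close> is nevertheless a measure.\<close>
lemma sigma_algebra_Xi_sets: "sigma_algebra (Xi n k) (Xi_sets n k)"
  unfolding sigma_algebra_iff2
proof (intro conjI ballI allI impI)
  have X: "Xi n k \<in> Xi_sets n k" using height_in_Xi_sets[of "\<lambda>_. True"] by simp
  show "Xi_sets n k \<subseteq> Pow (Xi n k)" "{} \<in> Xi_sets n k" by (auto simp: Xi_sets_def)
  fix E assume E: "E \<in> Xi_sets n k"
  have "gspan n k -` (Xi n k - E) \<inter> space (tuples n k) =
     (gspan n k -` Xi n k \<inter> space (tuples n k)) - (gspan n k -` E \<inter> space (tuples n k))" by auto
  also have "\<dots> \<in> sets (tuples n k)" using X E by (auto simp: Xi_sets_def)
  finally show "Xi n k - E \<in> Xi_sets n k" by (auto simp: Xi_sets_def)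
next
  fix A :: "nat \<Rightarrow> _" assume A: "range A \<subseteq> Xi_sets n k"
  have "gspan n k -` (\<Union>i. A i) \<inter> space (tuples n k) = (\<Union>i. gspan n k -` A i \<inter> space (tuples n k))" by auto
  also have "\<dots> \<in> sets (tuples n k)"
    by (rule sets.countable_UN) (use A in \<open>auto simp: Xi_sets_def\<close>)
  finally show "(\<Union>i. A i) \<in> Xi_sets n k" using A by (auto simp: Xi_sets_def)
qed

lemma Xi_sigma: "sets (sigma (Xi n k) (Xi_sets n k)) = Xi_sets n k" "space (sigma (Xi n k) (Xi_sets n k)) = Xi n k"
proof -
  interpret sigma_algebra "Xi n k" "Xi_sets n k" by (rule sigma_algebra_Xi_sets)
  show "sets (sigma (Xi n k) (Xi_sets n k)) = Xi_sets n k" "space (sigma (Xi n k) (Xi_sets n k)) = Xi n k"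
    using space_closed by (auto simp: sets_measure_of_eq space_measure_of_conv)
qed

lemma Xi_measure_eq: "Xi_measure n k = distr (frames n k) (sigma (Xi n k) (Xi_sets n k)) (gspan n k)"
  by (simp add: Xi_measure_def Xi_sets_def)

lemma sets_Xi_measure: "sets (Xi_measure n k) = Xi_sets n k"
  and space_Xi_measure: "space (Xi_measure n k) = Xi n k"
  by (simp_all add: Xi_measure_eq Xi_sigma)

lemma emeasure_Xi_measure:
  assumes "E \<in> Xi_sets n k"
  shows "emeasure (Xi_measure n k) E = emeasure (frames n k) (gspan n k -` E \<inter> space (tuples n k))"
proof -
  let ?\<mu> = "\<lambda>A. emeasure (frames n k) (gspan n k -` A \<inter> space (tuples n k))"
  have "countably_additive (Xi_sets n k) ?\<mu>"
    unfolding countably_additive_def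
  proof (intro allI impI)
    fix A :: "nat \<Rightarrow> _" assume A: "range A \<subseteq> Xi_sets n k" "disjoint_family A"
    have "disjoint_family (\<lambda>i. gspan n k -` A i \<inter> space (tuples n k))"
      using A(2) unfolding disjoint_family_on_def by blast
    then have "(\<Sum>i. ?\<mu> (A i)) = emeasure (frames n k) (\<Union>i. gspan n k -` A i \<inter> space (tuples n k))"
      using A by (intro suminf_emeasure) (auto simp: Xi_sets_def)
    also have "(\<Union>i. gspan n k -` A i \<inter> space (tuples n k)) = gspan n k -` (\<Union>i. A i) \<inter> space (tuples n k)" by auto
    finally show "(\<Sum>i. ?\<mu> (A i)) = ?\<mu> (\<Union>i. A i)" .
  qed
  moreover have "positive (Xi_sets n k) ?\<mu>" by (simp add: positive_def)
  ultimately show ?thesis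
    unfolding Xi_measure_eq distr_def Xi_sigma space_frames
    by (intro emeasure_measure_of_sigma[OF sigma_algebra_Xi_sets _ _ assms])
qed

lemma measurable_height [measurable]: "(\<lambda>\<xi>. cos (d0set n \<xi>)) \<in> borel_measurable (Xi_measure n k)"
proof (rule measurableI)
  fix B :: "real set" assume [measurable]: "B \<in> sets borel"
  have "{\<xi> \<in> Xi n k. cos (d0set n \<xi>) \<in> B} \<in> Xi_sets n k"
    by (rule height_in_Xi_sets) measurable
  also have "{\<xi> \<in> Xi n k. cos (d0set n \<xi>) \<in> B} = (\<lambda>\<xi>. cos (d0set n \<xi>)) -` B \<inter> Xi n k" by auto
  finally show "(\<lambda>\<xi>. cos (d0set n \<xi>)) -` B \<inter> space (Xi_measure n k) \<in> sets (Xi_measure n k)"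
    by (simp add: sets_Xi_measure space_Xi_measure)
qed simp

lemma AE_Xi_height:
  assumes kn: "Suc k \<le> n"
  shows "AE \<xi> in Xi_measure n k. cos (d0set n \<xi>) < 1"
proof (rule AE_I')
  let ?E = "{\<xi> \<in> Xi n k. cos (d0set n \<xi>) = 1}"
  have E: "?E \<in> Xi_sets n k" by (rule height_in_Xi_sets) measurable
  have "gspan n k -` ?E \<inter> space (tuples n k) = {A \<in> space (tuples n k). independent_tuple n k A \<and> height_sq n k A = 1}"
    unfolding vimage_gspan_Xi[of n k "\<lambda>x. x = 1"] by (intro Collect_cong conj_cong refl) auto
  then have "emeasure (Xi_measure n k) ?E = 0"
    using null_through_pole[OF kn] E by (simp add: emeasure_Xi_measure null_sets_frames_iff[symmetric] null_setsD1)
  then show "?E \<in> null_sets (Xi_measure n k)" using E by (auto intro!: null_setsI simp: sets_Xi_measure)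
  show "{\<xi> \<in> space (Xi_measure n k). \<not> cos (d0set n \<xi>) < 1} \<subseteq> ?E"
    unfolding space_Xi_measure by (auto simp: not_less dest: Xi_height(2) intro: antisym)
qed

text \<open>Turns an almost-everywhere statement into a usable instance; the height can be confined
  to an interval but not prescribed exactly. The bounds are squared on the way, since positivity is
  known for \<open>height_sq\<close> and the cosine is its root.\<close>

lemma ex_Xi_height:
  assumes kn: "Suc k \<le> n" and ab: "0 < a" "a < b" "b < 1" and ae: "AE \<xi> in Xi_measure n k. P \<xi>"
  shows "\<exists>\<xi> \<in> Xi n k. a < cos (d0set n \<xi>) \<and> cos (d0set n \<xi>) < b \<and> P \<xi>"
proof (rule ccontr)
  assume no: "\<not> ?thesis"
  let ?E = "{\<xi> \<in> Xi n k. a < cos (d0set n \<xi>) \<and> cos (d0set n \<xi>) < b}"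
  have E: "?E \<in> Xi_sets n k" by (rule height_in_Xi_sets) measurable
  have "AE \<xi> in Xi_measure n k. \<xi> \<notin> ?E" using ae by eventually_elim (use no in auto)
  then have "?E \<in> null_sets (Xi_measure n k)" using E by (subst AE_iff_null_sets) (auto simp: sets_Xi_measure)
  then have "emeasure (frames n k) (gspan n k -` ?E \<inter> space (tuples n k)) = 0"
    using emeasure_Xi_measure[OF E] by (simp add: null_setsD1)
  then have N: "gspan n k -` ?E \<inter> space (tuples n k) \<in> null_sets (tuples n k)"
    using E by (subst null_sets_frames_iff[symmetric]) (auto intro!: null_setsI simp: Xi_sets_def)
  have ab2: "0 < a\<^sup>2" "a\<^sup>2 < b\<^sup>2" "b\<^sup>2 < 1"
    using ab by (auto intro: power_strict_mono simp: power_less_one_iff abs_square_less_1)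
  have "{A \<in> space (tuples n k). independent_tuple n k A \<and> a\<^sup>2 < height_sq n k A \<and> height_sq n k A < b\<^sup>2} \<subseteq> gspan n k -` ?E \<inter> space (tuples n k)"
    unfolding vimage_gspan_Xi[of n k "\<lambda>x. a < x \<and> x < b"]
  proof clarsimp
    fix A assume A: "a\<^sup>2 < height_sq n k A" "height_sq n k A < b\<^sup>2"
    have "0 < height_sq n k A" using A ab2 by linarith
    then show "0 < height_sq n k A \<and> a < sqrt (height_sq n k A) \<and> sqrt (height_sq n k A) < b"
      using A ab real_less_rsqrt[of a "height_sq n k A"] real_sqrt_less_mono[OF A(2)] by auto
  qed
  then have "emeasure (tuples n k) {A \<in> space (tuples n k). independent_tuple n k A \<and> a\<^sup>2 < height_sq n k A \<and> height_sq n k A < b\<^sup>2} \<le>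
     emeasure (tuples n k) (gspan n k -` ?E \<inter> space (tuples n k))"
    using N by (intro emeasure_mono) auto
  also have "\<dots> = 0" using N by (simp add: null_setsD1)
  finally show False using positive_height_tuples[OF kn ab2] by simp
qed

section \<open>Reduction to profiles\<close>

definition profile_pow :: "nat \<Rightarrow> real \<Rightarrow> real \<Rightarrow> real \<Rightarrow> (real \<Rightarrow> real) \<Rightarrow> ennreal" where
  "profile_pow n a1 a2 p F = (\<integral>\<^sup>+t. ennreal (\<bar>F t\<bar> powr p * sqrt (1 - t\<^sup>2) powr a1 * \<bar>t\<bar> powr a2) \<partial>slice_measure n)"

lemma sph_last_bound: "x \<in> sph (Suc n) \<Longrightarrow> -1 \<le> x n \<and> x n \<le> 1"
  using component_le_ip[of n "Suc n" x] by (auto simp: sph_def abs_square_le_1 abs_le_iff)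

lemma wLp_pow_radial:
  assumes n: "n \<ge> 1" and [measurable]: "F \<in> borel_measurable borel" and f: "\<And>x. x \<in> sph (Suc n) \<Longrightarrow> f x = F (x n)"
  shows "wLp_pow n a1 a2 p f = profile_pow n a1 a2 p F"
proof -
  let ?\<phi> = "\<lambda>t. ennreal (\<bar>F t\<bar> powr p * sqrt (1 - t\<^sup>2) powr a1 * \<bar>t\<bar> powr a2)"
  have "orig n n = 1" by (simp add: orig_def)
  then have oo: "ip (Suc n) (orig n) (orig n) = 1" by (simp add: ip_orig_left)
  have "wLp_pow n a1 a2 p f = (\<integral>\<^sup>+x. ?\<phi> (ip (Suc n) x (orig n)) \<partial>surf (Suc n))"
    unfolding wLp_pow_def
  proof (rule nn_integral_cong)
    fix x assume "x \<in> space (surf (Suc n))"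
    then have x: "x \<in> sph (Suc n)" by (simp add: space_surf)
    then show "ennreal (\<bar>f x\<bar> powr p * sin (d0 n x) powr a1 * \<bar>cos (d0 n x)\<bar> powr a2) = ?\<phi> (ip (Suc n) x (orig n))"
      using sph_last_bound[OF x]
      by (simp add: f d0_eq ip_commute[of _ x] ip_orig_left sin_arccos cos_arccos)
  qed
  also have "\<dots> = profile_pow n a1 a2 p F"
    unfolding profile_pow_def by (subst nn_integral_surf_linear[OF n]) (simp_all add: oo)
  finally show ?thesis .
qed

text \<open>\<open>frame_of\<close> picks an unspecified frame. On it \<open>f\<close> becomes
  \<open>F\<close> of the linear form whose coefficients are the last coordinates of the frame
  vectors. Their norm is \<open>cos (d0set n \<xi>)\<close> for every frame, and only this norm
  enters the distribution of the form on the unit sphere.\<close>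

lemma Rk_radial:
  assumes k: "k \<ge> 1" and F [measurable]: "F \<in> borel_measurable borel" and f: "\<And>x. x \<in> sph (Suc n) \<Longrightarrow> f x = F (x n)"
    and xi: "\<xi> \<in> Xi n k"
  shows "Rk_integrable n k f \<xi> \<longleftrightarrow> integrable (slice_measure k) (\<lambda>t. F (cos (d0set n \<xi>) * t))"
    and "Rk n k f \<xi> = (\<integral>t. F (cos (d0set n \<xi>) * t) \<partial>slice_measure k)"
proof -
  let ?u = "frame_of n k \<xi>"
  let ?w = "\<lambda>j. ?u j n"
  let ?r = "cos (d0set n \<xi>)"
  note u = frame_of_Xi[OF xi]
  have r: "sqrt (ip (Suc k) ?w ?w) = ?r"
    using cos_d0set_onframe[OF u(1)] unfolding u(2) by (simp add: ip_def power2_eq_square)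
  have eq: "f (emb n k ?u c) = F (ip (Suc k) c ?w)" if "c \<in> space (surf (Suc k))" for c
  proof -
    have "emb n k ?u c \<in> sph (Suc n)"
      using that ip_emb[OF u(1), of c] by (auto simp: space_surf sph_def space_Rn emb_def)
    then show ?thesis using f by (simp add: emb_last)
  qed
  have "Rk_integrable n k f \<xi> \<longleftrightarrow> integrable (surf (Suc k)) (\<lambda>c. F (ip (Suc k) c ?w))"
    unfolding Rk_integrable_def by (rule Bochner_Integration.integrable_cong) (auto simp: eq)
  also have "\<dots> \<longleftrightarrow> integrable (distr (surf (Suc k)) borel (\<lambda>c. ip (Suc k) c ?w)) F"
    by (rule integrable_distr_eq[symmetric]) measurable
  also have "\<dots> \<longleftrightarrow> integrable (slice_measure k) (\<lambda>t. F (?r * t))"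
    unfolding distr_surf_linear[OF k] r by (rule integrable_distr_eq) measurable
  finally show "Rk_integrable n k f \<xi> \<longleftrightarrow> integrable (slice_measure k) (\<lambda>t. F (?r * t))" .
  have "Rk n k f \<xi> = (\<integral>c. F (ip (Suc k) c ?w) \<partial>surf (Suc k))"
    unfolding Rk_def by (rule Bochner_Integration.integral_cong) (auto simp: eq)
  also have "\<dots> = integral\<^sup>L (distr (surf (Suc k)) borel (\<lambda>c. ip (Suc k) c ?w)) F"
    by (rule integral_distr[symmetric]) measurable
  also have "\<dots> = (\<integral>t. F (?r * t) \<partial>slice_measure k)"
    unfolding distr_surf_linear[OF k] r by (rule integral_distr) measurable
  finally show "Rk n k f \<xi> = (\<integral>t. F (?r * t) \<partial>slice_measure k)" .
qed

text \<open>\<open>F\<close> is \<open>f\<close> read along one meridian, which takes a second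
  coordinate, hence \<open>n \<ge> 1\<close>. Clamping the argument to \<open>[-1, 1]\<close>
  extends it to the whole line, and measurability follows by composing \<open>f\<close> with a
  measurable curve in the sphere.\<close>

lemma radial_profile:
  assumes n: "n \<ge> 1" and f: "f \<in> borel_measurable (surf (Suc n))" and ev: "even_radial n f"
  obtains F where "F \<in> borel_measurable borel" "\<And>t. F (- t) = F t" "\<And>x. x \<in> sph (Suc n) \<Longrightarrow> f x = F (x n)"
proof -
  define cl :: "real \<Rightarrow> real" where "cl t = max (-1) (min 1 t)" for t
  define pt where "pt t = (\<lambda>i\<in>{..<Suc n}. if i = n then t else if i = 0 then sqrt (1 - t\<^sup>2) else 0)" for t :: real
  have pt: "pt t \<in> sph (Suc n)" "pt t n = t" if "-1 \<le> t" "t \<le> 1" for t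
  proof -
    have t: "t\<^sup>2 \<le> 1" using that by (simp add: abs_square_le_1 abs_le_iff)
    have "{..<Suc n} = insert n (insert 0 {1..<n})" using n by auto
    then have "ip (Suc n) (pt t) (pt t) = pt t n * pt t n + (pt t 0 * pt t 0 + (\<Sum>i\<in>{1..<n}. pt t i * pt t i))"
      using n unfolding ip_def by simp
    moreover have "(\<Sum>i\<in>{1..<n}. pt t i * pt t i) = 0" by (intro sum.neutral) (auto simp: pt_def)
    moreover have "pt t n = t" "pt t 0 = sqrt (1 - t\<^sup>2)" using n by (auto simp: pt_def)
    ultimately show "pt t \<in> sph (Suc n)" "pt t n = t"
      using t by (auto simp: sph_def space_Rn pt_def power2_eq_square)
  qed
  have clb: "-1 \<le> cl t" "cl t \<le> 1" for t by (auto simp: cl_def)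
  have "(\<lambda>t. pt (cl t)) \<in> measurable borel (restrict_space (Rn (Suc n)) (sph (Suc n)))"
  proof (rule measurable_restrict_space2)
    show "(\<lambda>t. pt (cl t)) \<in> space borel \<rightarrow> sph (Suc n)" using pt clb by auto
    show "(\<lambda>t. pt (cl t)) \<in> measurable borel (Rn (Suc n))"
    proof (rule measurable_into_Rn)
      have [measurable]: "cl \<in> borel_measurable borel" unfolding cl_def by measurable
      show "(\<lambda>t. pt (cl t) i) \<in> borel_measurable borel" if "i < Suc n" for i
        using that unfolding pt_def by (cases "i = n"; cases "i = 0") auto
    qed (auto simp: pt_def)
  qed
  then have "(\<lambda>t. pt (cl t)) \<in> measurable borel (surf (Suc n))"
    by (simp add: measurable_cong_sets[OF refl sets_surf])
  from measurable_compose[OF this f] have 1: "(\<lambda>t. f (pt (cl t))) \<in> borel_measurable borel" .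
  have 2: "f (pt (cl (- t))) = f (pt (cl t))" for t
  proof -
    have "cl (- t) = - cl t" by (auto simp: cl_def max_def min_def)
    then show ?thesis using ev pt clb[of t] clb[of "- t"] unfolding even_radial_def by (metis abs_minus_cancel)
  qed
  have 3: "f x = f (pt (cl (x n)))" if x: "x \<in> sph (Suc n)" for x
  proof -
    have b: "-1 \<le> x n" "x n \<le> 1" using sph_last_bound[OF x] by auto
    then have "cl (x n) = x n" by (simp add: cl_def)
    then show ?thesis using ev pt[OF b] x unfolding even_radial_def by metis
  qed
  show thesis by (rule that[OF 1 2 3])
qed

section \<open>Passing between sections and profiles\<close>

lemma sigma_finite_slice_measure: "sigma_finite_measure (slice_measure k)"
  unfolding slice_measure_def
  by (subst sigma_finite_measure.sigma_finite_iff_density_finite'[OF lborel.sigma_finite_measure_axioms]) (auto simp: indicator_def)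

text \<open>One bound on the integral of the absolute value serves twice: being finite it gives
  integrability, and it dominates the signed integral. Heights equal to 1 require no estimate, as
  sections through the pole form a null set.\<close>

lemma ineq_star_if_profile:
  assumes k: "k \<ge> 1" and kn: "Suc k \<le> n" and C: "C \<ge> 0"
    and H: "\<And>F \<rho>. F \<in> borel_measurable borel \<Longrightarrow> (\<And>t. F (- t) = F t) \<Longrightarrow> profile_pow n a1 a2 p F < \<infinity> \<Longrightarrow> 0 < \<rho> \<Longrightarrow> \<rho> < 1 \<Longrightarrow>
      ennreal (sqrt (1 - \<rho>\<^sup>2) powr g1 * \<rho> powr g2) * (\<integral>\<^sup>+t. ennreal \<bar>F (\<rho> * t)\<bar> \<partial>slice_measure k)
        \<le> ennreal (C * enn2real (profile_pow n a1 a2 p F) powr (1 / p))"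
  shows "ineq_star n k a1 a2 g1 g2 p"
  unfolding ineq_star_def
proof (rule exI[of _ C], intro allI impI)
  fix f assume f: "f \<in> borel_measurable (surf (Suc n))" "even_radial n f" "wLp_pow n a1 a2 p f < \<infinity>"
  have n1: "n \<ge> 1" using kn by simp
  obtain F where F [measurable]: "F \<in> borel_measurable borel" and Fe: "\<And>t. F (- t) = F t" and fF: "\<And>x. x \<in> sph (Suc n) \<Longrightarrow> f x = F (x n)"
    using radial_profile[OF n1 f(1,2)] by blast
  have W: "wLp_pow n a1 a2 p f = profile_pow n a1 a2 p F" using wLp_pow_radial[where f=f and F=F, OF n1 F] fF by blast
  let ?D = "C * enn2real (profile_pow n a1 a2 p F) powr (1 / p)"
  have D: "?D \<ge> 0" using C by simp
  have H': "integrable (slice_measure k) (\<lambda>t. F (\<rho> * t)) \<and>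
      \<bar>sqrt (1 - \<rho>\<^sup>2) powr g1 * \<rho> powr g2 * (\<integral>t. F (\<rho> * t) \<partial>slice_measure k)\<bar> \<le> ?D" if \<rho>: "0 < \<rho>" "\<rho> < 1" for \<rho>
  proof -
    let ?c = "sqrt (1 - \<rho>\<^sup>2) powr g1 * \<rho> powr g2"
    let ?J = "\<integral>\<^sup>+t. ennreal \<bar>F (\<rho> * t)\<bar> \<partial>slice_measure k"
    have "\<rho>\<^sup>2 < 1" using \<rho> by (simp add: abs_square_less_1)
    then have c: "?c > 0" using \<rho> by simp
    have le: "ennreal ?c * ?J \<le> ennreal ?D" using H[OF F Fe _ \<rho>] f(3) unfolding W by blast
    then have "ennreal ?c * ?J < \<infinity>" using ennreal_less_top le_less_trans by (metis infinity_ennreal_def)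
    then have J: "?J < \<infinity>" using c by (auto simp: ennreal_mult_less_top less_top)
    have int: "integrable (slice_measure k) (\<lambda>t. F (\<rho> * t))"
      using J by (intro integrableI_bounded) auto
    have "ennreal \<bar>\<integral>t. F (\<rho> * t) \<partial>slice_measure k\<bar> \<le> ?J"
      using integral_norm_bound_ennreal[OF int] by simp
    then have "ennreal ?c * ennreal \<bar>\<integral>t. F (\<rho> * t) \<partial>slice_measure k\<bar> \<le> ennreal ?D"
      using le by (meson mult_left_mono order_trans zero_le)
    then have "ennreal (?c * \<bar>\<integral>t. F (\<rho> * t) \<partial>slice_measure k\<bar>) \<le> ennreal ?D"
      using c by (simp add: ennreal_mult)
    then have "?c * \<bar>\<integral>t. F (\<rho> * t) \<partial>slice_measure k\<bar> \<le> ?D" using D by (simp only: ennreal_le_iff)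
    then show ?thesis using int c by (simp add: abs_mult)
  qed
  have ae: "AE \<xi> in Xi_measure n k. \<xi> \<in> Xi n k \<and> 0 < cos (d0set n \<xi>) \<and> cos (d0set n \<xi>) < 1"
    using AE_Xi_height[OF kn] AE_space by eventually_elim (auto simp: space_Xi_measure Xi_height)
  have 1: "AE \<xi> in Xi_measure n k. Rk_integrable n k f \<xi>"
    using ae by eventually_elim (use H' Rk_radial(1)[where f=f and F=F, OF k F fF] in blast)
  let ?h = "\<lambda>\<rho>. ereal \<bar>sqrt (1 - \<rho>\<^sup>2) powr g1 * \<rho> powr g2 * (\<integral>t. F (\<rho> * t) \<partial>slice_measure k)\<bar>"
  let ?G = "\<lambda>\<xi>. ereal \<bar>sin (d0set n \<xi>) powr g1 * cos (d0set n \<xi>) powr g2 * Rk n k f \<xi>\<bar>"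
  have Gh: "?G \<xi> = ?h (cos (d0set n \<xi>))" if "\<xi> \<in> Xi n k" for \<xi>
    using Rk_radial(2)[where f=f and F=F, OF k F fF that] Xi_height(3)[OF that] by simp
  \<comment> \<open>The bound on the essential supremum is derived for a measurable function;
    \<open>?G\<close> is one because it factors through the height.\<close>
  have "(\<lambda>\<rho>. \<integral>t. F (\<rho> * t) \<partial>slice_measure k) \<in> borel_measurable borel"
    by (rule sigma_finite_measure.borel_measurable_lebesgue_integral[OF sigma_finite_slice_measure]) measurable
  then have "?h \<in> borel_measurable borel" by measurable
  then have "(\<lambda>\<xi>. ?h (cos (d0set n \<xi>))) \<in> borel_measurable (Xi_measure n k)"
    by (rule measurable_compose[OF measurable_height])
  then have G: "?G \<in> borel_measurable (Xi_measure n k)"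
    by (subst measurable_cong[OF Gh]) (auto simp: space_Xi_measure)
  have "esssup (Xi_measure n k) ?G \<le> ereal (C * wLp_norm n a1 a2 p f)"
  proof (rule esssup_I[OF G])
    show "AE \<xi> in Xi_measure n k. ?G \<xi> \<le> ereal (C * wLp_norm n a1 a2 p f)"
      using ae by eventually_elim (use H' in \<open>auto simp: Gh wLp_norm_def W\<close>)
  qed
  with 1 show "(AE \<xi> in Xi_measure n k. Rk_integrable n k f \<xi>) \<and>
      esssup (Xi_measure n k) ?G \<le> ereal (C * wLp_norm n a1 a2 p f)" by blast
qed

text \<open>What an almost-everywhere bound leaves for testing: in each interval of heights the
  inequality holds at some \<rho>, which may depend on \<open>F\<close>. Restricting to nonnegative
  \<open>F\<close> allows nonnegative integrals throughout.\<close>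

definition profile_ineq :: "nat \<Rightarrow> nat \<Rightarrow> real \<Rightarrow> real \<Rightarrow> real \<Rightarrow> real \<Rightarrow> real \<Rightarrow> real \<Rightarrow> bool" where
  "profile_ineq n k a1 a2 g1 g2 p C \<longleftrightarrow> C \<ge> 0 \<and> (\<forall>F a b. F \<in> borel_measurable borel \<longrightarrow> (\<forall>t. F t \<ge> 0) \<longrightarrow> (\<forall>t. F (- t) = F t) \<longrightarrow>
      profile_pow n a1 a2 p F < \<infinity> \<longrightarrow> 0 < a \<longrightarrow> a < b \<longrightarrow> b < 1 \<longrightarrow>
      (\<exists>\<rho>. a < \<rho> \<and> \<rho> < b \<and> ennreal (sqrt (1 - \<rho>\<^sup>2) powr g1 * \<rho> powr g2) * (\<integral>\<^sup>+t. ennreal (F (\<rho> * t)) \<partial>slice_measure k)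
        \<le> ennreal (C * enn2real (profile_pow n a1 a2 p F) powr (1 / p))))"

lemma profile_if_ineq_star:
  assumes k: "k \<ge> 1" and kn: "Suc k \<le> n" and star: "ineq_star n k a1 a2 g1 g2 p"
  shows "\<exists>C. profile_ineq n k a1 a2 g1 g2 p C"
proof -
  have n1: "n \<ge> 1" using kn by simp
  obtain C where C: "\<And>f. f \<in> borel_measurable (surf (Suc n)) \<Longrightarrow> even_radial n f \<Longrightarrow>
        wLp_pow n a1 a2 p f < \<infinity> \<Longrightarrow>
        (AE \<xi> in Xi_measure n k. Rk_integrable n k f \<xi>) \<and>
        esssup (Xi_measure n k)
          (\<lambda>\<xi>. ereal \<bar>sin (d0set n \<xi>) powr g1 * cos (d0set n \<xi>) powr g2 * Rk n k f \<xi>\<bar>)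
          \<le> ereal (C * wLp_norm n a1 a2 p f)"
    using star unfolding ineq_star_def by blast
  show ?thesis
    unfolding profile_ineq_def
  \<comment> \<open>The constant of \<open>ineq_star\<close> may be negative. Enlarging it to
    \<open>max C 0\<close> is harmless, and nonnegativity is used when upper bounds for the norm are
    inserted.\<close>
  proof (rule exI[of _ "max C 0"], intro conjI allI impI)
    show "max C 0 \<ge> 0" by simp
    fix F :: "real \<Rightarrow> real" and a b :: real
    assume F [measurable]: "F \<in> borel_measurable borel" and "\<forall>t. F t \<ge> 0" "\<forall>t. F (- t) = F t"
      and fin: "profile_pow n a1 a2 p F < \<infinity>" and ab: "0 < a" "a < b" "b < 1"
    then have F0: "\<And>t. F t \<ge> 0" and Fe: "\<And>t. F (- t) = F t" by auto
    define f where "f x = F (x n)" for x :: "nat \<Rightarrow> real"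
    have W: "wLp_pow n a1 a2 p f = profile_pow n a1 a2 p F" by (rule wLp_pow_radial[OF n1 F]) (simp add: f_def)
    let ?N = "enn2real (profile_pow n a1 a2 p F) powr (1 / p)"
    have fm: "f \<in> borel_measurable (surf (Suc n))"
    proof -
      have "f = (\<lambda>x. F (ip (Suc n) x (orig n)))" by (auto simp: f_def ip_commute[of _ _ "orig n"] ip_orig_left)
      then show ?thesis by simp
    qed
    have fe: "even_radial n f"
    proof -
      have "F s = F t" if "\<bar>s\<bar> = \<bar>t\<bar>" for s t using that Fe by (auto simp: abs_eq_iff)
      then show ?thesis unfolding even_radial_def f_def by blast
    qed
    let ?G = "\<lambda>\<xi>. ereal \<bar>sin (d0set n \<xi>) powr g1 * cos (d0set n \<xi>) powr g2 * Rk n k f \<xi>\<bar>"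
    have st: "AE \<xi> in Xi_measure n k. Rk_integrable n k f \<xi>" "esssup (Xi_measure n k) ?G \<le> ereal (C * ?N)"
      using C[OF fm fe] fin by (auto simp: W wLp_norm_def)
    have "AE \<xi> in Xi_measure n k. Rk_integrable n k f \<xi> \<and> ?G \<xi> \<le> ereal (C * ?N)"
      using st(1) esssup_AE[of ?G "Xi_measure n k"] by eventually_elim (use st(2) order_trans in blast)
    from ex_Xi_height[OF kn ab this] obtain \<xi> where \<xi>: "\<xi> \<in> Xi n k" "a < cos (d0set n \<xi>)" "cos (d0set n \<xi>) < b"
      "Rk_integrable n k f \<xi>" "?G \<xi> \<le> ereal (C * ?N)" by blast
    define \<rho> where "\<rho> = cos (d0set n \<xi>)"
    have fF: "\<And>x. x \<in> sph (Suc n) \<Longrightarrow> f x = F (x n)" by (simp add: f_def)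
    have int: "integrable (slice_measure k) (\<lambda>t. F (\<rho> * t))"
      using Rk_radial(1)[where f=f and F=F, OF k F fF \<xi>(1)] \<xi>(4) by (simp add: \<rho>_def)
    have J: "(\<integral>\<^sup>+t. ennreal (F (\<rho> * t)) \<partial>slice_measure k) = ennreal (\<integral>t. F (\<rho> * t) \<partial>slice_measure k)"
      by (rule nn_integral_eq_integral[OF int]) (simp add: F0)
    have J0: "(\<integral>t. F (\<rho> * t) \<partial>slice_measure k) \<ge> 0" by (rule Bochner_Integration.integral_nonneg) (simp add: F0)
    let ?c = "sqrt (1 - \<rho>\<^sup>2) powr g1 * \<rho> powr g2"
    have "?c * (\<integral>t. F (\<rho> * t) \<partial>slice_measure k) \<le> C * ?N"
      using \<xi>(5) Rk_radial(2)[where f=f and F=F, OF k F fF \<xi>(1)] Xi_height(3)[OF \<xi>(1)] J0 by (simp add: \<rho>_def abs_mult)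
    also have "\<dots> \<le> max C 0 * ?N" by (intro mult_right_mono) auto
    finally have "ennreal (?c * (\<integral>t. F (\<rho> * t) \<partial>slice_measure k)) \<le> ennreal (max C 0 * ?N)" by (rule ennreal_leI)
    then have "ennreal ?c * (\<integral>\<^sup>+t. ennreal (F (\<rho> * t)) \<partial>slice_measure k) \<le> ennreal (max C 0 * ?N)"
      unfolding J using J0 by (simp add: ennreal_mult)
    then show "\<exists>\<rho>. a < \<rho> \<and> \<rho> < b \<and> ennreal (sqrt (1 - \<rho>\<^sup>2) powr g1 * \<rho> powr g2) * (\<integral>\<^sup>+t. ennreal (F (\<rho> * t)) \<partial>slice_measure k)
        \<le> ennreal (max C 0 * ?N)"
      using \<xi>(2,3) unfolding \<rho>_def by blast
  qed
qed

section \<open>Sufficiency\<close>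

definition int01 :: "(real \<Rightarrow> ennreal) \<Rightarrow> ennreal" where
  "int01 \<phi> = (\<integral>\<^sup>+t. \<phi> t * indicator {0<..<1} t \<partial>lborel)"

lemma nn_integral_slice_even:
  fixes \<phi> :: "real \<Rightarrow> ennreal"
  assumes [measurable]: "\<phi> \<in> borel_measurable borel" and ev: "\<And>t. \<phi> (- t) = \<phi> t" and m: "m \<ge> 1"
  shows "(\<integral>\<^sup>+t. \<phi> t \<partial>slice_measure m) = ennreal (2 * slice_const m) * int01 (\<lambda>t. \<phi> t * ennreal ((1 - t\<^sup>2) powr (real m / 2 - 1)))"
proof -
  define g where "g t = ennreal (slice_const m) * (\<phi> t * ennreal ((1 - t\<^sup>2) powr (real m / 2 - 1)))" for t
  have [measurable]: "g \<in> borel_measurable borel" unfolding g_def by measurable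
  have k: "slice_const m > 0" using slice_const_pos[OF m] .
  have "(\<integral>\<^sup>+t. \<phi> t \<partial>slice_measure m) = (\<integral>\<^sup>+t. g t * indicator {-1<..<1} t \<partial>lborel)"
    unfolding slice_measure_def g_def using k
    by (subst nn_integral_density) (auto simp: ennreal_mult ac_simps intro!: nn_integral_cong)
  also have "\<dots> = (\<integral>\<^sup>+t. g t * indicator {-1<..<0} t + g t * indicator {0<..<1} t \<partial>lborel)"
    by (rule nn_integral_cong_AE, rule AE_I'[of "{0}"]) (auto simp: indicator_def split: if_splits)
  also have "\<dots> = (\<integral>\<^sup>+t. g t * indicator {-1<..<0} t \<partial>lborel) + (\<integral>\<^sup>+t. g t * indicator {0<..<1} t \<partial>lborel)"
    by (rule nn_integral_add) auto
  also have "(\<integral>\<^sup>+t. g t * indicator {-1<..<0} t \<partial>lborel) = (\<integral>\<^sup>+t. g t * indicator {0<..<1} t \<partial>lborel)"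
    by (subst nn_integral_real_affine[where c="-1" and t=0])
       (auto simp: g_def ev indicator_def intro!: nn_integral_cong)
  also have "(\<integral>\<^sup>+t. g t * indicator {0<..<1} t \<partial>lborel)
      = ennreal (slice_const m) * int01 (\<lambda>t. \<phi> t * ennreal ((1 - t\<^sup>2) powr (real m / 2 - 1)))"
    unfolding int01_def g_def by (subst nn_integral_cmult[symmetric]) (auto simp: mult.assoc)
  also have "x + x = 2 * x" for x :: ennreal by (simp add: mult_2)
  finally show ?thesis using k by (simp add: ennreal_mult mult.assoc)
qed

lemma int01_mono: "(\<And>t. 0 < t \<Longrightarrow> t < 1 \<Longrightarrow> f t \<le> g t) \<Longrightarrow> int01 f \<le> int01 g"
  unfolding int01_def by (intro nn_integral_mono) (auto simp: indicator_def)

lemma int01_cong: "(\<And>t. 0 < t \<Longrightarrow> t < 1 \<Longrightarrow> f t = g t) \<Longrightarrow> int01 f = int01 g"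
  unfolding int01_def by (intro nn_integral_cong) (auto simp: indicator_def)

lemma int01_cmult:
  assumes [measurable]: "f \<in> borel_measurable borel" shows "int01 (\<lambda>t. c * f t) = c * int01 f"
  unfolding int01_def by (subst nn_integral_cmult[symmetric]) (auto simp: mult.assoc)

text \<open>Only the part of \<open>f\<close> below \<rho> is seen. Raised to the power
  \<open>1 / p\<close>, the factor \<open>1 / \<rho>\<close> accounts for the 1 in the condition
  \<open>g2 \<ge> (1 + a2) / p\<close>.\<close>

lemma int01_scale:
  assumes [measurable]: "f \<in> borel_measurable borel" and \<rho>: "0 < \<rho>" "\<rho> < 1"
  shows "int01 (\<lambda>t. f (\<rho> * t)) \<le> ennreal (1 / \<rho>) * int01 f"
proof -
  have "ennreal \<rho> * int01 (\<lambda>t. f (\<rho> * t)) = ennreal \<bar>\<rho>\<bar> * (\<integral>\<^sup>+t. f (0 + \<rho> * t) * indicator {0<..<\<rho>} (0 + \<rho> * t) \<partial>lborel)"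
    unfolding int01_def using \<rho> by (auto simp: indicator_def zero_less_mult_iff intro!: arg_cong[where f="\<lambda>z. _ * z"] nn_integral_cong)
  also have "\<dots> = (\<integral>\<^sup>+t. f t * indicator {0<..<\<rho>} t \<partial>lborel)"
    by (rule nn_integral_real_affine[symmetric]) (use \<rho> in auto)
  also have "\<dots> \<le> int01 f" unfolding int01_def using \<rho> by (intro nn_integral_mono) (auto simp: indicator_def)
  finally have "ennreal (1 / \<rho>) * (ennreal \<rho> * int01 (\<lambda>t. f (\<rho> * t))) \<le> ennreal (1 / \<rho>) * int01 f"
    by (rule mult_left_mono) simp
  also have "ennreal (1 / \<rho>) * (ennreal \<rho> * int01 (\<lambda>t. f (\<rho> * t))) = int01 (\<lambda>t. f (\<rho> * t))"
    using \<rho> by (simp add: mult.assoc[symmetric] ennreal_mult[symmetric])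
  finally show ?thesis .
qed

text \<open>Young's inequality for \<open>u / A\<close> and \<open>v / B\<close>, integrated. Upper
  bounds \<open>U\<close> and \<open>V\<close> in place of norms keep all constants real;
  \<open>V\<close> can be taken positive, whereas \<open>U = 0\<close> is a genuine case and is
  treated apart.\<close>

lemma nn_integral_Holder:
  fixes u v :: "'a \<Rightarrow> real"
  assumes [measurable]: "u \<in> borel_measurable M" "v \<in> borel_measurable M"
    and nn: "\<And>x. u x \<ge> 0" "\<And>x. v x \<ge> 0" and pq: "p > 1" "q > 1" "1 / p + 1 / q = 1"
    and U: "(\<integral>\<^sup>+x. ennreal (u x powr p) \<partial>M) \<le> ennreal U" "U \<ge> 0"
    and V: "(\<integral>\<^sup>+x. ennreal (v x powr q) \<partial>M) \<le> ennreal V" "V > 0"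
  shows "(\<integral>\<^sup>+x. ennreal (u x * v x) \<partial>M) \<le> ennreal (U powr (1 / p) * V powr (1 / q))"
proof (cases "U = 0")
  case True
  then have "(\<integral>\<^sup>+x. ennreal (u x powr p) \<partial>M) = 0" using U by simp
  then have "AE x in M. ennreal (u x powr p) = 0" by (subst (asm) nn_integral_0_iff_AE) auto
  then have "AE x in M. ennreal (u x * v x) = 0" by eventually_elim simp
  then have "(\<integral>\<^sup>+x. ennreal (u x * v x) \<partial>M) = 0" by (subst nn_integral_0_iff_AE) auto
  then show ?thesis by simp
next
  case False
  then have U0: "U > 0" using U by simp
  define A B where "A = U powr (1 / p)" and "B = V powr (1 / q)"
  have AB: "A > 0" "B > 0" "A powr p = U" "B powr q = V"
    using U0 V pq by (auto simp: A_def B_def powr_powr)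
  have "(\<integral>\<^sup>+x. ennreal (u x * v x) \<partial>M)
     \<le> (\<integral>\<^sup>+x. ennreal (A * B / (p * U)) * ennreal (u x powr p) + ennreal (A * B / (q * V)) * ennreal (v x powr q) \<partial>M)"
  proof (rule nn_integral_mono)
    fix x
    have "(u x / A) * (v x / B) \<le> (u x / A) powr p / p + (v x / B) powr q / q"
      using nn AB pq by (intro Youngs_inequality) auto
    also have "\<dots> = u x powr p / (p * U) + v x powr q / (q * V)"
      using nn AB by (simp add: powr_divide mult.commute)
    finally have "A * B * ((u x / A) * (v x / B)) \<le> A * B * (u x powr p / (p * U) + v x powr q / (q * V))"
      using AB by (intro mult_left_mono) auto
    then have "u x * v x \<le> A * B / (p * U) * u x powr p + A * B / (q * V) * v x powr q"
      using AB by (simp add: distrib_left)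
    then have "ennreal (u x * v x) \<le> ennreal (A * B / (p * U) * u x powr p + A * B / (q * V) * v x powr q)"
      by (rule ennreal_leI)
    also have "\<dots> = ennreal (A * B / (p * U)) * ennreal (u x powr p) + ennreal (A * B / (q * V)) * ennreal (v x powr q)"
      using AB U0 V pq by (subst ennreal_plus) (auto simp: ennreal_mult[symmetric])
    finally show "ennreal (u x * v x) \<le> ennreal (A * B / (p * U)) * ennreal (u x powr p) + ennreal (A * B / (q * V)) * ennreal (v x powr q)" .
  qed
  also have "\<dots> = ennreal (A * B / (p * U)) * (\<integral>\<^sup>+x. ennreal (u x powr p) \<partial>M) + ennreal (A * B / (q * V)) * (\<integral>\<^sup>+x. ennreal (v x powr q) \<partial>M)"
    by (subst nn_integral_add) (auto simp: nn_integral_cmult)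
  also have "\<dots> \<le> ennreal (A * B / (p * U)) * ennreal U + ennreal (A * B / (q * V)) * ennreal V"
    using U V by (intro add_mono mult_left_mono) auto
  also have "\<dots> = ennreal (A * B / p + A * B / q)"
    using AB U0 V pq by (subst ennreal_plus) (auto simp: ennreal_mult[symmetric])
  also have "A * B / p + A * B / q = A * B"
  proof -
    have "A * B / p + A * B / q = A * B * (1 / p + 1 / q)" by (simp add: distrib_left)
    then show ?thesis using pq by simp
  qed
  finally show ?thesis by (simp add: A_def B_def)
qed

text \<open>All exponents are arbitrary reals, so a power may increase or decrease. Taking the
  minimum and maximum over both ends of the range of \<open>x / y\<close> avoids distinguishing the
  sign of \<open>e\<close> at every use.\<close>

lemma powr_between:
  fixes x y :: real
  assumes "0 < l" "0 < y" "l * y \<le> x" "x \<le> u * y"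
  shows "min (l powr e) (u powr e) * y powr e \<le> x powr e" "x powr e \<le> max (l powr e) (u powr e) * y powr e"
proof -
  define z where "z = x / y"
  have z: "l \<le> z" "z \<le> u" using assms by (auto simp: z_def field_simps)
  have x: "x powr e = z powr e * y powr e"
    using assms z by (subst powr_mult[symmetric]) (auto simp: z_def)
  have "min (l powr e) (u powr e) \<le> z powr e \<and> z powr e \<le> max (l powr e) (u powr e)"
  proof (cases "e \<ge> 0")
    case True
    then have "l powr e \<le> z powr e" "z powr e \<le> u powr e" using z assms by (auto intro!: powr_mono2)
    then show ?thesis by auto
  next
    case False
    then have "u powr e \<le> z powr e" "z powr e \<le> l powr e" using z assms by (auto intro!: powr_mono2')
    then show ?thesis by auto
  qed
  then show "min (l powr e) (u powr e) * y powr e \<le> x powr e" "x powr e \<le> max (l powr e) (u powr e) * y powr e"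
    unfolding x by (auto intro!: mult_right_mono)
qed

section \<open>Beta integrals and the dual kernel\<close>

lemma one_minus_sq_bounds:
  fixes t :: real
  assumes "0 \<le> t" "t < 1" shows "1 - t \<le> 1 - t\<^sup>2" "1 - t\<^sup>2 \<le> 2 * (1 - t)"
proof -
  have "1 - t\<^sup>2 = (1 + t) * (1 - t)" by (simp add: power2_eq_square algebra_simps)
  moreover have "1 * (1 - t) \<le> (1 + t) * (1 - t)" "(1 + t) * (1 - t) \<le> 2 * (1 - t)"
    using assms by (intro mult_right_mono; simp)+
  ultimately show "1 - t \<le> 1 - t\<^sup>2" "1 - t\<^sup>2 \<le> 2 * (1 - t)" by simp_all
qed

lemma one_minus_sq_powr_le:
  fixes t :: real
  assumes "0 < t" "t < 1" shows "(1 - t\<^sup>2) powr a \<le> max 1 (2 powr a) * (1 - t) powr a"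
  using powr_between(2)[of 1 "1 - t" "1 - t\<^sup>2" 2 a] one_minus_sq_bounds[of t] assms by simp

lemma int01_beta:
  assumes a: "a > -1" and b: "b > -1"
  obtains K where "K > 0" "int01 (\<lambda>t. ennreal ((1 - t\<^sup>2) powr a * t powr b)) \<le> ennreal K"
proof -
  define c where "c = max 1 (2 powr a)"
  have c: "c > 0" by (simp add: c_def)
  let ?B = "Beta (b + 1) (a + 1)"
  have hi: "((\<lambda>t. t powr b * (1 - t) powr a) has_integral ?B) {0..1}"
    using has_integral_Beta_real[of "b + 1" "a + 1"] a b by simp
  have B0: "?B \<ge> 0" by (rule has_integral_nonneg[OF hi]) auto
  have "int01 (\<lambda>t. ennreal ((1 - t\<^sup>2) powr a * t powr b)) \<le> int01 (\<lambda>t. ennreal c * ennreal (t powr b * (1 - t) powr a))"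
  proof (rule int01_mono)
    fix t :: real assume t: "0 < t" "t < 1"
    have "(1 - t\<^sup>2) powr a * t powr b \<le> c * (1 - t) powr a * t powr b"
      unfolding c_def using one_minus_sq_powr_le[OF t] by (intro mult_right_mono) auto
    then show "ennreal ((1 - t\<^sup>2) powr a * t powr b) \<le> ennreal c * ennreal (t powr b * (1 - t) powr a)"
      using c by (simp add: ennreal_mult[symmetric] ac_simps)
  qed
  also have "\<dots> = ennreal c * int01 (\<lambda>t. ennreal (t powr b * (1 - t) powr a))" by (rule int01_cmult) measurable
  also have "int01 (\<lambda>t. ennreal (t powr b * (1 - t) powr a)) \<le> (\<integral>\<^sup>+t. ennreal (t powr b * (1 - t) powr a) * indicator {0..1} t \<partial>lborel)"
    unfolding int01_def by (intro nn_integral_mono) (auto simp: indicator_def)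
  also have "\<dots> = ennreal ?B"
    by (rule nn_integral_has_integral_lebesgue'[OF _ hi]) auto
  finally have "int01 (\<lambda>t. ennreal ((1 - t\<^sup>2) powr a * t powr b)) \<le> ennreal c * ennreal ?B" by (simp add: mult_left_mono)
  \<comment> \<open>The \<open>+ 1\<close> makes the constant positive, since only
    \<open>?B \<ge> 0\<close> has been established.\<close>
  also have "\<dots> \<le> ennreal (c * ?B + 1)" using c B0 by (simp add: ennreal_mult[symmetric])
  finally show thesis using c B0 by (intro that[of "c * ?B + 1"]) (auto intro: add_nonneg_pos)
qed

text \<open>The factor \<open>1 - \<rho>\<^sup>2 * t\<^sup>2\<close> is at least
  \<open>1 - \<rho>\<^sup>2\<close> and at least \<open>1 - t\<^sup>2\<close>. Of its exponent
  \<beta> the part \<theta> is charged to the first and the rest \<open>e\<close> to the second; the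
  strict inequality on \<theta> leaves \<open>a - e > -1\<close>, so a Beta integral bounds what
  remains. If \<open>\<beta> \<le> \<theta>\<close>, then \<open>e = 0\<close> suffices because the
  factor is at most 1.\<close>

lemma kernel_bound_subcritical:
  assumes a: "a > -1" and b: "b > -1" and th: "\<theta> \<ge> 0" "\<theta> > \<beta> - a - 1"
  obtains K where "K > 0" "\<And>\<rho>. 0 < \<rho> \<Longrightarrow> \<rho> < 1 \<Longrightarrow>
    int01 (\<lambda>t. ennreal ((1 - t\<^sup>2) powr a * t powr b * (1 - \<rho>\<^sup>2 * t\<^sup>2) powr (- \<beta>))) \<le> ennreal (K * (1 - \<rho>\<^sup>2) powr (- \<theta>))"
proof -
  define e where "e = (if \<beta> \<le> \<theta> then 0 else \<beta> - \<theta>)"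
  have e: "e \<ge> 0" "a - e > -1" using th a by (auto simp: e_def)
  obtain K where K: "K > 0" "int01 (\<lambda>t. ennreal ((1 - t\<^sup>2) powr (a - e) * t powr b)) \<le> ennreal K"
    using int01_beta[OF e(2) b] by blast
  have "int01 (\<lambda>t. ennreal ((1 - t\<^sup>2) powr a * t powr b * (1 - \<rho>\<^sup>2 * t\<^sup>2) powr (- \<beta>))) \<le> ennreal (K * (1 - \<rho>\<^sup>2) powr (- \<theta>))"
    if \<rho>: "0 < \<rho>" "\<rho> < 1" for \<rho>
  proof -
    have r2: "\<rho>\<^sup>2 < 1" "0 < \<rho>\<^sup>2" using \<rho> by (auto simp: abs_square_less_1)
    have "int01 (\<lambda>t. ennreal ((1 - t\<^sup>2) powr a * t powr b * (1 - \<rho>\<^sup>2 * t\<^sup>2) powr (- \<beta>)))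
      \<le> int01 (\<lambda>t. ennreal ((1 - \<rho>\<^sup>2) powr (- \<theta>)) * ennreal ((1 - t\<^sup>2) powr (a - e) * t powr b))"
    proof (rule int01_mono)
      fix t :: real assume t: "0 < t" "t < 1"
      have t2: "t\<^sup>2 < 1" "0 < t\<^sup>2" using t by (auto simp: abs_square_less_1)
      let ?y = "1 - \<rho>\<^sup>2 * t\<^sup>2"
      have rt: "\<rho>\<^sup>2 * t\<^sup>2 \<le> \<rho>\<^sup>2" "\<rho>\<^sup>2 * t\<^sup>2 \<le> t\<^sup>2" using r2 t2 by (auto intro: mult_left_le mult_left_le_one_le)
      have y: "1 - \<rho>\<^sup>2 \<le> ?y" "1 - t\<^sup>2 \<le> ?y" "?y \<le> 1" "?y > 0"
        using rt r2 t2 by (simp_all add: order.strict_trans1[OF rt(1) r2(1)])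
      have "?y powr (- \<beta>) \<le> ?y powr (- \<theta>) * ?y powr (- e)"
      proof -
        have "?y powr (- \<beta>) \<le> ?y powr (- \<theta> - e)"
          using y by (intro powr_mono') (auto simp: e_def)
        then show ?thesis by (simp add: powr_add[symmetric])
      qed
      also have "\<dots> \<le> (1 - \<rho>\<^sup>2) powr (- \<theta>) * (1 - t\<^sup>2) powr (- e)"
        using y r2 t2 th e by (intro mult_mono powr_mono2') auto
      finally have "?y powr (- \<beta>) \<le> (1 - \<rho>\<^sup>2) powr (- \<theta>) * (1 - t\<^sup>2) powr (- e)" .
      then have "(1 - t\<^sup>2) powr a * t powr b * ?y powr (- \<beta>) \<le> (1 - t\<^sup>2) powr a * t powr b * ((1 - \<rho>\<^sup>2) powr (- \<theta>) * (1 - t\<^sup>2) powr (- e))"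
        by (intro mult_left_mono) auto
      also have "\<dots> = (1 - \<rho>\<^sup>2) powr (- \<theta>) * ((1 - t\<^sup>2) powr (a - e) * t powr b)"
        by (simp add: powr_diff powr_minus_divide)
      finally show "ennreal ((1 - t\<^sup>2) powr a * t powr b * ?y powr (- \<beta>)) \<le>
         ennreal ((1 - \<rho>\<^sup>2) powr (- \<theta>)) * ennreal ((1 - t\<^sup>2) powr (a - e) * t powr b)"
        by (simp add: ennreal_mult[symmetric] ennreal_leI)
    qed
    also have "\<dots> = ennreal ((1 - \<rho>\<^sup>2) powr (- \<theta>)) * int01 (\<lambda>t. ennreal ((1 - t\<^sup>2) powr (a - e) * t powr b))"
      by (rule int01_cmult) measurable
    also have "\<dots> \<le> ennreal ((1 - \<rho>\<^sup>2) powr (- \<theta>)) * ennreal K" using K by (intro mult_left_mono) auto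
    finally show ?thesis using K by (simp add: ennreal_mult[symmetric] mult.commute)
  qed
  with K(1) show thesis by (rule that)
qed

text \<open>Charging \<open>e = \<beta> - \<theta>\<close> as in the subcritical case would leave
  the divergent exponent -1, so the range is cut instead. With \<open>d = 1 - \<rho>\<close>, the
  factor \<open>1 - \<rho>\<^sup>2 * t\<^sup>2\<close> is bounded below by \<open>d\<close> where
  \<open>1 - t \<le> d\<close> and by \<open>1 - t\<close> beyond. Each piece is of size
  \<open>d powr (- \<theta>)\<close>, the second because \<open>\<theta> > 0\<close>. For
  \<open>t \<le> 1/2\<close> the factor is bounded away from 0 and a Beta integral suffices.\<close>

lemma kernel_bound_endpoint:
  assumes a: "a > -1" and b: "b > -1" and th: "\<theta> > 0" "\<theta> = \<beta> - a - 1"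
  obtains K where "K > 0" "\<And>\<rho>. 0 < \<rho> \<Longrightarrow> \<rho> < 1 \<Longrightarrow>
    int01 (\<lambda>t. ennreal ((1 - t\<^sup>2) powr a * t powr b * (1 - \<rho>\<^sup>2 * t\<^sup>2) powr (- \<beta>))) \<le> ennreal (K * (1 - \<rho>\<^sup>2) powr (- \<theta>))"
proof -
  have \<beta>: "\<beta> > 0" using a th by simp
  obtain K where K: "K > 0" "int01 (\<lambda>t. ennreal ((1 - t\<^sup>2) powr a * t powr b)) \<le> ennreal K"
    using int01_beta[OF a b] by blast
  define ca where "ca = max 1 (2 powr a)"
  define cb where "cb = max 1 ((1/2) powr b)"
  have cab: "ca > 0" "cb > 0" by (auto simp: ca_def cb_def)
  define K1 where "K1 = 2 powr \<beta> * K"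
  define K2 where "K2 = ca * cb * (1 / (a + 1) + 1 / \<theta>)"
  have K12: "K1 > 0" "K2 > 0" using K cab a th by (auto simp: K1_def K2_def intro!: mult_pos_pos add_pos_pos)
  have "int01 (\<lambda>t. ennreal ((1 - t\<^sup>2) powr a * t powr b * (1 - \<rho>\<^sup>2 * t\<^sup>2) powr (- \<beta>))) \<le> ennreal ((K1 + K2 * 2 powr \<theta>) * (1 - \<rho>\<^sup>2) powr (- \<theta>))"
    if \<rho>: "0 < \<rho>" "\<rho> < 1" for \<rho>
  proof -
    define d where "d = 1 - \<rho>"
    have d: "0 < d" "d < 1" using \<rho> by (auto simp: d_def)
    have r2: "\<rho>\<^sup>2 < 1" "0 < \<rho>\<^sup>2" using \<rho> by (auto simp: abs_square_less_1)
    \<comment> \<open>A majorant in the variable \<open>x = 1 - t\<close>. It is continued to all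
      \<open>x \<ge> d\<close>, as the exponent \<open>a - \<beta> = - \<theta> - 1\<close> is
      integrable at infinity; both integrals are then elementary.\<close>
    define h where "h x = ennreal (d powr (- \<beta>)) * (ennreal (x powr a) * indicator {0..d} x) + ennreal (x powr (a - \<beta>)) * indicator {d..} x" for x :: real
    have [measurable]: "h \<in> borel_measurable borel" unfolding h_def by measurable
    have "int01 (\<lambda>t. ennreal ((1 - t\<^sup>2) powr a * t powr b * (1 - \<rho>\<^sup>2 * t\<^sup>2) powr (- \<beta>)))
      \<le> int01 (\<lambda>t. ennreal (2 powr \<beta>) * ennreal ((1 - t\<^sup>2) powr a * t powr b) + ennreal (ca * cb) * h (1 - t))"
    proof (rule int01_mono)
      fix t :: real assume t: "0 < t" "t < 1"
      have t2: "t\<^sup>2 < 1" "0 < t\<^sup>2" using t by (auto simp: abs_square_less_1)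
      let ?y = "1 - \<rho>\<^sup>2 * t\<^sup>2"
      have rt0: "\<rho> * t \<le> t" "\<rho> * t \<le> \<rho>" using t \<rho> by (auto intro: mult_left_le mult_left_le_one_le)
      have rt1: "\<rho> * t \<le> 1" using rt0 t by linarith
      have "(\<rho> * t)\<^sup>2 \<le> \<rho> * t"
        unfolding power2_eq_square using t \<rho> by (intro mult_left_le[OF rt1]) simp
      then have y: "1 - t \<le> ?y" "d \<le> ?y" using rt0 by (auto simp: power_mult_distrib d_def)
      show "ennreal ((1 - t\<^sup>2) powr a * t powr b * ?y powr (- \<beta>)) \<le>
         ennreal (2 powr \<beta>) * ennreal ((1 - t\<^sup>2) powr a * t powr b) + ennreal (ca * cb) * h (1 - t)"
      proof (cases "t \<le> 1/2")
        case True
        have "?y powr (- \<beta>) \<le> (1/2) powr (- \<beta>)" using y True \<beta> by (intro powr_mono2') auto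
        also have "\<dots> = 2 powr \<beta>" by (simp add: powr_minus_divide powr_divide)
        finally have "(1 - t\<^sup>2) powr a * t powr b * ?y powr (- \<beta>) \<le> (1 - t\<^sup>2) powr a * t powr b * 2 powr \<beta>"
          by (intro mult_left_mono) auto
        then have "ennreal ((1 - t\<^sup>2) powr a * t powr b * ?y powr (- \<beta>)) \<le> ennreal (2 powr \<beta>) * ennreal ((1 - t\<^sup>2) powr a * t powr b)"
          by (simp add: ennreal_mult[symmetric] ennreal_leI mult.commute)
        then show ?thesis by (rule order_trans) simp
      next
        case False
        let ?x = "1 - t"
        have tb: "t powr b \<le> cb"
          using powr_between(2)[of "1/2" 1 t 1 b] t False by (simp add: cb_def max.commute)
        have ya: "?y powr (- \<beta>) \<le> d powr (- \<beta>)" "?y powr (- \<beta>) \<le> ?x powr (- \<beta>)"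
          using y d t \<beta> by (auto intro!: powr_mono2')
        have le: "(1 - t\<^sup>2) powr a * t powr b * ?y powr (- \<beta>) \<le> (ca * ?x powr a) * cb * ?y powr (- \<beta>)"
          using one_minus_sq_powr_le[OF t] tb cab by (intro mult_mono) (auto simp: ca_def)
        have "ennreal (?x powr a * ?y powr (- \<beta>)) \<le> h ?x"
        proof (cases "?x \<le> d")
          case True
          have "ennreal (?x powr a * ?y powr (- \<beta>)) \<le> ennreal (d powr (- \<beta>) * ?x powr a)"
            using mult_left_mono[OF ya(1), of "?x powr a"] by (intro ennreal_leI) (simp add: mult.commute)
          also have "\<dots> = ennreal (d powr (- \<beta>)) * (ennreal (?x powr a) * indicator {0..d} ?x)"
            using True t by (simp add: ennreal_mult)
          also have "\<dots> \<le> h ?x" unfolding h_def by simp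
          finally show ?thesis .
        next
          case False
          have "ennreal (?x powr a * ?y powr (- \<beta>)) \<le> ennreal (?x powr a * ?x powr (- \<beta>))"
            using ya(2) by (intro ennreal_leI mult_left_mono) auto
          also have "\<dots> = ennreal (?x powr (a - \<beta>)) * indicator {d..} ?x"
            using False t by (simp add: powr_diff powr_minus_divide)
          also have "\<dots> \<le> h ?x" unfolding h_def by simp
          finally show ?thesis .
        qed
        then have "ennreal (ca * cb) * ennreal (?x powr a * ?y powr (- \<beta>)) \<le> ennreal (ca * cb) * h ?x"
          by (rule mult_left_mono) simp
        moreover have "ennreal ((1 - t\<^sup>2) powr a * t powr b * ?y powr (- \<beta>)) \<le> ennreal (ca * cb) * ennreal (?x powr a * ?y powr (- \<beta>))"
          using le cab by (subst ennreal_mult[symmetric]) (auto intro!: ennreal_leI simp: ac_simps)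
        ultimately show ?thesis by (meson add_increasing order_trans zero_le)
      qed
    qed
    also have "\<dots> = ennreal (2 powr \<beta>) * int01 (\<lambda>t. ennreal ((1 - t\<^sup>2) powr a * t powr b)) + ennreal (ca * cb) * int01 (\<lambda>t. h (1 - t))"
      unfolding int01_def distrib_right by (subst nn_integral_add) (auto simp: mult.assoc nn_integral_cmult)
    also have "\<dots> \<le> ennreal (2 powr \<beta>) * ennreal K + ennreal (ca * cb) * ennreal (d powr (- \<theta>) * (1 / (a + 1) + 1 / \<theta>))"
    proof (intro add_mono mult_left_mono K(2))
      have "int01 (\<lambda>t. h (1 - t)) \<le> (\<integral>\<^sup>+t. h (1 + (-1) * t) \<partial>lborel)"
        unfolding int01_def by (intro nn_integral_mono) (auto simp: indicator_def)
      also have "\<dots> = (\<integral>\<^sup>+x. h x \<partial>lborel)"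
        using nn_integral_real_affine[of h "-1" 1] by simp
      also have "\<dots> = ennreal (d powr (- \<beta>)) * (\<integral>\<^sup>+x. ennreal (x powr a) * indicator {0..d} x \<partial>lborel) + (\<integral>\<^sup>+x. ennreal (x powr (a - \<beta>)) * indicator {d..} x \<partial>lborel)"
        unfolding h_def by (subst nn_integral_add) (auto simp: nn_integral_cmult)
      also have "(\<integral>\<^sup>+x. ennreal (x powr a) * indicator {0..d} x \<partial>lborel) = ennreal (d powr (a + 1) / (a + 1))"
        by (rule nn_integral_has_integral_lebesgue'[OF _ has_integral_powr_from_0]) (use a d in auto)
      also have "(\<integral>\<^sup>+x. ennreal (x powr (a - \<beta>)) * indicator {d..} x \<partial>lborel) = ennreal (- (d powr (a - \<beta> + 1)) / (a - \<beta> + 1))"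
        by (rule nn_integral_has_integral_lebesgue'[OF _ has_integral_powr_to_inf]) (use th d in auto)
      also have "ennreal (d powr (- \<beta>)) * ennreal (d powr (a + 1) / (a + 1)) + ennreal (- (d powr (a - \<beta> + 1)) / (a - \<beta> + 1))
        = ennreal (d powr (- \<theta>) * (1 / (a + 1) + 1 / \<theta>))"
      proof -
        have "- \<beta> + (a + 1) = - \<theta>" using th by simp
        then have "d powr (- \<beta>) * d powr (a + 1) = d powr (- \<theta>)" by (simp only: powr_add[symmetric])
        then have e1: "d powr (- \<beta>) * (d powr (a + 1) / (a + 1)) = d powr (- \<theta>) / (a + 1)" by simp
        have e2: "a - \<beta> + 1 = - \<theta>" using th by simp
        have "ennreal (d powr (- \<beta>)) * ennreal (d powr (a + 1) / (a + 1)) = ennreal (d powr (- \<theta>) / (a + 1))"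
          using a by (subst ennreal_mult[symmetric]) (auto simp only: e1, auto)
        moreover have "ennreal (- (d powr (a - \<beta> + 1)) / (a - \<beta> + 1)) = ennreal (d powr (- \<theta>) / \<theta>)"
          unfolding e2 by simp
        ultimately show ?thesis using a th by (simp add: ennreal_plus[symmetric] distrib_left del: ennreal_plus)
      qed
      finally show "int01 (\<lambda>t. h (1 - t)) \<le> ennreal (d powr (- \<theta>) * (1 / (a + 1) + 1 / \<theta>))" .
    qed auto
    also have "\<dots> = ennreal (K1 + K2 * d powr (- \<theta>))"
      using K cab a th by (simp add: K1_def K2_def ennreal_mult[symmetric] ennreal_plus[symmetric] ac_simps del: ennreal_plus)
    also have "\<dots> \<le> ennreal ((K1 + K2 * 2 powr \<theta>) * (1 - \<rho>\<^sup>2) powr (- \<theta>))"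
    proof (rule ennreal_leI)
      have "(1 - \<rho>\<^sup>2) / 2 \<le> d" using zero_le_power2[of "1 - \<rho>"] by (simp add: d_def power2_eq_square field_simps)
      then have "d powr (- \<theta>) \<le> ((1 - \<rho>\<^sup>2) / 2) powr (- \<theta>)" using r2 th by (intro powr_mono2') auto
      also have "\<dots> = 2 powr \<theta> * (1 - \<rho>\<^sup>2) powr (- \<theta>)" using r2 by (simp add: powr_divide powr_minus_divide)
      finally have "K2 * d powr (- \<theta>) \<le> K2 * 2 powr \<theta> * (1 - \<rho>\<^sup>2) powr (- \<theta>)" using K12 by (simp add: mult.assoc mult_left_mono)
      moreover have "K1 * 1 \<le> K1 * (1 - \<rho>\<^sup>2) powr (- \<theta>)"
        using K12 r2 th powr_mono2'[of "- \<theta>" "1 - \<rho>\<^sup>2" 1] by (intro mult_left_mono) auto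
      ultimately show "K1 + K2 * d powr (- \<theta>) \<le> (K1 + K2 * 2 powr \<theta>) * (1 - \<rho>\<^sup>2) powr (- \<theta>)" by (simp add: distrib_right)
    qed
    finally show ?thesis .
  qed
  moreover have "K1 + K2 * 2 powr \<theta> > 0" using K12 by (intro add_pos_pos mult_pos_pos) auto
  ultimately show thesis by (intro that[of "K1 + K2 * 2 powr \<theta>"]) auto
qed

section \<open>Estimates of the transform of a profile\<close>

lemma sqrt_powr: "0 \<le> x \<Longrightarrow> sqrt x powr a = x powr (a / 2)"
  by (simp add: powr_half_sqrt[symmetric] powr_powr)

lemma profile_pow_even:
  assumes [measurable]: "F \<in> borel_measurable borel" and ev: "\<And>t. F (- t) = F t" and n: "n \<ge> 1"
  shows "profile_pow n a1 a2 p F = ennreal (2 * slice_const n) * int01 (\<lambda>t. ennreal (\<bar>F t\<bar> powr p * (1 - t\<^sup>2) powr ((a1 + real n - 2) / 2) * t powr a2))"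
proof -
  have "profile_pow n a1 a2 p F = ennreal (2 * slice_const n) * int01 (\<lambda>t. ennreal (\<bar>F t\<bar> powr p * sqrt (1 - t\<^sup>2) powr a1 * \<bar>t\<bar> powr a2) * ennreal ((1 - t\<^sup>2) powr (real n / 2 - 1)))"
    unfolding profile_pow_def by (rule nn_integral_slice_even[OF _ _ n]) (auto simp: ev)
  also have "int01 (\<lambda>t. ennreal (\<bar>F t\<bar> powr p * sqrt (1 - t\<^sup>2) powr a1 * \<bar>t\<bar> powr a2) * ennreal ((1 - t\<^sup>2) powr (real n / 2 - 1)))
     = int01 (\<lambda>t. ennreal (\<bar>F t\<bar> powr p * (1 - t\<^sup>2) powr ((a1 + real n - 2) / 2) * t powr a2))"
  proof (rule int01_cong)
    fix t :: real assume t: "0 < t" "t < 1"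
    have t2: "t\<^sup>2 < 1" using t by (auto simp: abs_square_less_1)
    have e: "(1 - t\<^sup>2) powr ((a1 + real n - 2) / 2) = sqrt (1 - t\<^sup>2) powr a1 * (1 - t\<^sup>2) powr (real n / 2 - 1)"
      using t2 by (simp add: sqrt_powr powr_add[symmetric] field_simps)
    show "ennreal (\<bar>F t\<bar> powr p * sqrt (1 - t\<^sup>2) powr a1 * \<bar>t\<bar> powr a2) * ennreal ((1 - t\<^sup>2) powr (real n / 2 - 1))
      = ennreal (\<bar>F t\<bar> powr p * (1 - t\<^sup>2) powr ((a1 + real n - 2) / 2) * t powr a2)"
      unfolding e using t by (subst ennreal_mult[symmetric]) (auto simp: ac_simps)
  qed
  finally show ?thesis .
qed

lemma nn_integral_slice_profile:
  assumes [measurable]: "F \<in> borel_measurable borel" and ev: "\<And>t. F (- t) = F t" and k: "k \<ge> 1"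
  shows "(\<integral>\<^sup>+t. ennreal \<bar>F (\<rho> * t)\<bar> \<partial>slice_measure k) = ennreal (2 * slice_const k) * int01 (\<lambda>t. ennreal (\<bar>F (\<rho> * t)\<bar> * (1 - t\<^sup>2) powr (real k / 2 - 1)))"
  by (subst nn_integral_slice_even[OF _ _ k]) (auto simp: ev ennreal_mult)

text \<open>For \<open>p = 1\<close> the dual norm is a supremum, and the kernel is compared
  pointwise. Since \<open>k \<ge> 2\<close> the exponent \<open>real k / 2 - 1\<close> is
  nonnegative, so \<open>1 - t\<^sup>2\<close> may be replaced by the larger
  \<open>1 - (\<rho> * t)\<^sup>2\<close> that occurs in the weight; since \<open>a2 \<le> 0\<close>
  the missing factor \<open>t powr a2\<close> is at least 1.\<close>

lemma profile_bound_p1: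
  assumes k: "k \<ge> 2" and a2: "a2 \<le> 0" and g1: "g1 \<ge> 0" "g1 \<ge> a1 + real n - real k" and g2: "g2 \<ge> 1 + a2"
    and [measurable]: "F \<in> borel_measurable borel" and \<rho>: "0 < \<rho>" "\<rho> < 1"
  shows "ennreal ((1 - \<rho>\<^sup>2) powr (g1 / 2) * \<rho> powr g2) * int01 (\<lambda>t. ennreal (\<bar>F (\<rho> * t)\<bar> * (1 - t\<^sup>2) powr (real k / 2 - 1)))
    \<le> int01 (\<lambda>t. ennreal (\<bar>F t\<bar> * (1 - t\<^sup>2) powr ((a1 + real n - 2) / 2) * t powr a2))"
proof -
  define A where "A = (a1 + real n - 2) / 2"
  define B where "B = real k / 2 - 1"
  have B: "B \<ge> 0" using k by (simp add: B_def)
  have BA: "B - A \<ge> - (g1 / 2)" using g1(2) by (simp add: A_def B_def field_simps)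
  have r2: "\<rho>\<^sup>2 < 1" "0 < \<rho>\<^sup>2" using \<rho> by (auto simp: abs_square_less_1)
  define g where "g s = ennreal (\<bar>F s\<bar> * (1 - s\<^sup>2) powr A * s powr a2)" for s
  have [measurable]: "g \<in> borel_measurable borel" unfolding g_def by measurable
  let ?c = "(1 - \<rho>\<^sup>2) powr (- (g1 / 2)) * \<rho> powr (- a2)"
  have "int01 (\<lambda>t. ennreal (\<bar>F (\<rho> * t)\<bar> * (1 - t\<^sup>2) powr B)) \<le> int01 (\<lambda>t. ennreal ?c * g (\<rho> * t))"
  proof (rule int01_mono)
    fix t :: real assume t: "0 < t" "t < 1"
    have t2: "t\<^sup>2 < 1" "0 < t\<^sup>2" using t by (auto simp: abs_square_less_1)
    let ?y = "1 - (\<rho> * t)\<^sup>2"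
    have rt: "\<rho>\<^sup>2 * t\<^sup>2 \<le> \<rho>\<^sup>2" "\<rho>\<^sup>2 * t\<^sup>2 \<le> t\<^sup>2" using r2 t2 by (auto intro: mult_left_le mult_left_le_one_le)
    have y: "1 - \<rho>\<^sup>2 \<le> ?y" "1 - t\<^sup>2 \<le> ?y" "?y \<le> 1" "?y > 0"
      using rt r2 t2 by (simp_all add: power_mult_distrib order.strict_trans1[OF rt(1) r2(1)])
    have "(1 - t\<^sup>2) powr B \<le> ?y powr B" using y t2 B by (intro powr_mono2) auto
    also have "\<dots> = ?y powr A * ?y powr (B - A)" by (simp add: powr_add[symmetric])
    also have "\<dots> \<le> ?y powr A * (1 - \<rho>\<^sup>2) powr (- (g1 / 2))"
    proof (intro mult_left_mono)
      have "?y powr (B - A) \<le> ?y powr (- (g1 / 2))" using y BA by (intro powr_mono') auto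
      also have "\<dots> \<le> (1 - \<rho>\<^sup>2) powr (- (g1 / 2))" using y r2 g1 by (intro powr_mono2') auto
      finally show "?y powr (B - A) \<le> (1 - \<rho>\<^sup>2) powr (- (g1 / 2))" .
    qed auto
    finally have 1: "(1 - t\<^sup>2) powr B \<le> (1 - \<rho>\<^sup>2) powr (- (g1 / 2)) * ?y powr A" by (simp add: mult.commute)
    have "1 \<le> t powr a2" using powr_mono2'[of a2 t 1] a2 t by simp
    also have "\<dots> = \<rho> powr (- a2) * (\<rho> * t) powr a2" using \<rho> t by (simp add: powr_mult powr_minus)
    finally have 2: "1 \<le> \<rho> powr (- a2) * (\<rho> * t) powr a2" .
    have "(1 - t\<^sup>2) powr B * 1 \<le> ((1 - \<rho>\<^sup>2) powr (- (g1 / 2)) * ?y powr A) * (\<rho> powr (- a2) * (\<rho> * t) powr a2)"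
      using 1 2 by (intro mult_mono) auto
    then have "\<bar>F (\<rho> * t)\<bar> * (1 - t\<^sup>2) powr B \<le> \<bar>F (\<rho> * t)\<bar> * (((1 - \<rho>\<^sup>2) powr (- (g1 / 2)) * ?y powr A) * (\<rho> powr (- a2) * (\<rho> * t) powr a2))"
      by (intro mult_left_mono) auto
    also have "\<dots> = ?c * (\<bar>F (\<rho> * t)\<bar> * ?y powr A * (\<rho> * t) powr a2)" by (simp add: ac_simps)
    finally show "ennreal (\<bar>F (\<rho> * t)\<bar> * (1 - t\<^sup>2) powr B) \<le> ennreal ?c * g (\<rho> * t)"
      unfolding g_def by (subst ennreal_mult[symmetric]) (auto intro!: ennreal_leI)
  qed
  also have "\<dots> = ennreal ?c * int01 (\<lambda>t. g (\<rho> * t))" by (rule int01_cmult) measurable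
  also have "\<dots> \<le> ennreal ?c * (ennreal (1 / \<rho>) * int01 g)" by (intro mult_left_mono int01_scale \<rho>) auto
  finally have "ennreal ((1 - \<rho>\<^sup>2) powr (g1 / 2) * \<rho> powr g2) * int01 (\<lambda>t. ennreal (\<bar>F (\<rho> * t)\<bar> * (1 - t\<^sup>2) powr B))
     \<le> ennreal ((1 - \<rho>\<^sup>2) powr (g1 / 2) * \<rho> powr g2) * (ennreal ?c * (ennreal (1 / \<rho>) * int01 g))"
    by (rule mult_left_mono) simp
  also have "\<dots> = ennreal (((1 - \<rho>\<^sup>2) powr (g1 / 2) * \<rho> powr g2) * (?c * (1 / \<rho>))) * int01 g"
  proof -
    have "ennreal x * (ennreal y * (ennreal (1 / \<rho>) * z)) = ennreal (x * (y * (1 / \<rho>))) * z" if "x \<ge> 0" "y \<ge> 0" for x y z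
      using that \<rho> by (subst ennreal_mult, simp, simp, subst ennreal_mult) (auto simp: mult.assoc)
    from this[of "(1 - \<rho>\<^sup>2) powr (g1 / 2) * \<rho> powr g2" ?c "int01 g"] show ?thesis by simp
  qed
  also have "\<dots> \<le> ennreal 1 * int01 g"
  proof (intro mult_right_mono ennreal_leI)
    have "((1 - \<rho>\<^sup>2) powr (g1 / 2) * \<rho> powr g2) * (?c * (1 / \<rho>)) = \<rho> powr (g2 - (1 + a2))"
      using \<rho> r2 by (simp add: powr_diff powr_add powr_minus field_simps)
    also have "\<dots> \<le> 1" using \<rho> g2 by (intro powr_le1) auto
    finally show "((1 - \<rho>\<^sup>2) powr (g1 / 2) * \<rho> powr g2) * (?c * (1 / \<rho>)) \<le> 1" .
  qed auto
  finally show ?thesis by (simp add: A_def B_def g_def[abs_def])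
qed

text \<open>The weight of the norm, evaluated at \<open>\<rho> * t\<close>, is inserted in one
  Hoelder factor and divided out of the other. The dual factor is then the kernel integral with
  exponents \<open>a\<close>, \<open>b\<close> and \<beta>. For \<open>k = 1\<close> the condition
  \<open>a > -1\<close> is exactly \<open>p > 2\<close>, and \<open>b > -1\<close> is
  \<open>a2 < p - 1\<close>.\<close>

lemma profile_bound:
  assumes p: "p > 1" and k: "k \<ge> 1" and a2: "a2 < p - 1" and k1: "k = 1 \<longrightarrow> p > 2"
    and g1: "g1 \<ge> 0" "g1 \<ge> (a1 + real n) / p - real k" and crit: "p = (a1 + real n) / real k \<longrightarrow> g1 > 0"
    and g2: "g2 \<ge> (1 + a2) / p"
  obtains K where "K > 0" "\<And>F \<rho> U. F \<in> borel_measurable borel \<Longrightarrow> 0 < \<rho> \<Longrightarrow> \<rho> < 1 \<Longrightarrow> U \<ge> 0 \<Longrightarrow>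
    int01 (\<lambda>t. ennreal (\<bar>F t\<bar> powr p * (1 - t\<^sup>2) powr ((a1 + real n - 2) / 2) * t powr a2)) \<le> ennreal U \<Longrightarrow>
    ennreal ((1 - \<rho>\<^sup>2) powr (g1 / 2) * \<rho> powr g2) * int01 (\<lambda>t. ennreal (\<bar>F (\<rho> * t)\<bar> * (1 - t\<^sup>2) powr (real k / 2 - 1)))
    \<le> ennreal (K * U powr (1 / p))"
proof -
  define q where "q = p / (p - 1)"
  have q: "q > 1" "1 / p + 1 / q = 1" "q / p = 1 / (p - 1)" using p by (auto simp: q_def field_simps)
  define A where "A = (a1 + real n - 2) / 2"
  define B where "B = real k / 2 - 1"
  define a where "a = B * q"
  define b where "b = - a2 / (p - 1)"
  define \<beta> where "\<beta> = A / (p - 1)"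
  define \<theta> where "\<theta> = g1 * q / 2"
  have a: "a > -1"
  proof (cases "k = 1")
    case True
    then have "p > 2" using k1 by simp
    then have "q < 2" using p by (simp add: q_def field_simps)
    then show ?thesis using True by (simp add: a_def B_def)
  next
    case False
    then have "B \<ge> 0" using k by (simp add: B_def)
    then have "a \<ge> 0" using q by (simp add: a_def)
    then show ?thesis by simp
  qed
  have b: "b > -1" using a2 p by (simp add: b_def field_simps)
  \<comment> \<open>Matches the threshold of the kernel bounds with the condition on
    \<open>g1\<close>: multiplication by \<open>q / 2\<close> turns \<open>g1\<close> into \<theta>
    and \<open>(a1 + n) / p - k\<close> into \<open>\<beta> - a - 1\<close>.\<close>
  have id: "\<beta> - a - 1 = q / 2 * ((a1 + real n) / p - real k)"
  proof -
    have r: "p - 1 \<noteq> 0" "p \<noteq> 0" using p by auto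
    have "\<beta> - a - 1 = A / (p - 1) - B * p / (p - 1) - (p - 1) / (p - 1)"
      using r by (simp add: \<beta>_def a_def q_def)
    also have "\<dots> = (A - B * p - (p - 1)) / (p - 1)" by (simp only: diff_divide_distrib)
    also have "A - B * p - (p - 1) = (a1 + real n - real k * p) / 2"
      by (simp add: A_def B_def field_simps)
    also have "\<dots> / (p - 1) = q / 2 * ((a1 + real n - real k * p) / p)" using r by (simp add: q_def)
    also have "(a1 + real n - real k * p) / p = (a1 + real n) / p - real k" using r by (simp add: diff_divide_distrib)
    finally show ?thesis .
  qed
  have th: "\<theta> \<ge> 0" "\<theta> = q / 2 * g1" using g1 q by (auto simp: \<theta>_def)
  obtain K0 where K0: "K0 > 0" "\<And>\<rho>. 0 < \<rho> \<Longrightarrow> \<rho> < 1 \<Longrightarrow>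
    int01 (\<lambda>t. ennreal ((1 - t\<^sup>2) powr a * t powr b * (1 - \<rho>\<^sup>2 * t\<^sup>2) powr (- \<beta>))) \<le> ennreal (K0 * (1 - \<rho>\<^sup>2) powr (- \<theta>))"
  proof (cases "g1 > (a1 + real n) / p - real k")
    case True
    then have "\<theta> > \<beta> - a - 1" unfolding id th(2) using q by (intro mult_strict_left_mono) auto
    from kernel_bound_subcritical[OF a b th(1) this] show ?thesis using that by blast
  next
    case False
    then have eq: "g1 = (a1 + real n) / p - real k" using g1 by simp
    \<comment> \<open>The endpoint bound needs \<open>\<theta> > 0\<close>. Equality together with
      \<open>g1 = 0\<close> occurs only at the critical \<open>p\<close>, where the hypothesis
      excludes it.\<close>
    have "g1 \<noteq> 0"
    proof
      assume g0: "g1 = 0"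
      then have "p = (a1 + real n) / real k" using eq p k by (simp add: field_simps)
      then show False using crit g0 by simp
    qed
    then have "\<theta> > 0" unfolding th(2) using g1 q by simp
    moreover have "\<theta> = \<beta> - a - 1" unfolding id th(2) eq ..
    ultimately show ?thesis using kernel_bound_endpoint[OF a b] that by blast
  qed
  define K where "K = K0 powr (1 / q)"
  have "K > 0" using K0 by (simp add: K_def)
  moreover have "ennreal ((1 - \<rho>\<^sup>2) powr (g1 / 2) * \<rho> powr g2) * int01 (\<lambda>t. ennreal (\<bar>F (\<rho> * t)\<bar> * (1 - t\<^sup>2) powr B))
    \<le> ennreal (K * U powr (1 / p))"
    if F [measurable]: "F \<in> borel_measurable borel" and \<rho>: "0 < \<rho>" "\<rho> < 1" and U: "U \<ge> 0"
      "int01 (\<lambda>t. ennreal (\<bar>F t\<bar> powr p * (1 - t\<^sup>2) powr A * t powr a2)) \<le> ennreal U" for F \<rho> U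
  proof -
    have r2: "\<rho>\<^sup>2 < 1" "0 < \<rho>\<^sup>2" using \<rho> by (auto simp: abs_square_less_1)
    define g where "g s = ennreal (\<bar>F s\<bar> powr p * (1 - s\<^sup>2) powr A * s powr a2)" for s
    have [measurable]: "g \<in> borel_measurable borel" unfolding g_def by measurable
    define i :: "real \<Rightarrow> real" where "i = indicator {0<..<1}"
    have [measurable]: "i \<in> borel_measurable borel" unfolding i_def by measurable
    \<comment> \<open>\<open>u\<close> carries the weight at \<open>\<rho> * t\<close> to the power
      \<open>1 / p\<close> and \<open>v\<close> its inverse, so that \<open>u t * v t\<close> is the
      integrand. The indicator \<open>i\<close> allows Hoelder to be used on the whole line.\<close>
    define u where "u t = \<bar>F (\<rho> * t)\<bar> * (\<rho> * t) powr (a2 / p) * (1 - (\<rho> * t)\<^sup>2) powr (A / p) * i t" for t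
    define v where "v t = (1 - t\<^sup>2) powr B * (\<rho> * t) powr (- a2 / p) * (1 - (\<rho> * t)\<^sup>2) powr (- A / p) * i t" for t
    have [measurable]: "u \<in> borel_measurable lborel" "v \<in> borel_measurable lborel"
      unfolding u_def v_def by measurable
    have i0: "i t \<ge> 0" for t by (simp add: i_def)
    have nn: "u t \<ge> 0" "v t \<ge> 0" for t unfolding u_def v_def using i0 by auto
    have y: "0 < 1 - (\<rho> * t)\<^sup>2" if t: "0 < t" "t < 1" for t
    proof -
      have "\<rho> * t < 1 * 1" using \<rho> t by (intro mult_strict_mono) auto
      then show ?thesis using \<rho> t by (simp add: abs_square_less_1)
    qed
    have "(\<integral>\<^sup>+t. ennreal (u t powr p) \<partial>lborel) = int01 (\<lambda>t. g (\<rho> * t))"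
      unfolding int01_def
    proof (rule nn_integral_cong)
      fix t :: real
      show "ennreal (u t powr p) = g (\<rho> * t) * indicator {0<..<1} t"
      proof (cases "0 < t \<and> t < 1")
        case True
        then show ?thesis using \<rho> p y[of t] by (simp add: u_def g_def i_def powr_mult powr_powr ac_simps)
      qed (use p in \<open>auto simp: u_def i_def indicator_def\<close>)
    qed
    also have "\<dots> \<le> ennreal (1 / \<rho>) * int01 g" by (rule int01_scale[OF _ \<rho>]) measurable
    also have "\<dots> \<le> ennreal (1 / \<rho>) * ennreal U" using U(2) by (intro mult_left_mono) (auto simp: g_def[abs_def])
    finally have hu: "(\<integral>\<^sup>+t. ennreal (u t powr p) \<partial>lborel) \<le> ennreal (U / \<rho>)"
      using \<rho> U by (simp add: ennreal_mult[symmetric])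
    define V where "V = \<rho> powr (- a2 / (p - 1)) * (K0 * (1 - \<rho>\<^sup>2) powr (- \<theta>))"
    have V: "V > 0" using \<rho> K0 r2 by (simp add: V_def)
    have "(\<integral>\<^sup>+t. ennreal (v t powr q) \<partial>lborel)
       = int01 (\<lambda>t. ennreal (\<rho> powr (- a2 / (p - 1))) * ennreal ((1 - t\<^sup>2) powr a * t powr b * (1 - \<rho>\<^sup>2 * t\<^sup>2) powr (- \<beta>)))"
      unfolding int01_def
    proof (rule nn_integral_cong)
      fix t :: real
      show "ennreal (v t powr q) = ennreal (\<rho> powr (- a2 / (p - 1))) * ennreal ((1 - t\<^sup>2) powr a * t powr b * (1 - \<rho>\<^sup>2 * t\<^sup>2) powr (- \<beta>)) * indicator {0<..<1} t"
      proof (cases "0 < t \<and> t < 1")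
        case True
        then have t: "0 < t" "t < 1" by auto
        have t2: "t\<^sup>2 < 1" using t by (auto simp: abs_square_less_1)
        have e: "- a2 / p * q = - a2 / (p - 1)" "- A / p * q = - \<beta>"
          using q(3) by (auto simp: \<beta>_def divide_inverse mult.assoc mult.commute)
        have "v t powr q = (1 - t\<^sup>2) powr a * ((\<rho> * t) powr (- a2 / (p - 1)) * (1 - (\<rho> * t)\<^sup>2) powr (- \<beta>))"
          unfolding v_def a_def e[symmetric] using t y[OF t] t2 by (simp add: i_def powr_mult powr_powr)
        also have "\<dots> = \<rho> powr (- a2 / (p - 1)) * ((1 - t\<^sup>2) powr a * t powr b * (1 - \<rho>\<^sup>2 * t\<^sup>2) powr (- \<beta>))"
          using \<rho> t by (simp add: b_def powr_mult power_mult_distrib)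
        finally show ?thesis using t by (simp add: ennreal_mult)
      qed (use q in \<open>auto simp: v_def i_def indicator_def\<close>)
    qed
    also have "\<dots> = ennreal (\<rho> powr (- a2 / (p - 1))) * int01 (\<lambda>t. ennreal ((1 - t\<^sup>2) powr a * t powr b * (1 - \<rho>\<^sup>2 * t\<^sup>2) powr (- \<beta>)))"
      by (rule int01_cmult) measurable
    also have "\<dots> \<le> ennreal (\<rho> powr (- a2 / (p - 1))) * ennreal (K0 * (1 - \<rho>\<^sup>2) powr (- \<theta>))"
      by (intro mult_left_mono K0 \<rho>) auto
    finally have hv: "(\<integral>\<^sup>+t. ennreal (v t powr q) \<partial>lborel) \<le> ennreal V"
      unfolding V_def using K0 by (subst ennreal_mult) auto
    have "int01 (\<lambda>t. ennreal (\<bar>F (\<rho> * t)\<bar> * (1 - t\<^sup>2) powr B)) = (\<integral>\<^sup>+t. ennreal (u t * v t) \<partial>lborel)"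
      unfolding int01_def
    proof (rule nn_integral_cong)
      fix t :: real
      show "ennreal (\<bar>F (\<rho> * t)\<bar> * (1 - t\<^sup>2) powr B) * indicator {0<..<1} t = ennreal (u t * v t)"
      proof (cases "0 < t \<and> t < 1")
        case True
        then have t: "0 < t" "t < 1" by auto
        have "(\<rho> * t) powr (a2 / p) * (\<rho> * t) powr (- a2 / p) = 1"
          "(1 - (\<rho> * t)\<^sup>2) powr (A / p) * (1 - (\<rho> * t)\<^sup>2) powr (- A / p) = 1"
          using \<rho> t y[OF t] by (auto simp: powr_add[symmetric])
        then have "u t * v t = \<bar>F (\<rho> * t)\<bar> * (1 - t\<^sup>2) powr B"
          using t unfolding u_def v_def i_def by (simp add: algebra_simps) 
        then show ?thesis using t by simp
      qed (auto simp: u_def i_def indicator_def)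
    qed
    also have "\<dots> \<le> ennreal ((U / \<rho>) powr (1 / p) * V powr (1 / q))"
      by (rule nn_integral_Holder[OF _ _ nn p q(1,2) hu _ hv V]) (use U \<rho> in auto)
    finally have "ennreal ((1 - \<rho>\<^sup>2) powr (g1 / 2) * \<rho> powr g2) * int01 (\<lambda>t. ennreal (\<bar>F (\<rho> * t)\<bar> * (1 - t\<^sup>2) powr B))
      \<le> ennreal ((1 - \<rho>\<^sup>2) powr (g1 / 2) * \<rho> powr g2) * ennreal ((U / \<rho>) powr (1 / p) * V powr (1 / q))"
      by (rule mult_left_mono) simp
    also have "\<dots> = ennreal (((1 - \<rho>\<^sup>2) powr (g1 / 2) * \<rho> powr g2) * ((U / \<rho>) powr (1 / p) * V powr (1 / q)))"
      by (simp add: ennreal_mult)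
    also have "\<dots> \<le> ennreal (K * U powr (1 / p))"
    proof (rule ennreal_leI)
      have e: "- a2 / (p - 1) * (1 / q) = - a2 / p" "- \<theta> * (1 / q) = - (g1 / 2)"
        using p q(1) by (auto simp: q_def \<theta>_def field_simps)
      have "V powr (1 / q) = \<rho> powr (- a2 / (p - 1) * (1 / q)) * (K * (1 - \<rho>\<^sup>2) powr (- \<theta> * (1 / q)))"
        unfolding V_def K_def using \<rho> r2 K0 by (simp only: powr_mult powr_powr)
      then have V': "V powr (1 / q) = \<rho> powr (- a2 / p) * (K * (1 - \<rho>\<^sup>2) powr (- (g1 / 2)))" unfolding e .
      have U': "(U / \<rho>) powr (1 / p) = U powr (1 / p) * \<rho> powr (- (1 / p))"
        using U \<rho> by (simp add: powr_divide powr_minus_divide)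
      have "((1 - \<rho>\<^sup>2) powr (g1 / 2) * \<rho> powr g2) * ((U / \<rho>) powr (1 / p) * V powr (1 / q))
         = K * U powr (1 / p) * ((1 - \<rho>\<^sup>2) powr (g1 / 2) * (1 - \<rho>\<^sup>2) powr (- (g1 / 2))) * (\<rho> powr g2 * \<rho> powr (- (1 / p)) * \<rho> powr (- a2 / p))"
        unfolding V' U' by (simp only: ac_simps)
      also have "(1 - \<rho>\<^sup>2) powr (g1 / 2) * (1 - \<rho>\<^sup>2) powr (- (g1 / 2)) = 1"
        using r2 by (simp add: powr_add[symmetric])
      \<comment> \<open>The exponent \<open>- (1 / p)\<close> comes from rescaling the norm and
        \<open>- a2 / p\<close> from the dual weight; the condition on \<open>g2\<close> makes the
        total nonnegative.\<close>
      also have "\<rho> powr g2 * \<rho> powr (- (1 / p)) * \<rho> powr (- a2 / p) = \<rho> powr (g2 - (1 + a2) / p)"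
        by (simp add: powr_add[symmetric] add_divide_distrib diff_diff_eq)
      also have "K * U powr (1 / p) * 1 * \<rho> powr (g2 - (1 + a2) / p) \<le> K * U powr (1 / p) * 1 * 1"
        using \<rho> g2 \<open>K > 0\<close> by (intro mult_left_mono powr_le1) auto
      finally show "((1 - \<rho>\<^sup>2) powr (g1 / 2) * \<rho> powr g2) * ((U / \<rho>) powr (1 / p) * V powr (1 / q)) \<le> K * U powr (1 / p)" by simp
    qed
    finally show ?thesis .
  qed
  ultimately show thesis unfolding A_def B_def by (rule that)
qed

lemma ineq_star_sufficient:
  assumes k: "k \<ge> 1" and kn: "Suc k \<le> n" and p: "p \<ge> 1" "p \<ge> 1 + a2" "a2 > 0 \<longrightarrow> p > 1 + a2" and k1: "k = 1 \<longrightarrow> p > 2"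
    and g1: "g1 \<ge> 0" "g1 \<ge> (a1 + real n) / p - real k" and crit: "p = (a1 + real n) / real k \<longrightarrow> g1 > 0"
    and g2: "g2 \<ge> (1 + a2) / p"
  shows "ineq_star n k a1 a2 g1 g2 p"
proof -
  define N where "N F = int01 (\<lambda>t. ennreal (\<bar>F t\<bar> powr p * (1 - t\<^sup>2) powr ((a1 + real n - 2) / 2) * t powr a2))" for F
  have "\<exists>K>0. \<forall>F \<rho> U. F \<in> borel_measurable borel \<longrightarrow> 0 < \<rho> \<longrightarrow> \<rho> < 1 \<longrightarrow> U \<ge> 0 \<longrightarrow> N F \<le> ennreal U \<longrightarrow>
    ennreal ((1 - \<rho>\<^sup>2) powr (g1 / 2) * \<rho> powr g2) * int01 (\<lambda>t. ennreal (\<bar>F (\<rho> * t)\<bar> * (1 - t\<^sup>2) powr (real k / 2 - 1)))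
    \<le> ennreal (K * U powr (1 / p))"
  proof (cases "p = 1")
    case True
    have k2: "k \<ge> 2" using k k1 True by (cases "k = 1") auto
    have a2: "a2 \<le> 0" using p True by auto
    show ?thesis
    proof (intro exI[of _ 1] conjI allI impI)
      fix F :: "real \<Rightarrow> real" and \<rho> U :: real
      assume F: "F \<in> borel_measurable borel" and \<rho>: "0 < \<rho>" "\<rho> < 1" and U: "0 \<le> U" "N F \<le> ennreal U"
      have NF: "N F = int01 (\<lambda>t. ennreal (\<bar>F t\<bar> * (1 - t\<^sup>2) powr ((a1 + real n - 2) / 2) * t powr a2))"
        by (simp add: N_def True)
      show "ennreal ((1 - \<rho>\<^sup>2) powr (g1 / 2) * \<rho> powr g2) * int01 (\<lambda>t. ennreal (\<bar>F (\<rho> * t)\<bar> * (1 - t\<^sup>2) powr (real k / 2 - 1)))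
         \<le> ennreal (1 * U powr (1 / p))"
        using profile_bound_p1[OF k2 a2 g1(1) _ _ F \<rho>, of a1 n g2] g1(2) g2 U
        unfolding NF[symmetric] by (auto simp: True intro: order_trans)
    qed simp
  next
    case False
    then have p1: "p > 1" using p by simp
    have a2: "a2 < p - 1" using p p1 by (cases "a2 > 0") auto
    show ?thesis unfolding N_def by (rule profile_bound[OF p1 k a2 k1 g1 crit g2]) blast
  qed
  then obtain K where K: "K > 0" "\<And>F \<rho> U. F \<in> borel_measurable borel \<Longrightarrow> 0 < \<rho> \<Longrightarrow> \<rho> < 1 \<Longrightarrow> U \<ge> 0 \<Longrightarrow> N F \<le> ennreal U \<Longrightarrow>
    ennreal ((1 - \<rho>\<^sup>2) powr (g1 / 2) * \<rho> powr g2) * int01 (\<lambda>t. ennreal (\<bar>F (\<rho> * t)\<bar> * (1 - t\<^sup>2) powr (real k / 2 - 1)))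
    \<le> ennreal (K * U powr (1 / p))" by blast
  have kp: "slice_const k > 0" "slice_const n > 0" using slice_const_pos k kn by auto
  \<comment> \<open>The factors \<open>2 * slice_const\<close> convert integrals over the unit
    interval into slice integrals of even functions, in dimension \<open>k\<close> for the transform
    and in dimension \<open>n\<close> for the norm.\<close>
  define C where "C = 2 * slice_const k * K * (1 / (2 * slice_const n)) powr (1 / p)"
  have C: "C \<ge> 0" using kp K by (simp add: C_def)
  show ?thesis
  proof (rule ineq_star_if_profile[OF k kn C])
    fix F :: "real \<Rightarrow> real" and \<rho> :: real
    assume F [measurable]: "F \<in> borel_measurable borel" and ev: "\<And>t. F (- t) = F t" and fin: "profile_pow n a1 a2 p F < \<infinity>" and \<rho>: "0 < \<rho>" "\<rho> < 1"
    define W where "W = enn2real (profile_pow n a1 a2 p F)"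
    have "ennreal W = ennreal (2 * slice_const n) * N F"
      using fin profile_pow_even[OF F ev, of n a1 a2 p] kn by (simp add: W_def N_def less_top)
    then have "ennreal (1 / (2 * slice_const n)) * ennreal W = (ennreal (1 / (2 * slice_const n)) * ennreal (2 * slice_const n)) * N F"
      by (simp add: mult.assoc)
    also have "ennreal (1 / (2 * slice_const n)) * ennreal (2 * slice_const n) = 1"
      using kp by (subst ennreal_mult[symmetric]) auto
    finally have NF: "N F = ennreal (1 / (2 * slice_const n) * W)" using kp by (subst ennreal_mult) (auto simp: W_def)
    have r2: "\<rho>\<^sup>2 < 1" using \<rho> by (auto simp: abs_square_less_1)
    have "ennreal (sqrt (1 - \<rho>\<^sup>2) powr g1 * \<rho> powr g2) * (\<integral>\<^sup>+t. ennreal \<bar>F (\<rho> * t)\<bar> \<partial>slice_measure k)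
      = ennreal (2 * slice_const k) * (ennreal ((1 - \<rho>\<^sup>2) powr (g1 / 2) * \<rho> powr g2) * int01 (\<lambda>t. ennreal (\<bar>F (\<rho> * t)\<bar> * (1 - t\<^sup>2) powr (real k / 2 - 1))))"
      unfolding nn_integral_slice_profile[OF F ev k] using r2 by (simp add: sqrt_powr ac_simps)
    also have "\<dots> \<le> ennreal (2 * slice_const k) * ennreal (K * (1 / (2 * slice_const n) * W) powr (1 / p))"
      using kp by (intro mult_left_mono K(2)[OF F \<rho>]) (auto simp: NF W_def)
    also have "\<dots> = ennreal (C * W powr (1 / p))"
    proof -
      have "(1 / (2 * slice_const n) * W) powr (1 / p) = (1 / (2 * slice_const n)) powr (1 / p) * W powr (1 / p)"
        by (rule powr_mult)
      then show ?thesis using kp K by (subst ennreal_mult[symmetric]) (auto simp: C_def mult.assoc)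
    qed
    finally show "ennreal (sqrt (1 - \<rho>\<^sup>2) powr g1 * \<rho> powr g2) * (\<integral>\<^sup>+t. ennreal \<bar>F (\<rho> * t)\<bar> \<partial>slice_measure k)
        \<le> ennreal (C * enn2real (profile_pow n a1 a2 p F) powr (1 / p))" by (simp add: W_def)
  qed
qed

section \<open>Necessity\<close>

text \<open>The substitution \<open>s = \<rho> * t\<close> moves \<rho> from the test function into
  the kernel. On a fixed interval below \<rho> the integrand can then be minorised by an
  \<open>h\<close> that does not depend on \<rho>.\<close>

lemma nn_integral_slice_lower:
  assumes [measurable]: "F \<in> borel_measurable borel" and F0: "\<And>s. F s \<ge> 0" and \<rho>: "0 < \<rho>" "\<rho> < 1"
    and cd: "0 < c" "d < \<rho>" and k: "k \<ge> 1"
    and [measurable]: "h \<in> borel_measurable borel"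
    and h: "\<And>s. c \<le> s \<Longrightarrow> s \<le> d \<Longrightarrow> h s \<le> F s * (1 - (s / \<rho>)\<^sup>2) powr (real k / 2 - 1)"
  shows "ennreal (slice_const k) * (\<integral>\<^sup>+s. ennreal (h s) * indicator {c..d} s \<partial>lborel) \<le> ennreal \<rho> * (\<integral>\<^sup>+t. ennreal (F (\<rho> * t)) \<partial>slice_measure k)"
proof -
  let ?B = "real k / 2 - 1"
  let ?\<phi> = "\<lambda>s. ennreal (F s * (1 - (s / \<rho>)\<^sup>2) powr ?B) * indicator {c..d} s"
  have kp: "slice_const k > 0" by (rule slice_const_pos[OF k])
  have "(\<integral>\<^sup>+s. ennreal (h s) * indicator {c..d} s \<partial>lborel) \<le> (\<integral>\<^sup>+s. ?\<phi> s \<partial>lborel)"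
    by (intro nn_integral_mono) (auto simp: indicator_def intro!: ennreal_leI h)
  also have "\<dots> = ennreal \<bar>\<rho>\<bar> * (\<integral>\<^sup>+t. ?\<phi> (0 + \<rho> * t) \<partial>lborel)"
    by (rule nn_integral_real_affine) (use \<rho> in auto)
  also have "\<dots> \<le> ennreal \<bar>\<rho>\<bar> * (\<integral>\<^sup>+t. ennreal (F (\<rho> * t) * (1 - t\<^sup>2) powr ?B) * indicator {-1<..<1} t \<partial>lborel)"
  proof (intro mult_left_mono nn_integral_mono)
    fix t
    have "-1 < t \<and> t < 1" if "c \<le> \<rho> * t" "\<rho> * t \<le> d"
    proof -
      have "0 < \<rho> * t" "\<rho> * t < \<rho> * 1" using that cd by linarith+
      then show ?thesis using \<rho> by (simp only: mult_less_cancel_left_pos zero_less_mult_iff) linarith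
    qed
    then show "?\<phi> (0 + \<rho> * t) \<le> ennreal (F (\<rho> * t) * (1 - t\<^sup>2) powr ?B) * indicator {-1<..<1} t"
      using \<rho> by (auto simp: indicator_def)
  qed simp
  finally have "ennreal (slice_const k) * (\<integral>\<^sup>+s. ennreal (h s) * indicator {c..d} s \<partial>lborel)
     \<le> ennreal (slice_const k) * (ennreal \<bar>\<rho>\<bar> * (\<integral>\<^sup>+t. ennreal (F (\<rho> * t) * (1 - t\<^sup>2) powr ?B) * indicator {-1<..<1} t \<partial>lborel))"
    by (rule mult_left_mono) simp
  also have "\<dots> = ennreal \<rho> * (ennreal (slice_const k) * (\<integral>\<^sup>+t. ennreal (F (\<rho> * t) * (1 - t\<^sup>2) powr ?B) * indicator {-1<..<1} t \<partial>lborel))"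
    using \<rho> by (simp add: ac_simps)
  also have "ennreal (slice_const k) * (\<integral>\<^sup>+t. ennreal (F (\<rho> * t) * (1 - t\<^sup>2) powr ?B) * indicator {-1<..<1} t \<partial>lborel) = (\<integral>\<^sup>+t. ennreal (F (\<rho> * t)) \<partial>slice_measure k)"
    unfolding slice_measure_def using kp F0
    by (subst nn_integral_density) (auto simp: nn_integral_cmult[symmetric] ennreal_mult ac_simps intro!: nn_integral_cong)
  finally show ?thesis .
qed

lemma profile_pow_upper:
  assumes [measurable]: "F \<in> borel_measurable borel" and F0: "\<And>s. F s \<ge> 0" and ev: "\<And>t. F (- t) = F t" and n: "n \<ge> 1"
    and cd: "0 < c" "d < 1" and supp: "\<And>s. 0 < s \<Longrightarrow> s < 1 \<Longrightarrow> s < c \<or> d < s \<Longrightarrow> F s = 0"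
    and V: "\<And>s. c \<le> s \<Longrightarrow> s \<le> d \<Longrightarrow> (1 - s\<^sup>2) powr ((a1 + real n - 2) / 2) * s powr a2 \<le> V" "V \<ge> 0"
  shows "profile_pow n a1 a2 p F \<le> ennreal (2 * slice_const n * V) * (\<integral>\<^sup>+s. ennreal (F s powr p) * indicator {c..d} s \<partial>lborel)"
proof -
  let ?A = "(a1 + real n - 2) / 2"
  have kp: "slice_const n > 0" by (rule slice_const_pos[OF n])
  have "int01 (\<lambda>t. ennreal (\<bar>F t\<bar> powr p * (1 - t\<^sup>2) powr ?A * t powr a2)) \<le> (\<integral>\<^sup>+s. ennreal V * (ennreal (F s powr p) * indicator {c..d} s) \<partial>lborel)"
    unfolding int01_def
  proof (rule nn_integral_mono)
    fix t :: real
    show "ennreal (\<bar>F t\<bar> powr p * (1 - t\<^sup>2) powr ?A * t powr a2) * indicator {0<..<1} t \<le> ennreal V * (ennreal (F t powr p) * indicator {c..d} t)"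
    proof (cases "0 < t \<and> t < 1 \<and> c \<le> t \<and> t \<le> d")
      case True
      have "F t powr p * ((1 - t\<^sup>2) powr ?A * t powr a2) \<le> F t powr p * V"
        using True V by (intro mult_left_mono) auto
      then show ?thesis using True V F0 by (auto simp: ennreal_mult[symmetric] ac_simps intro!: ennreal_leI)
    next
      case False
      then show ?thesis using supp[of t] by (auto simp: indicator_def not_le)
    qed
  qed
  also have "\<dots> = ennreal V * (\<integral>\<^sup>+s. ennreal (F s powr p) * indicator {c..d} s \<partial>lborel)"
    by (rule nn_integral_cmult) measurable
  finally have "profile_pow n a1 a2 p F \<le> ennreal (2 * slice_const n) * (ennreal V * (\<integral>\<^sup>+s. ennreal (F s powr p) * indicator {c..d} s \<partial>lborel))"
    unfolding profile_pow_even[OF assms(1) ev n] by (rule mult_left_mono) simp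
  then show ?thesis using kp V by (simp add: ennreal_mult mult.assoc)
qed

text \<open>The height supplied by \<open>profile_ineq\<close> is not under control, so the bounds
  \<open>h\<close> for the integrand and \<open>L\<close> for the weight are uniform in \<rho>
  between \<open>a\<close> and \<open>b\<close>. The factor \<rho> next to \<open>L\<close> pays for
  the one lost in the substitution \<open>s = \<rho> * t\<close>.\<close>

lemma profile_test:
  assumes pr: "profile_ineq n k a1 a2 g1 g2 p C" and p: "p > 0" and n: "n \<ge> 1" and k: "k \<ge> 1"
    and F [measurable]: "F \<in> borel_measurable borel" and F0: "\<And>s. F s \<ge> 0" and ev: "\<And>t. F (- t) = F t"
    and cd: "0 < c" "d \<le> a" and ab: "a < b" "b < 1" "0 < a"
    and supp: "\<And>s. 0 < s \<Longrightarrow> s < 1 \<Longrightarrow> s < c \<or> d < s \<Longrightarrow> F s = 0"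
    and V: "\<And>s. c \<le> s \<Longrightarrow> s \<le> d \<Longrightarrow> (1 - s\<^sup>2) powr ((a1 + real n - 2) / 2) * s powr a2 \<le> V" "V \<ge> 0"
    and U: "(\<integral>\<^sup>+s. ennreal (F s powr p) * indicator {c..d} s \<partial>lborel) \<le> ennreal U" "U \<ge> 0"
    and h [measurable]: "h \<in> borel_measurable borel"
    and hF: "\<And>\<rho> s. a < \<rho> \<Longrightarrow> \<rho> < b \<Longrightarrow> c \<le> s \<Longrightarrow> s \<le> d \<Longrightarrow> h s \<le> F s * (1 - (s / \<rho>)\<^sup>2) powr (real k / 2 - 1)"
    and H: "ennreal H \<le> (\<integral>\<^sup>+s. ennreal (h s) * indicator {c..d} s \<partial>lborel)" "H \<ge> 0"
    and L: "\<And>\<rho>. a < \<rho> \<Longrightarrow> \<rho> < b \<Longrightarrow> L * \<rho> \<le> sqrt (1 - \<rho>\<^sup>2) powr g1 * \<rho> powr g2" "L \<ge> 0"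
  shows "L * (slice_const k * H) \<le> C * (2 * slice_const n * V * U) powr (1 / p)"
proof -
  have kp: "slice_const n > 0" "slice_const k > 0" using slice_const_pos n k by auto
  have C0: "C \<ge> 0" using pr by (simp add: profile_ineq_def)
  have "profile_pow n a1 a2 p F \<le> ennreal (2 * slice_const n * V) * (\<integral>\<^sup>+s. ennreal (F s powr p) * indicator {c..d} s \<partial>lborel)"
    by (rule profile_pow_upper[OF F F0 ev n cd(1) _ supp V]) (use cd ab in auto)
  also have "\<dots> \<le> ennreal (2 * slice_const n * V) * ennreal U" using U by (intro mult_left_mono) auto
  also have "\<dots> = ennreal (2 * slice_const n * V * U)" using kp V U by (simp add: ennreal_mult)
  finally have W: "profile_pow n a1 a2 p F \<le> ennreal (2 * slice_const n * V * U)" .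
  then have "profile_pow n a1 a2 p F < \<infinity>" using ennreal_less_top order.strict_trans1 by (metis infinity_ennreal_def)
  with pr F F0 ev ab obtain \<rho> where \<rho>: "a < \<rho>" "\<rho> < b"
    and le: "ennreal (sqrt (1 - \<rho>\<^sup>2) powr g1 * \<rho> powr g2) * (\<integral>\<^sup>+t. ennreal (F (\<rho> * t)) \<partial>slice_measure k) \<le> ennreal (C * enn2real (profile_pow n a1 a2 p F) powr (1 / p))"
    unfolding profile_ineq_def by meson
  have "ennreal (slice_const k * H) = ennreal (slice_const k) * ennreal H" using kp H by (simp add: ennreal_mult)
  also have "\<dots> \<le> ennreal (slice_const k) * (\<integral>\<^sup>+s. ennreal (h s) * indicator {c..d} s \<partial>lborel)"
    using H by (intro mult_left_mono) auto
  also have "\<dots> \<le> ennreal \<rho> * (\<integral>\<^sup>+t. ennreal (F (\<rho> * t)) \<partial>slice_measure k)"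
    by (rule nn_integral_slice_lower[OF F F0 _ _ cd(1) _ k h hF]) (use \<rho> ab cd in auto)
  finally have J: "ennreal (slice_const k * H) \<le> ennreal \<rho> * (\<integral>\<^sup>+t. ennreal (F (\<rho> * t)) \<partial>slice_measure k)" .
  have "ennreal (L * (slice_const k * H)) = ennreal L * ennreal (slice_const k * H)" using L kp H by (simp add: ennreal_mult)
  also have "\<dots> \<le> ennreal L * (ennreal \<rho> * (\<integral>\<^sup>+t. ennreal (F (\<rho> * t)) \<partial>slice_measure k))"
    by (intro mult_left_mono J) auto
  also have "\<dots> = ennreal (L * \<rho>) * (\<integral>\<^sup>+t. ennreal (F (\<rho> * t)) \<partial>slice_measure k)"
    using L(2) \<rho> ab by (simp add: ennreal_mult mult.assoc)
  also have "\<dots> \<le> ennreal (sqrt (1 - \<rho>\<^sup>2) powr g1 * \<rho> powr g2) * (\<integral>\<^sup>+t. ennreal (F (\<rho> * t)) \<partial>slice_measure k)"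
    by (intro mult_right_mono ennreal_leI L \<rho>) auto
  also note le
  finally have "L * (slice_const k * H) \<le> C * enn2real (profile_pow n a1 a2 p F) powr (1 / p)"
    using C0 by (simp add: ennreal_le_iff)
  also have "\<dots> \<le> C * (2 * slice_const n * V * U) powr (1 / p)"
  proof (intro mult_left_mono powr_mono2 C0)
    show "enn2real (profile_pow n a1 a2 p F) \<le> 2 * slice_const n * V * U"
      using enn2real_mono[OF W] kp V U by simp
  qed (use p in auto)
  finally show ?thesis .
qed

lemma indicator_test:
  assumes pr: "profile_ineq n k a1 a2 g1 g2 p C" and p: "p > 0" and n: "n \<ge> 1" and k: "k \<ge> 1"
    and cd: "0 < c" "c < d" "d \<le> a" and ab: "a < b" "b < 1"
    and V: "\<And>s. c \<le> s \<Longrightarrow> s \<le> d \<Longrightarrow> (1 - s\<^sup>2) powr ((a1 + real n - 2) / 2) * s powr a2 \<le> V" "V \<ge> 0"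
    and m: "\<And>\<rho> s. a < \<rho> \<Longrightarrow> \<rho> < b \<Longrightarrow> c \<le> s \<Longrightarrow> s \<le> d \<Longrightarrow> m \<le> (1 - (s / \<rho>)\<^sup>2) powr (real k / 2 - 1)" "m \<ge> 0"
    and L: "\<And>\<rho>. a < \<rho> \<Longrightarrow> \<rho> < b \<Longrightarrow> L * \<rho> \<le> sqrt (1 - \<rho>\<^sup>2) powr g1 * \<rho> powr g2" "L \<ge> 0"
  shows "L * (slice_const k * (m * (d - c))) \<le> C * (2 * slice_const n * V * (d - c)) powr (1 / p)"
proof -
  define F :: "real \<Rightarrow> real" where "F s = indicator {c..d} \<bar>s\<bar>" for s
  have U: "(\<integral>\<^sup>+s. ennreal (F s powr p) * indicator {c..d} s \<partial>lborel) \<le> ennreal (d - c)"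
  proof -
    have "(\<integral>\<^sup>+s. ennreal (F s powr p) * indicator {c..d} s \<partial>lborel) = (\<integral>\<^sup>+s. indicator {c..d} s \<partial>lborel)"
      using cd p by (intro nn_integral_cong) (auto simp: F_def indicator_def)
    then show ?thesis using cd by simp
  qed
  have H: "ennreal (m * (d - c)) \<le> (\<integral>\<^sup>+s. ennreal m * indicator {c..d} s \<partial>lborel)"
    using cd m by (simp add: nn_integral_cmult_indicator ennreal_mult)
  show ?thesis
  proof (rule profile_test[where F=F and c=c and d=d and a=a and b=b and h="\<lambda>_. m", OF pr p n k])
    show "F \<in> borel_measurable borel" unfolding F_def by measurable
    show "(\<integral>\<^sup>+s. ennreal (F s powr p) * indicator {c..d} s \<partial>lborel) \<le> ennreal (d - c)" by (rule U)
    show "ennreal (m * (d - c)) \<le> (\<integral>\<^sup>+s. ennreal m * indicator {c..d} s \<partial>lborel)" by (rule H)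
    show "m \<le> F s * (1 - (s / \<rho>)\<^sup>2) powr (real k / 2 - 1)" if "a < \<rho>" "\<rho> < b" "c \<le> s" "s \<le> d" for \<rho> s
      using m(1)[OF that] that cd by (simp add: F_def)
    show "V \<ge> 0" "L \<ge> 0" by fact+
    show "(1 - s\<^sup>2) powr ((a1 + real n - 2) / 2) * s powr a2 \<le> V" if "c \<le> s" "s \<le> d" for s using V that by blast
    show "L * \<rho> \<le> sqrt (1 - \<rho>\<^sup>2) powr g1 * \<rho> powr g2" if "a < \<rho>" "\<rho> < b" for \<rho> using L that by blast
  qed (use cd ab m in \<open>auto simp: F_def\<close>)
qed

section \<open>Conditions on the exponents from shrinking intervals\<close>

lemma powr_exponent_compare:
  fixes \<alpha> \<beta> C e :: real
  assumes "e > 0" and le: "\<And>\<delta>. 0 < \<delta> \<Longrightarrow> \<delta> < e \<Longrightarrow> \<delta> powr \<alpha> \<le> C * \<delta> powr \<beta>"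
  shows "\<beta> \<le> \<alpha>"
proof (rule ccontr)
  assume "\<not> \<beta> \<le> \<alpha>"
  then have pos: "\<beta> - \<alpha> > 0" by simp
  have "((\<lambda>\<delta>. C * \<delta> powr (\<beta> - \<alpha>)) \<longlongrightarrow> C * 0) (at_right 0)"
    using pos by (intro tendsto_mult tendsto_const tendsto_zero_powrI[where b="\<beta> - \<alpha>"]) (auto intro!: tendsto_ident_at eventually_at_rightI[of 0 1])
  then have "eventually (\<lambda>\<delta>. C * \<delta> powr (\<beta> - \<alpha>) < 1) (at_right 0)"
    by (rule order_tendstoD(2)) simp
  moreover have "eventually (\<lambda>\<delta>. \<delta> \<in> {0<..<e}) (at_right 0)" using assms(1) by (rule eventually_at_right_real)
  ultimately have "eventually (\<lambda>\<delta>. C * \<delta> powr (\<beta> - \<alpha>) < 1 \<and> \<delta> \<in> {0<..<e}) (at_right 0)" by eventually_elim simp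
  then obtain \<delta> where \<delta>: "C * \<delta> powr (\<beta> - \<alpha>) < 1" "0 < \<delta>" "\<delta> < e"
    using eventually_happens'[OF trivial_limit_at_right_real] by fastforce
  have "\<delta> powr \<alpha> \<le> C * \<delta> powr (\<beta> - \<alpha>) * \<delta> powr \<alpha>"
    using le[OF \<delta>(2,3)] by (simp add: powr_diff)
  also have "\<dots> < 1 * \<delta> powr \<alpha>" using \<delta> by (intro mult_strict_right_mono) auto
  finally show False by simp
qed

lemma powr_const_bounds:
  fixes x :: real
  assumes "0 < l" "l \<le> x" "x \<le> u"
  shows "min (l powr e) (u powr e) \<le> x powr e" "x powr e \<le> max (l powr e) (u powr e)"
  using powr_between[of l 1 x u e] assms by auto

lemma min_powr_pos: "0 < l \<Longrightarrow> 0 < u \<Longrightarrow> min (l powr e) (u powr e) > (0::real)"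
  by simp

lemma max_powr_pos: "0 < l \<Longrightarrow> max (l powr e) (u powr e) > (0::real)"
  by (simp add: less_max_iff_disj)

text \<open>The support has length and distance from 0 comparable to \<tau>, and so have the
  heights, between \<tau> and \<open>2 * \<tau>\<close>. The transform is then bounded below, the
  weight is of order \<open>\<tau> powr g2\<close> and the norm at most of order
  \<open>\<tau> powr ((1 + a2) / p)\<close>; letting \<tau> tend to 0 compares the
  exponents.\<close>

lemma necessary_g2:
  assumes pr: "profile_ineq n k a1 a2 g1 g2 p C" and p: "p > 0" and n: "n \<ge> 1" and k: "k \<ge> 1"
  shows "(1 + a2) / p \<le> g2"
proof -
  define A where "A = (a1 + real n - 2) / 2"
  define B where "B = real k / 2 - 1"
  define MA where "MA = max ((3/4) powr A) (1 powr A)"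
  define M2 where "M2 = max ((1/4) powr a2) ((1/2) powr a2)"
  define mB where "mB = min ((3/4) powr B) (1 powr B)"
  define L1 where "L1 = min ((3/4) powr (g1/2)) (1 powr (g1/2))"
  define L2 where "L2 = min (1 powr (g2 - 1)) (2 powr (g2 - 1))"
  have pos: "MA > 0" "M2 > 0" "mB > 0" "L1 > 0" "L2 > 0"
    unfolding MA_def M2_def mB_def L1_def L2_def by (intro max_powr_pos min_powr_pos; simp)+
  have kp: "slice_const n > 0" "slice_const k > 0" using slice_const_pos n k by auto
  define P where "P = L1 * L2 * slice_const k * mB / 4"
  define Q where "Q = C * (2 * slice_const n * MA * M2 / 4) powr (1 / p)"
  have P: "P > 0" using pos kp by (simp add: P_def)
  have "\<tau> powr g2 \<le> (Q / P) * \<tau> powr ((1 + a2) / p)" if \<tau>: "0 < \<tau>" "\<tau> < 1/4" for \<tau>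
  proof -
    have "(L1 * (L2 * \<tau> powr (g2 - 1))) * (slice_const k * (mB * (\<tau> / 2 - \<tau> / 4)))
        \<le> C * (2 * slice_const n * (MA * (M2 * \<tau> powr a2)) * (\<tau> / 2 - \<tau> / 4)) powr (1 / p)"
    proof (rule indicator_test[OF pr p n k, where c="\<tau> / 4" and d="\<tau> / 2" and a=\<tau> and b="2 * \<tau>"])
      fix s assume s: "\<tau> / 4 \<le> s" "s \<le> \<tau> / 2"
      have "s \<le> 1/2" "s > 0" using s \<tau> by auto
      then have "s\<^sup>2 \<le> (1/2)\<^sup>2" by (intro power_mono) auto
      then have "(1 - s\<^sup>2) powr A \<le> MA" unfolding MA_def by (intro powr_const_bounds) (auto simp: power2_eq_square)
      moreover have "s powr a2 \<le> M2 * \<tau> powr a2" unfolding M2_def using s \<tau> by (intro powr_between) auto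
      ultimately show "(1 - s\<^sup>2) powr ((a1 + real n - 2) / 2) * s powr a2 \<le> MA * (M2 * \<tau> powr a2)"
        unfolding A_def[symmetric] using pos by (intro mult_mono) auto
    next
      fix \<rho> s :: real assume \<rho>: "\<tau> < \<rho>" "\<rho> < 2 * \<tau>" and s: "\<tau> / 4 \<le> s" "s \<le> \<tau> / 2"
      have "s / \<rho> \<le> 1/2" "0 < s / \<rho>" using s \<rho> \<tau> by (auto simp: field_simps)
      then have "(s / \<rho>)\<^sup>2 \<le> (1/2)\<^sup>2" by (intro power_mono) auto
      moreover have "(s / \<rho>)\<^sup>2 \<ge> 0" by (rule zero_le_power2)
      ultimately show "mB \<le> (1 - (s / \<rho>)\<^sup>2) powr (real k / 2 - 1)"
        unfolding mB_def B_def[symmetric] by (intro powr_const_bounds) (simp_all add: power2_eq_square)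
    next
      fix \<rho> assume \<rho>: "\<tau> < \<rho>" "\<rho> < 2 * \<tau>"
      have "\<rho> \<le> 1/2" "\<rho> > 0" using \<rho> \<tau> by auto
      then have "\<rho>\<^sup>2 \<le> (1/2)\<^sup>2" by (intro power_mono) auto
      then have "3/4 \<le> 1 - \<rho>\<^sup>2" by (simp add: power_divide)
      then have 1: "L1 \<le> sqrt (1 - \<rho>\<^sup>2) powr g1"
        unfolding L1_def by (subst sqrt_powr, linarith, intro powr_const_bounds) auto
      have 2: "L2 * \<tau> powr (g2 - 1) \<le> \<rho> powr (g2 - 1)"
        unfolding L2_def using \<rho> \<tau> by (intro powr_between) auto
      have "L1 * (L2 * \<tau> powr (g2 - 1)) * \<rho> \<le> sqrt (1 - \<rho>\<^sup>2) powr g1 * \<rho> powr (g2 - 1) * \<rho>"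
        using 1 2 pos \<open>\<rho> > 0\<close> by (intro mult_right_mono mult_mono) auto
      also have "\<dots> = sqrt (1 - \<rho>\<^sup>2) powr g1 * \<rho> powr g2" using \<open>\<rho> > 0\<close> by (simp add: powr_diff)
      finally show "L1 * (L2 * \<tau> powr (g2 - 1)) * \<rho> \<le> sqrt (1 - \<rho>\<^sup>2) powr g1 * \<rho> powr g2" .
    qed (use \<tau> pos in auto)
    also have "2 * slice_const n * (MA * (M2 * \<tau> powr a2)) * (\<tau> / 2 - \<tau> / 4) = (2 * slice_const n * MA * M2 / 4) * \<tau> powr (1 + a2)"
      using \<tau> by (simp add: powr_add)
    also have "C * \<dots> powr (1 / p) = Q * \<tau> powr ((1 + a2) / p)"
      unfolding Q_def powr_mult[of "2 * slice_const n * MA * M2 / 4"] powr_powr by simp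
    also have "(L1 * (L2 * \<tau> powr (g2 - 1))) * (slice_const k * (mB * (\<tau> / 2 - \<tau> / 4))) = P * \<tau> powr g2"
      using \<tau> by (simp add: P_def powr_diff)
    finally show ?thesis using P by (simp add: field_simps)
  qed
  then show ?thesis by (rule powr_exponent_compare[where e="1/4", rotated]) auto
qed

lemma height_near_pole:
  fixes \<delta> \<rho> :: real
  assumes \<delta>: "0 < \<delta>" "\<delta> < 1/8" and \<rho>: "1 - 2 * \<delta> < \<rho>" "\<rho> < 1 - \<delta>"
  shows "min (1 powr (g1/2)) (4 powr (g1/2)) * min ((1/2) powr g2) (1 powr g2) * \<delta> powr (g1/2) * \<rho> \<le> sqrt (1 - \<rho>\<^sup>2) powr g1 * \<rho> powr g2"
proof -
  have r: "1/2 \<le> \<rho>" "\<rho> < 1" using assms by auto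
  have b: "1 * \<delta> \<le> 1 - \<rho>\<^sup>2" "1 - \<rho>\<^sup>2 \<le> 4 * \<delta>" using one_minus_sq_bounds[of \<rho>] r \<rho> by auto
  have "min (1 powr (g1/2)) (4 powr (g1/2)) * \<delta> powr (g1/2) \<le> (1 - \<rho>\<^sup>2) powr (g1/2)"
    using b \<delta> by (intro powr_between) auto
  also have "\<dots> = sqrt (1 - \<rho>\<^sup>2) powr g1" using b \<delta> by (subst sqrt_powr) auto
  finally have 1: "min (1 powr (g1/2)) (4 powr (g1/2)) * \<delta> powr (g1/2) \<le> sqrt (1 - \<rho>\<^sup>2) powr g1" .
  have 2: "min ((1/2) powr g2) (1 powr g2) \<le> \<rho> powr g2" using r by (intro powr_const_bounds) auto
  have pos: "min ((1/2) powr g2) (1 powr g2) > 0" by (intro min_powr_pos) auto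
  have "(min (1 powr (g1/2)) (4 powr (g1/2)) * \<delta> powr (g1/2)) * min ((1/2) powr g2) (1 powr g2) * \<rho>
     \<le> (sqrt (1 - \<rho>\<^sup>2) powr g1 * \<rho> powr g2) * 1"
    using 1 2 r pos by (intro mult_mono) (auto intro!: mult_nonneg_nonneg)
  then show ?thesis by (simp add: ac_simps)
qed

text \<open>A fixed function supported away from 1 has a transform bounded below as \<rho> tends to
  1, so the weight must stay bounded. At \<open>1 - \<rho>\<close> of order \<delta> it is of order
  \<open>\<delta> powr (g1 / 2)\<close>, the sine being the root of
  \<open>1 - \<rho>\<^sup>2\<close>.\<close>

lemma necessary_g1_nonneg:
  assumes pr: "profile_ineq n k a1 a2 g1 g2 p C" and p: "p > 0" and n: "n \<ge> 1" and k: "k \<ge> 1"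
  shows "0 \<le> g1"
proof -
  define A where "A = (a1 + real n - 2) / 2"
  define B where "B = real k / 2 - 1"
  define MA where "MA = max ((3/4) powr A) (1 powr A)"
  define M2 where "M2 = max ((1/4) powr a2) ((1/2) powr a2)"
  define mB where "mB = min ((1/2) powr B) (1 powr B)"
  define L where "L = min (1 powr (g1/2)) (4 powr (g1/2)) * min ((1/2) powr g2) (1 powr g2)"
  have pos: "MA > 0" "M2 > 0" "mB > 0" "L > 0"
    unfolding MA_def M2_def mB_def L_def by (intro mult_pos_pos max_powr_pos min_powr_pos; simp)+
  have kp: "slice_const n > 0" "slice_const k > 0" using slice_const_pos n k by auto
  define P where "P = L * slice_const k * mB / 4"
  define Q where "Q = C * (2 * slice_const n * (MA * M2) * (1 / 2 - 1 / 4)) powr (1 / p)"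
  have P: "P > 0" using pos kp by (simp add: P_def)
  have "\<delta> powr (g1/2) \<le> (Q / P) * \<delta> powr 0" if \<delta>: "0 < \<delta>" "\<delta> < 1/8" for \<delta>
  proof -
    have "(L * \<delta> powr (g1/2)) * (slice_const k * (mB * (1 / 2 - 1 / 4))) \<le> Q"
      unfolding Q_def
    proof (rule indicator_test[OF pr p n k, where c="1/4" and d="1/2" and a="1 - 2 * \<delta>" and b="1 - \<delta>"])
      fix s :: real assume s: "1 / 4 \<le> s" "s \<le> 1 / 2"
      then have "s\<^sup>2 \<le> (1/2)\<^sup>2" by (intro power_mono) auto
      then have "(1 - s\<^sup>2) powr A \<le> MA" unfolding MA_def by (intro powr_const_bounds) (auto simp: power2_eq_square)
      moreover have "s powr a2 \<le> M2" unfolding M2_def using s by (intro powr_const_bounds) auto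
      ultimately show "(1 - s\<^sup>2) powr ((a1 + real n - 2) / 2) * s powr a2 \<le> MA * M2"
        unfolding A_def[symmetric] using pos by (intro mult_mono) auto
    next
      fix \<rho> s :: real assume \<rho>: "1 - 2 * \<delta> < \<rho>" "\<rho> < 1 - \<delta>" and s: "1 / 4 \<le> s" "s \<le> 1 / 2"
      have "s / \<rho> \<le> 2/3" "0 < s / \<rho>" using s \<rho> \<delta> by (auto simp: field_simps)
      then have "(s / \<rho>)\<^sup>2 \<le> (2/3)\<^sup>2" by (intro power_mono) auto
      moreover have "(s / \<rho>)\<^sup>2 \<ge> 0" by (rule zero_le_power2)
      ultimately show "mB \<le> (1 - (s / \<rho>)\<^sup>2) powr (real k / 2 - 1)"
        unfolding mB_def B_def[symmetric] by (intro powr_const_bounds) (simp_all add: power2_eq_square)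
    next
      fix \<rho> assume "1 - 2 * \<delta> < \<rho>" "\<rho> < 1 - \<delta>"
      then show "L * \<delta> powr (g1/2) * \<rho> \<le> sqrt (1 - \<rho>\<^sup>2) powr g1 * \<rho> powr g2"
        unfolding L_def by (rule height_near_pole[OF \<delta>])
    qed (use \<delta> pos in auto)
    then have "P * \<delta> powr (g1/2) \<le> Q" by (simp add: P_def ac_simps)
    then show ?thesis using P \<delta> by (simp add: field_simps)
  qed
  then have "0 \<le> g1/2" by (rule powr_exponent_compare[where e="1/8", rotated]) auto
  then show ?thesis by simp
qed

text \<open>Support, height and 1 are kept at mutual distances of order \<delta>, so the kernel is
  of order \<open>\<delta> powr B\<close> on an interval of length \<open>4 * \<delta>\<close>. The
  two sides scale with exponents \<open>g1 / 2 + B + 1\<close> and \<open>(A + 1) / p\<close>, and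
  twice their comparison is the claim.\<close>

lemma necessary_g1:
  assumes pr: "profile_ineq n k a1 a2 g1 g2 p C" and p: "p > 0" and n: "n \<ge> 1" and k: "k \<ge> 1"
  shows "(a1 + real n) / p - real k \<le> g1"
proof -
  define A where "A = (a1 + real n - 2) / 2"
  define B where "B = real k / 2 - 1"
  define MA where "MA = max (4 powr A) (16 powr A)"
  define M2 where "M2 = max ((1/2) powr a2) (1 powr a2)"
  define mB where "mB = min (2 powr B) (16 powr B)"
  define L where "L = min (1 powr (g1/2)) (4 powr (g1/2)) * min ((1/2) powr g2) (1 powr g2)"
  have pos: "MA > 0" "M2 > 0" "mB > 0" "L > 0"
    unfolding MA_def M2_def mB_def L_def by (intro mult_pos_pos max_powr_pos min_powr_pos; simp)+
  have kp: "slice_const n > 0" "slice_const k > 0" using slice_const_pos n k by auto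
  define P where "P = L * slice_const k * mB * 4"
  define Q where "Q = C * (8 * slice_const n * MA * M2) powr (1 / p)"
  have P: "P > 0" using pos kp by (simp add: P_def)
  have "\<delta> powr (g1/2 + B + 1) \<le> (Q / P) * \<delta> powr ((A + 1) / p)" if \<delta>: "0 < \<delta>" "\<delta> < 1/16" for \<delta>
  proof -
    have dc: "(1 - 4 * \<delta>) - (1 - 8 * \<delta>) = 4 * \<delta>" by simp
    have "(L * \<delta> powr (g1/2)) * (slice_const k * ((mB * \<delta> powr B) * ((1 - 4 * \<delta>) - (1 - 8 * \<delta>))))
       \<le> C * (2 * slice_const n * ((MA * \<delta> powr A) * M2) * ((1 - 4 * \<delta>) - (1 - 8 * \<delta>))) powr (1 / p)"
    proof (rule indicator_test[OF pr p n k, where c="1 - 8 * \<delta>" and d="1 - 4 * \<delta>" and a="1 - 2 * \<delta>" and b="1 - \<delta>"])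
      fix s :: real assume s: "1 - 8 * \<delta> \<le> s" "s \<le> 1 - 4 * \<delta>"
      have s1: "1/2 \<le> s" "s < 1" using s \<delta> by auto
      have "4 * \<delta> \<le> 1 - s\<^sup>2" "1 - s\<^sup>2 \<le> 16 * \<delta>" using one_minus_sq_bounds[of s] s s1 by auto
      then have "(1 - s\<^sup>2) powr A \<le> MA * \<delta> powr A" unfolding MA_def using \<delta> by (intro powr_between) auto
      moreover have "s powr a2 \<le> M2" unfolding M2_def using s1 by (intro powr_const_bounds) auto
      ultimately show "(1 - s\<^sup>2) powr ((a1 + real n - 2) / 2) * s powr a2 \<le> (MA * \<delta> powr A) * M2"
        unfolding A_def[symmetric] using pos by (intro mult_mono) auto
    next
      fix \<rho> s :: real assume \<rho>: "1 - 2 * \<delta> < \<rho>" "\<rho> < 1 - \<delta>" and s: "1 - 8 * \<delta> \<le> s" "s \<le> 1 - 4 * \<delta>"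
      have r: "7/8 < \<rho>" "\<rho> < 1" "s > 0" using \<rho> s \<delta> by auto
      define t where "t = s / \<rho>"
      have t0: "0 \<le> t" "t < 1" using r s \<rho> \<delta> by (auto simp: t_def field_simps)
      have e: "1 - t = (\<rho> - s) / \<rho>" using r by (simp add: t_def field_simps)
      have "2 * \<delta> * \<rho> \<le> 2 * \<delta> * 1" using r \<delta> by (intro mult_left_mono) auto
      then have "2 * \<delta> * \<rho> \<le> \<rho> - s" using s \<rho> by linarith
      then have l: "2 * \<delta> \<le> 1 - t" unfolding e using r by (simp add: pos_le_divide_eq)
      have "8 * \<delta> * (7/8) \<le> 8 * \<delta> * \<rho>" using r \<delta> by (intro mult_left_mono) auto
      then have "\<rho> - s \<le> 8 * \<delta> * \<rho>" using s \<rho> by linarith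
      then have u: "1 - t \<le> 8 * \<delta>" unfolding e using r by (simp add: pos_divide_le_eq)
      have "2 * \<delta> \<le> 1 - t\<^sup>2" "1 - t\<^sup>2 \<le> 16 * \<delta>" using one_minus_sq_bounds[OF t0] l u by auto
      then show "mB * \<delta> powr B \<le> (1 - (s / \<rho>)\<^sup>2) powr (real k / 2 - 1)"
        unfolding mB_def B_def[symmetric] t_def[symmetric] using \<delta> by (intro powr_between) auto
    next
      fix \<rho> assume "1 - 2 * \<delta> < \<rho>" "\<rho> < 1 - \<delta>"
      then show "L * \<delta> powr (g1/2) * \<rho> \<le> sqrt (1 - \<rho>\<^sup>2) powr g1 * \<rho> powr g2"
        unfolding L_def using \<delta> by (intro height_near_pole) auto
    qed (use \<delta> pos in auto)
    also have "2 * slice_const n * ((MA * \<delta> powr A) * M2) * ((1 - 4 * \<delta>) - (1 - 8 * \<delta>)) = (8 * slice_const n * MA * M2) * \<delta> powr (A + 1)"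
      unfolding dc using \<delta> by (simp add: powr_add)
    also have "C * \<dots> powr (1 / p) = Q * \<delta> powr ((A + 1) / p)"
      unfolding Q_def powr_mult[of "8 * slice_const n * MA * M2"] powr_powr by simp
    also have "(L * \<delta> powr (g1/2)) * (slice_const k * ((mB * \<delta> powr B) * ((1 - 4 * \<delta>) - (1 - 8 * \<delta>)))) = P * \<delta> powr (g1/2 + B + 1)"
      unfolding dc using \<delta> by (simp add: P_def powr_add)
    finally show ?thesis using P by (simp add: field_simps)
  qed
  then have "(A + 1) / p \<le> g1/2 + B + 1" by (rule powr_exponent_compare[where e="1/16", rotated]) auto
  moreover have "(A + 1) / p = (a1 + real n) / p / 2" by (simp add: A_def field_simps)
  ultimately show ?thesis by (simp add: B_def)
qed

text \<open>The kernel for \<open>k = 1\<close> has a square root singularity, which is not in the dual of \<open>L\<^sup>p\<close>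
  for \<open>p \<le> 2\<close>. It is tested with its own truncation at distance \<open>\<epsilon>\<close>, chosen so that its
  \<open>L\<^sup>2\<close> norm is \<open>l\<close>; its \<open>L\<^sup>p\<close> norm is then \<open>O(l)\<close>, while the transform is of order \<open>l\<^sup>2\<close>.\<close>
lemma necessary_p:
  assumes pr: "profile_ineq n 1 a1 a2 g1 g2 p C" and p: "p \<ge> 1" and n: "n \<ge> 1"
  shows "p > 2"
proof (rule ccontr)
  assume "\<not> p > 2"
  then have p2: "p \<le> 2" by simp
  define A where "A = (a1 + real n - 2) / 2"
  define MA where "MA = max ((3/4) powr A) (1 powr A)"
  define M2 where "M2 = max ((1/4) powr a2) ((1/2) powr a2)"
  define L1 where "L1 = min ((1/4) powr (g1/2)) (1 powr (g1/2))"
  define L2 where "L2 = min ((1/2) powr g2) (1 powr g2)"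
  have pos: "MA > 0" "M2 > 0" "L1 > 0" "L2 > 0"
    unfolding MA_def M2_def L1_def L2_def by (intro max_powr_pos min_powr_pos; simp)+
  have kp: "slice_const n > 0" "slice_const 1 > 0" using slice_const_pos[OF n] slice_const_pos[of 1] by auto
  \<comment> \<open>The 8 comes from
    \<open>1 - t\<^sup>2 \<le> 2 * (1 - t) \<le> 8 * (1/2 - s)\<close> for
    \<open>t = s / \<rho>\<close>, where \<rho> exceeds 1/2 by less than \<epsilon>.\<close>
  define c8 :: real where "c8 = 8 powr (-1/2)"
  have c8: "c8 > 0" by (simp add: c8_def)
  define P where "P = L1 * L2 * slice_const 1 * c8"
  define Q where "Q = C * (4 * slice_const n * MA * M2) powr (1 / p)"
  have P: "P > 0" using pos kp c8 by (simp add: P_def)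
  have bound: "P * l\<^sup>2 \<le> Q * l" if l: "l \<ge> 1" for l
  proof -
    \<comment> \<open>The square of \<open>F\<close> integrates to a logarithm,
      \<open>ln (1 / (4 * \<epsilon>))\<close> on an interval starting at 1/4, and this is to equal
      \<open>l\<^sup>2\<close>.\<close>
    define \<epsilon> where "\<epsilon> = exp (- l\<^sup>2) / 4"
    have \<epsilon>: "0 < \<epsilon>" "\<epsilon> < 1/4" using l by (auto simp: \<epsilon>_def)
    define F where "F s = indicator {1/4..1/2 - \<epsilon>} \<bar>s\<bar> * (1/2 - \<bar>s\<bar>) powr (-1/2)" for s :: real
    define r where "r s = 1 / (1/2 - s)" for s :: real
    have [measurable]: "F \<in> borel_measurable borel" "r \<in> borel_measurable borel" unfolding F_def r_def by measurable
    have "(\<integral>\<^sup>+s. ennreal (r s) * indicator {1/4..1/2 - \<epsilon>} s \<partial>lborel) = ennreal (- ln (1/2 - (1/2 - \<epsilon>)) - (- ln (1/2 - 1/4)))"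
      by (rule nn_integral_FTC_Icc) (use \<epsilon> in \<open>auto simp: r_def intro!: derivative_eq_intros\<close>)
    also have "- ln (1/2 - (1/2 - \<epsilon>)) - (- ln (1/2 - 1/4)) = l\<^sup>2"
      by (simp add: \<epsilon>_def ln_div)
    finally have R: "(\<integral>\<^sup>+s. ennreal (r s) * indicator {1/4..1/2 - \<epsilon>} s \<partial>lborel) = ennreal (l\<^sup>2)" .
    have "(L1 * L2) * (slice_const 1 * (c8 * l\<^sup>2)) \<le> C * (2 * slice_const n * (MA * M2) * (2 * l powr p)) powr (1 / p)"
    proof (rule profile_test[where F=F and c="1/4" and d="1/2 - \<epsilon>" and a="1/2" and b="1/2 + \<epsilon>" and h="\<lambda>s. c8 * r s", OF pr _ n])
      show "(\<integral>\<^sup>+s. ennreal (F s powr p) * indicator {1/4..1/2 - \<epsilon>} s \<partial>lborel) \<le> ennreal (2 * l powr p)"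
      proof -
        have "(\<integral>\<^sup>+s. ennreal (F s powr p) * indicator {1/4..1/2 - \<epsilon>} s \<partial>lborel)
          \<le> (\<integral>\<^sup>+s. ennreal (l powr (p - 2)) * (ennreal (r s) * indicator {1/4..1/2 - \<epsilon>} s) + ennreal (l powr p) * indicator {1/4..1/2 - \<epsilon>} s \<partial>lborel)"
        proof (rule nn_integral_mono)
          fix s :: real
          show "ennreal (F s powr p) * indicator {1/4..1/2 - \<epsilon>} s \<le> ennreal (l powr (p - 2)) * (ennreal (r s) * indicator {1/4..1/2 - \<epsilon>} s) + ennreal (l powr p) * indicator {1/4..1/2 - \<epsilon>} s"
          proof (cases "1/4 \<le> s \<and> s \<le> 1/2 - \<epsilon>")
            case True
            define x where "x = 1/2 - s"
            have x: "x > 0" using True \<epsilon> by (simp add: x_def)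
            define y where "y = x powr (-1/2)"
            have "y powr 2 = x powr (-1/2 * 2)" unfolding y_def by (rule powr_powr)
            then have y: "y > 0" "y powr 2 = r s" using x by (simp_all add: y_def r_def x_def[symmetric] powr_minus_divide)
            have Fy: "F s = y" using True by (simp add: F_def y_def x_def)
            \<comment> \<open>Values up to \<open>l\<close> are bounded by \<open>l\<close>; for
              larger ones \<open>p \<le> 2\<close> allows \<open>y powr (p - 2)\<close> to be
              replaced by \<open>l powr (p - 2)\<close>. As \<open>y powr 2\<close> integrates to
              \<open>l\<^sup>2\<close>, each term contributes at most
              \<open>l powr p\<close>.\<close>
            have "y powr p \<le> l powr (p - 2) * y powr 2 + l powr p"
            proof (cases "y \<le> l")
              case True
              then have "y powr p \<le> l powr p" using y p by (intro powr_mono2) auto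
              then show ?thesis by (simp add: add_increasing)
            next
              case False
              have "y powr p = y powr (p - 2) * y powr 2" by (simp add: powr_add[symmetric])
              also have "\<dots> \<le> l powr (p - 2) * y powr 2"
                using False l p2 by (intro mult_right_mono powr_mono2') auto
              finally show ?thesis by (simp add: add_increasing2)
            qed
            then have "ennreal (F s powr p) \<le> ennreal (l powr (p - 2) * r s + l powr p)"
              unfolding Fy y(2) by (rule ennreal_leI)
            also have "\<dots> = ennreal (l powr (p - 2)) * ennreal (r s) + ennreal (l powr p)"
              using y by (subst ennreal_plus) (auto simp: ennreal_mult y(2)[symmetric])
            finally show ?thesis using True by simp
          qed (auto simp: indicator_def)
        qed
        also have "\<dots> = ennreal (l powr (p - 2)) * ennreal (l\<^sup>2) + ennreal (l powr p) * ennreal (1/2 - \<epsilon> - 1/4)"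
          using \<epsilon> by (subst nn_integral_add) (auto simp: nn_integral_cmult R nn_integral_cmult_indicator)
        also have "\<dots> \<le> ennreal (l powr (p - 2)) * ennreal (l\<^sup>2) + ennreal (l powr p) * ennreal 1"
          using \<epsilon> by (intro add_left_mono mult_left_mono ennreal_leI) auto
        also have "ennreal (l powr (p - 2)) * ennreal (l\<^sup>2) = ennreal (l powr p)"
          using l by (subst ennreal_mult[symmetric]) (auto simp: powr_diff)
        also have "ennreal (l powr p) + ennreal (l powr p) * ennreal 1 = ennreal (2 * l powr p)"
          by (simp add: ennreal_plus[symmetric] del: ennreal_plus)
        finally show ?thesis .
      qed
      have "(\<integral>\<^sup>+s. ennreal (c8 * r s) * indicator {1/4..1/2 - \<epsilon>} s \<partial>lborel) = (\<integral>\<^sup>+s. ennreal c8 * (ennreal (r s) * indicator {1/4..1/2 - \<epsilon>} s) \<partial>lborel)"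
        using c8 \<epsilon> by (intro nn_integral_cong) (auto simp: indicator_def r_def ennreal_mult[symmetric])
      also have "\<dots> = ennreal (c8 * l\<^sup>2)"
        using c8 by (simp add: nn_integral_cmult R ennreal_mult)
      finally show "ennreal (c8 * l\<^sup>2) \<le> (\<integral>\<^sup>+s. ennreal (c8 * r s) * indicator {1/4..1/2 - \<epsilon>} s \<partial>lborel)" by simp
      fix \<rho> :: real assume \<rho>: "1/2 < \<rho>" "\<rho> < 1/2 + \<epsilon>"
      show "c8 * r s \<le> F s * (1 - (s / \<rho>)\<^sup>2) powr (real 1 / 2 - 1)" if s: "1/4 \<le> s" "s \<le> 1/2 - \<epsilon>" for s
      proof -
        define x where "x = 1/2 - s"
        have x: "x > 0" "\<epsilon> \<le> x" using s \<epsilon> by (auto simp: x_def)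
        define t where "t = s / \<rho>"
        have t0: "0 \<le> t" "t < 1" using s \<rho> \<epsilon> by (auto simp: t_def field_simps)
        have "1 - t = (\<rho> - s) / \<rho>" using \<rho> by (simp add: t_def field_simps)
        also have "\<dots> \<le> (2 * x) / \<rho>" using \<rho> x by (intro divide_right_mono) (auto simp: x_def)
        also have "\<dots> \<le> (2 * x) / (1/2)" using \<rho> x by (intro divide_left_mono) auto
        finally have "1 - t\<^sup>2 \<le> 8 * x" using one_minus_sq_bounds(2)[OF t0] by simp
        moreover have "0 < 1 - t\<^sup>2" using one_minus_sq_bounds(1)[OF t0] t0 by simp
        ultimately have "(8 * x) powr (-1/2) \<le> (1 - t\<^sup>2) powr (-1/2)" by (intro powr_mono2') auto
        then have "x powr (-1/2) * (8 * x) powr (-1/2) \<le> x powr (-1/2) * (1 - t\<^sup>2) powr (-1/2)"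
          by (intro mult_left_mono) auto
        moreover have "x powr (-1/2) * (8 * x) powr (-1/2) = c8 * r s"
        proof -
          have "x powr (-1/2) * x powr (-1/2) = 1 / x" using x by (simp add: powr_add[symmetric] powr_minus_divide)
          moreover have "x powr (-1/2) * (8 * x) powr (-1/2) = c8 * (x powr (-1/2) * x powr (-1/2))"
            unfolding c8_def powr_mult by (simp only: ac_simps)
          ultimately show ?thesis by (simp add: r_def x_def[symmetric])
        qed
        ultimately show ?thesis using s by (simp add: F_def x_def t_def)
      qed
      have r1: "1/2 \<le> \<rho>" "\<rho> \<le> 3/4" using \<rho> \<epsilon> by auto
      then have "\<rho>\<^sup>2 \<le> (3/4)\<^sup>2" by (intro power_mono) auto
      then have "1/4 \<le> 1 - \<rho>\<^sup>2" by (simp add: power_divide)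
      then have "L1 \<le> sqrt (1 - \<rho>\<^sup>2) powr g1"
        unfolding L1_def by (subst sqrt_powr, linarith, intro powr_const_bounds) auto
      moreover have "L2 \<le> \<rho> powr g2" unfolding L2_def using r1 by (intro powr_const_bounds) auto
      ultimately have "(L1 * L2) * \<rho> \<le> (sqrt (1 - \<rho>\<^sup>2) powr g1 * \<rho> powr g2) * 1"
        using pos r1 by (intro mult_mono) (auto intro: mult_nonneg_nonneg)
      then show "L1 * L2 * \<rho> \<le> sqrt (1 - \<rho>\<^sup>2) powr g1 * \<rho> powr g2" by simp
    next
      fix s :: real assume s: "1/4 \<le> s" "s \<le> 1/2 - \<epsilon>"
      have s2: "s \<le> 1/2" using s \<epsilon> by simp
      then have "s\<^sup>2 \<le> (1/2)\<^sup>2" using s by (intro power_mono) auto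
      then have "(1 - s\<^sup>2) powr A \<le> MA" unfolding MA_def by (intro powr_const_bounds) (auto simp: power2_eq_square)
      moreover have "s powr a2 \<le> M2" unfolding M2_def using s s2 by (intro powr_const_bounds) auto
      ultimately show "(1 - s\<^sup>2) powr ((a1 + real n - 2) / 2) * s powr a2 \<le> MA * M2"
        unfolding A_def[symmetric] using pos by (intro mult_mono) auto
    qed (use \<epsilon> pos p c8 in \<open>auto simp: F_def indicator_def\<close>)
    also have "2 * slice_const n * (MA * M2) * (2 * l powr p) = (4 * slice_const n * MA * M2) * l powr p" by simp
    also have "C * \<dots> powr (1 / p) = Q * l"
      unfolding Q_def powr_mult[of "4 * slice_const n * MA * M2"] powr_powr using l p by simp
    also have "(L1 * L2) * (slice_const 1 * (c8 * l\<^sup>2)) = P * l\<^sup>2" by (simp add: P_def ac_simps)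
    finally show ?thesis .
  qed
  \<comment> \<open>A quantity of order \<open>l\<^sup>2\<close> cannot stay below one of order
    \<open>l\<close> once \<open>l\<close> exceeds \<open>Q / P\<close>.\<close>
  define l where "l = max 1 (Q / P + 1)"
  have l: "l \<ge> 1" "l > Q / P" by (auto simp: l_def)
  have "P * l \<le> Q" using bound[OF l(1)] l by (simp add: power2_eq_square mult.assoc[symmetric])
  moreover have "Q < P * l" using l(2) P by (simp add: divide_less_eq mult.commute)
  ultimately show False by simp
qed

theorem theorem4p10:
  fixes n k :: nat and a1 a2 g1 g2 p :: real
  assumes "n \<ge> 2" and "1 \<le> k" and "k \<le> n - 1"
    and "p \<ge> max 1 (1 + a2)"
    and "a2 > 0 \<longrightarrow> p > 1 + a2"
    and "p = (a1 + real n) / real k \<longrightarrow> g1 > 0"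
  shows "(k \<ge> 2 \<longrightarrow> (ineq_star n k a1 a2 g1 g2 p \<longleftrightarrow>
              g1 \<ge> max 0 ((a1 + real n) / p - real k) \<and> g2 \<ge> (1 + a2) / p))
       \<and> (k = 1 \<longrightarrow> (ineq_star n k a1 a2 g1 g2 p \<longleftrightarrow>
              g1 \<ge> max 0 ((a1 + real n) / p - real k) \<and> g2 \<ge> (1 + a2) / p \<and> p > 2))"
proof -
  have kn: "Suc k \<le> n" using assms(1,3) by simp
  have n1: "n \<ge> 1" using assms(1) by simp
  have p: "p \<ge> 1" "p \<ge> 1 + a2" "p > 0" using assms(4) by auto
  have nec: "g1 \<ge> max 0 ((a1 + real n) / p - real k) \<and> g2 \<ge> (1 + a2) / p \<and> (k = 1 \<longrightarrow> p > 2)"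
    if star: "ineq_star n k a1 a2 g1 g2 p"
  proof -
    obtain C where pr: "profile_ineq n k a1 a2 g1 g2 p C"
      using profile_if_ineq_star[OF assms(2) kn star] by blast
    show ?thesis
      using necessary_g1_nonneg[OF pr p(3) n1 assms(2)] necessary_g1[OF pr p(3) n1 assms(2)]
        necessary_g2[OF pr p(3) n1 assms(2)] necessary_p[of n a1 a2 g1 g2 p C] pr p(1) n1 by auto
  qed
  have suf: "ineq_star n k a1 a2 g1 g2 p"
    if "g1 \<ge> max 0 ((a1 + real n) / p - real k)" "g2 \<ge> (1 + a2) / p" "k = 1 \<longrightarrow> p > 2"
    using that assms p kn by (intro ineq_star_sufficient) auto
  show ?thesis
  proof (intro conjI impI)
    assume "k \<ge> 2"
    then have "k \<noteq> 1" by simp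
    then show "ineq_star n k a1 a2 g1 g2 p \<longleftrightarrow> g1 \<ge> max 0 ((a1 + real n) / p - real k) \<and> g2 \<ge> (1 + a2) / p"
      using nec suf by blast
  next
    assume "k = 1"
    then show "ineq_star n k a1 a2 g1 g2 p \<longleftrightarrow> g1 \<ge> max 0 ((a1 + real n) / p - real k) \<and> g2 \<ge> (1 + a2) / p \<and> p > 2"
      using nec suf by blast
  qed
qed

end
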